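(* Let $M$ be a manifold and let $\mathcal{F}$ be a singular foliation of $M$. Then there exists a D-connected subgroup $G$ of the diffeomorphism group $\operatorname{Diff}(M)$ such that $\mathcal{F}$ is the partition of $M$ into the orbits of $G$.
   Context: A manifold is a set with a maximal smooth atlas whose topology is Hausdorff and second-countable. Singular foliation: A subset $L\subseteq M$ is a diffeological submanifold if its subspace diffeology (a map $q:O\to L$ from an open subset $O$ of a Cartesian space is a plot iff $q$ is smooth as a map into $M$) is a manifold diffeology, i.e. there is a (necessarily unique) manifold structure on $L$ whose smooth maps $O\to L$ are exactly these plots; $L$ always carries this manifold structure. It is weakly-embedded if moreover the inclusion $L\hookrightarrow M$ is an immersion. A (Stefan) singular foliation of an $n$-dimensional manifold $M$ is a partition $\mathcal{F}$ of $M$ into connected, weakly-embedded submanifolds, called leaves, such that about each $x\in M$ there is a chart $\psi$ of $M$ with: (a) $\psi$ is a diffeomorphism $V\to U\times W$, where $V$ is an open neighbourhood of $x$, $U$ and $W$ are open neighbourhoods of the origin in $\mathbb{R}^k$ and $\mathbb{R}^{n-k}$, and $k$ is the dimension of the leaf through $x$; (b) $\psi(x)=(0,0)$; (c) for every leaf $L$ of $\mathcal{F}$, $\psi(L\cap V)=U\times\ell$ for some $\ell\subseteq W$. $\operatorname{Diff}(M)$ carries its functional (group) diffeology: a map $P:O\to\operatorname{Diff}(M)$, with $O$ an open subset of a Cartesian space, is a plot iff $(r,x)\mapsto P(r)(x)$ and $(r,x)\mapsto P(r)^{-1}(x)$ are smooth maps $O\times M\to M$. A subgroup $G$ carries the subspace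 diffeology (plots of $\operatorname{Diff}(M)$ with values in $G$). The D-topology of a diffeological space is the finest topology for which all plots are continuous; $G$ is D-connected if it is connected in its D-topology (equivalently, any two elements can be joined by a smooth path, i.e. a plot $\mathbb{R}\to G$). *)

theory Defs
  imports "HOL-Analysis.Analysis" "HOL-Algebra.Bij" "HOL-Algebra.Group_Action"
begin

section \<open>Smooth functions on Cartesian spaces\<close>

text \<open>
  The Cartesian space of dimension m is \<^term>\<open>Euclidean_space m\<close>: the sequences
  \<^typ>\<open>nat \<Rightarrow> real\<close> vanishing at all indices from m on.  This allows quantification over
  dimensions.
\<close>

definition partial :: "nat \<Rightarrow> ((nat \<Rightarrow> real) \<Rightarrow> real) \<Rightarrow> (nat \<Rightarrow> real) \<Rightarrow> real" where
  "partial i f x = deriv (\<lambda>t. f (x(i := t))) (x i)"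

definition iter_partial :: "nat list \<Rightarrow> ((nat \<Rightarrow> real) \<Rightarrow> real) \<Rightarrow> (nat \<Rightarrow> real) \<Rightarrow> real" where
  "iter_partial is f = foldr partial is f"

text \<open>
  On an open subset \<open>S\<close> of the m-dimensional Cartesian space: all iterated partial derivatives
  of \<open>f\<close>, including \<open>f\<close> itself, exist and are continuous on \<open>S\<close>.  The explicit differentiability
  clause is needed because \<^const>\<open>deriv\<close> is total.
\<close>

definition smooth_fun :: "nat \<Rightarrow> (nat \<Rightarrow> real) set \<Rightarrow> ((nat \<Rightarrow> real) \<Rightarrow> real) \<Rightarrow> bool" where
  "smooth_fun m S f \<longleftrightarrow>
     (\<forall>is. set is \<subseteq> {..<m} \<longrightarrow>
        continuous_map (subtopology (Euclidean_space m) S) euclideanreal (iter_partial is f) \<and>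
        (\<forall>x\<in>S. \<forall>i<m. (\<lambda>t. iter_partial is f (x(i := t))) differentiable (at (x i))))"

definition smooth_cart ::
    "nat \<Rightarrow> (nat \<Rightarrow> real) set \<Rightarrow> nat \<Rightarrow> ((nat \<Rightarrow> real) \<Rightarrow> nat \<Rightarrow> real) \<Rightarrow> bool" where
  "smooth_cart m S n f \<longleftrightarrow>
     f ` S \<subseteq> topspace (Euclidean_space n) \<and> (\<forall>j<n. smooth_fun m S (\<lambda>x. f x j))"

text \<open>The identification of \<open>\<real>\<^sup>k \<times> \<real>\<^sup>l\<close> with \<open>\<real>\<^sup>k\<^sup>+\<^sup>l\<close>.\<close>

definition cat :: "nat \<Rightarrow> (nat \<Rightarrow> real) \<Rightarrow> (nat \<Rightarrow> real) \<Rightarrow> nat \<Rightarrow> real" where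
  "cat k u v = (\<lambda>i. if i < k then u i else v (i - k))"


section \<open>Manifolds\<close>

text \<open>
  A chart is a pair of its domain and its map, the latter extensional, i.e. \<^const>\<open>undefined\<close>
  outside the domain.  A manifold structure is therefore literally determined by the charts in its
  maximal atlas.
\<close>

type_synonym 'a chart = "'a set \<times> ('a \<Rightarrow> nat \<Rightarrow> real)"

record 'a mfd =
  points :: "'a set"
  mdim :: nat
  atlas :: "'a chart set"

definition is_chart :: "nat \<Rightarrow> 'a set \<Rightarrow> 'a chart \<Rightarrow> bool" where
  "is_chart n X = (\<lambda>(D, \<phi>). D \<subseteq> X \<and> \<phi> \<in> extensional D \<and> inj_on \<phi> D \<and>
                            openin (Euclidean_space n) (\<phi> ` D))"

definition compatible :: "nat \<Rightarrow> 'a chart \<Rightarrow> 'a chart \<Rightarrow> bool" where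
  "compatible n = (\<lambda>(D, \<phi>). \<lambda>(E, \<xi>).
     openin (Euclidean_space n) (\<phi> ` (D \<inter> E)) \<and>
     openin (Euclidean_space n) (\<xi> ` (D \<inter> E)) \<and>
     smooth_cart n (\<phi> ` (D \<inter> E)) n (\<xi> \<circ> inv_into D \<phi>) \<and>
     smooth_cart n (\<xi> ` (D \<inter> E)) n (\<phi> \<circ> inv_into E \<xi>))"

definition smooth_atlas :: "nat \<Rightarrow> 'a set \<Rightarrow> 'a chart set \<Rightarrow> bool" where
  "smooth_atlas n X A \<longleftrightarrow>
     (\<forall>c\<in>A. is_chart n X c) \<and> (\<Union>(fst ` A) = X) \<and> (\<forall>c\<in>A. \<forall>c'\<in>A. compatible n c c')"

definition maximal_atlas :: "nat \<Rightarrow> 'a set \<Rightarrow> 'a chart set \<Rightarrow> 'a chart set" where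
  "maximal_atlas n X A = {c. is_chart n X c \<and> (\<forall>c'\<in>A. compatible n c c')}"

definition mfd_topology :: "'a mfd \<Rightarrow> 'a topology" where
  "mfd_topology M = topology (\<lambda>U. U \<subseteq> points M \<and>
     (\<forall>(D, \<phi>)\<in>atlas M. openin (Euclidean_space (mdim M)) (\<phi> ` (U \<inter> D))))"

definition manifold :: "'a mfd \<Rightarrow> bool" where
  "manifold M \<longleftrightarrow>
     smooth_atlas (mdim M) (points M) (atlas M) \<and>
     maximal_atlas (mdim M) (points M) (atlas M) = atlas M \<and>
     Hausdorff_space (mfd_topology M) \<and>
     second_countable (mfd_topology M)"

lemma openin_mfd_topology:
  assumes "smooth_atlas (mdim M) (points M) (atlas M)"
  shows "openin (mfd_topology M) U \<longleftrightarrow> U \<subseteq> points M \<and>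
     (\<forall>(D, \<phi>)\<in>atlas M. openin (Euclidean_space (mdim M)) (\<phi> ` (U \<inter> D)))"
proof -
  let ?P = "\<lambda>U. U \<subseteq> points M \<and>
     (\<forall>(D, \<phi>)\<in>atlas M. openin (Euclidean_space (mdim M)) (\<phi> ` (U \<inter> D)))"
  have "istopology ?P"
    unfolding istopology_def
  proof (intro conjI allI impI)
    fix S T assume S: "?P S" and T: "?P T"
    show "S \<inter> T \<subseteq> points M" using S by blast
    show "\<forall>(D, \<phi>)\<in>atlas M. openin (Euclidean_space (mdim M)) (\<phi> ` ((S \<inter> T) \<inter> D))"
    proof clarify
      fix D \<phi> assume c: "(D, \<phi>) \<in> atlas M"
      then have "inj_on \<phi> D"
        using assms by (auto simp: smooth_atlas_def is_chart_def)
      then have "\<phi> ` ((S \<inter> T) \<inter> D) = \<phi> ` (S \<inter> D) \<inter> \<phi> ` (T \<inter> D)"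
        by (auto simp: inj_on_def)
      then show "openin (Euclidean_space (mdim M)) (\<phi> ` ((S \<inter> T) \<inter> D))"
        using S T c by auto
    qed
  next
    fix K assume K: "\<forall>S\<in>K. ?P S"
    then show "\<Union>K \<subseteq> points M" by blast
    show "\<forall>(D, \<phi>)\<in>atlas M. openin (Euclidean_space (mdim M)) (\<phi> ` (\<Union>K \<inter> D))"
    proof clarify
      fix D \<phi> assume c: "(D, \<phi>) \<in> atlas M"
      have "\<phi> ` (\<Union>K \<inter> D) = \<Union>((\<lambda>S. \<phi> ` (S \<inter> D)) ` K)" by auto
      also have "openin (Euclidean_space (mdim M)) \<dots>"
        using K c by (intro openin_Union) auto
      finally show "openin (Euclidean_space (mdim M)) (\<phi> ` (\<Union>K \<inter> D))" .
    qed
  qed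
  then show ?thesis
    by (simp add: mfd_topology_def topology_inverse')
qed

lemma topspace_mfd_topology:
  assumes "smooth_atlas (mdim M) (points M) (atlas M)"
  shows "topspace (mfd_topology M) = points M"
proof -
  have "D \<subseteq> points M" if "(D, \<phi>) \<in> atlas M" for D \<phi>
    using assms that by (auto simp: smooth_atlas_def is_chart_def)
  then have "openin (mfd_topology M) (points M)"
    using assms
    by (auto simp: openin_mfd_topology Int_absorb1 smooth_atlas_def is_chart_def)
  then show ?thesis
    using assms by (meson openin_mfd_topology openin_subset openin_topspace subset_antisym)
qed

definition cart_mfd :: "nat \<Rightarrow> (nat \<Rightarrow> real) set \<Rightarrow> (nat \<Rightarrow> real) mfd" where
  "cart_mfd m S = \<lparr>points = S, mdim = m, atlas = maximal_atlas m S {(S, \<lambda>x\<in>S. x)}\<rparr>"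

definition prod_mfd :: "'a mfd \<Rightarrow> 'b mfd \<Rightarrow> ('a \<times> 'b) mfd" where
  "prod_mfd M N =
     \<lparr>points = points M \<times> points N, mdim = mdim M + mdim N,
      atlas = maximal_atlas (mdim M + mdim N) (points M \<times> points N)
        {(D \<times> E, \<lambda>(x, y)\<in>D \<times> E. cat (mdim M) (\<phi> x) (\<xi> y)) |D \<phi> E \<xi>.
           (D, \<phi>) \<in> atlas M \<and> (E, \<xi>) \<in> atlas N}\<rparr>"

definition smooth_map :: "'a mfd \<Rightarrow> 'b mfd \<Rightarrow> ('a \<Rightarrow> 'b) \<Rightarrow> bool" where
  "smooth_map M N f \<longleftrightarrow>
     f ` points M \<subseteq> points N \<and>
     (\<forall>x\<in>points M. \<exists>(D, \<phi>)\<in>atlas M. \<exists>(E, \<xi>)\<in>atlas N.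
        x \<in> D \<and> f ` D \<subseteq> E \<and>
        smooth_cart (mdim M) (\<phi> ` D) (mdim N) (\<xi> \<circ> f \<circ> inv_into D \<phi>))"

text \<open>The differential is injective at every point; in charts, the kernel of the Jacobian matrix
  is trivial.\<close>

definition immersion :: "'a mfd \<Rightarrow> 'b mfd \<Rightarrow> ('a \<Rightarrow> 'b) \<Rightarrow> bool" where
  "immersion M N f \<longleftrightarrow>
     smooth_map M N f \<and>
     (\<forall>x\<in>points M. \<forall>(D, \<phi>)\<in>atlas M. \<forall>(E, \<xi>)\<in>atlas N. x \<in> D \<and> f x \<in> E \<longrightarrow>
        (\<forall>v :: nat \<Rightarrow> real.
           (\<forall>j<mdim N. (\<Sum>i<mdim M. partial i (\<lambda>z. (\<xi> \<circ> f \<circ> inv_into D \<phi>) z j) (\<phi> x) * v i) = 0)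
           \<longrightarrow> (\<forall>i<mdim M. v i = 0)))"


section \<open>Diffeologies\<close>

text \<open>
  A diffeology is represented by the set of its plots; \<open>(m, S, p)\<close> stands for the plot \<open>p\<close> from
  the open subset \<open>S\<close> of the m-dimensional Cartesian space.  The values of \<open>p\<close> outside \<open>S\<close> are
  irrelevant.
\<close>

type_synonym 'a diffeology = "(nat \<times> (nat \<Rightarrow> real) set \<times> ((nat \<Rightarrow> real) \<Rightarrow> 'a)) set"

definition subspace_diffeology :: "'a diffeology \<Rightarrow> 'a set \<Rightarrow> 'a diffeology" where
  "subspace_diffeology \<D> Y = {(m, S, p) \<in> \<D>. p ` S \<subseteq> Y}"

definition manifold_diffeology :: "'a mfd \<Rightarrow> 'a diffeology" where
  "manifold_diffeology M =
     {(m, S, p). openin (Euclidean_space m) S \<and> smooth_map (cart_mfd m S) M p}"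

text \<open>The finest topology on \<open>X\<close> making all plots continuous.\<close>

definition D_topology :: "'a set \<Rightarrow> 'a diffeology \<Rightarrow> 'a topology" where
  "D_topology X \<D> = topology (\<lambda>U. U \<subseteq> X \<and>
     (\<forall>(m, S, p)\<in>\<D>. openin (Euclidean_space m) {r \<in> S. p r \<in> U}))"

lemma openin_D_topology:
  "openin (D_topology X \<D>) U \<longleftrightarrow> U \<subseteq> X \<and>
     (\<forall>(m, S, p)\<in>\<D>. openin (Euclidean_space m) {r \<in> S. p r \<in> U})"
proof -
  let ?P = "\<lambda>U. U \<subseteq> X \<and> (\<forall>(m, S, p)\<in>\<D>. openin (Euclidean_space m) {r \<in> S. p r \<in> U})"
  have "istopology ?P"
    unfolding istopology_def
  proof (intro conjI allI impI)
    fix A B assume A: "?P A" and B: "?P B"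
    show "A \<inter> B \<subseteq> X" using A by blast
    show "\<forall>(m, S, p)\<in>\<D>. openin (Euclidean_space m) {r \<in> S. p r \<in> A \<inter> B}"
    proof clarify
      fix m S p assume "(m, S, p) \<in> \<D>"
      moreover have "{r \<in> S. p r \<in> A \<inter> B} = {r \<in> S. p r \<in> A} \<inter> {r \<in> S. p r \<in> B}" by auto
      ultimately show "openin (Euclidean_space m) {r \<in> S. p r \<in> A \<inter> B}"
        using A B by auto
    qed
  next
    fix K assume K: "\<forall>A\<in>K. ?P A"
    then show "\<Union>K \<subseteq> X" by blast
    show "\<forall>(m, S, p)\<in>\<D>. openin (Euclidean_space m) {r \<in> S. p r \<in> \<Union>K}"
    proof clarify
      fix m S p assume c: "(m, S, p) \<in> \<D>"
      have "{r \<in> S. p r \<in> \<Union>K} = \<Union>((\<lambda>A. {r \<in> S. p r \<in> A}) ` K)" by auto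
      also have "openin (Euclidean_space m) \<dots>"
        using K c by (intro openin_Union) auto
      finally show "openin (Euclidean_space m) {r \<in> S. p r \<in> \<Union>K}" .
    qed
  qed
  then show ?thesis
    by (simp add: D_topology_def topology_inverse')
qed

definition D_connected :: "'a set \<Rightarrow> 'a diffeology \<Rightarrow> bool" where
  "D_connected X \<D> \<longleftrightarrow> connected_space (D_topology X \<D>)"


section \<open>Singular foliations\<close>

definition submanifold_structure :: "'a mfd \<Rightarrow> 'a set \<Rightarrow> 'a mfd \<Rightarrow> bool" where
  "submanifold_structure M L N \<longleftrightarrow>
     manifold N \<and> points N = L \<and>
     manifold_diffeology N = subspace_diffeology (manifold_diffeology M) L"

definition diffeological_submanifold :: "'a mfd \<Rightarrow> 'a set \<Rightarrow> bool" where
  "diffeological_submanifold M L \<longleftrightarrow> L \<subseteq> points M \<and> (\<exists>N. submanifold_structure M L N)"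

text \<open>For nonempty \<open>L\<close> there is at most one such structure, since a manifold is determined by its
  smooth parametrizations; hence the choice is no choice.\<close>

definition submfd :: "'a mfd \<Rightarrow> 'a set \<Rightarrow> 'a mfd" where
  "submfd M L = (SOME N. submanifold_structure M L N)"

definition weakly_embedded :: "'a mfd \<Rightarrow> 'a set \<Rightarrow> bool" where
  "weakly_embedded M L \<longleftrightarrow>
     diffeological_submanifold M L \<and> immersion (submfd M L) M (\<lambda>x. x)"

text \<open>
  In the chart condition, \<open>L\<^sub>x\<close> is the leaf through \<open>x\<close>, \<open>k\<close> its dimension, and
  \<open>\<real>\<^sup>k \<times> \<real>\<^sup>n\<^sup>-\<^sup>k\<close> is identified with \<open>\<real>\<^sup>n\<close> by \<^const>\<open>cat\<close>.
\<close>

definition singular_foliation :: "'a mfd \<Rightarrow> 'a set set \<Rightarrow> bool" where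
  "singular_foliation M F \<longleftrightarrow>
     partition_on (points M) F \<and>
     (\<forall>L\<in>F. weakly_embedded M L \<and> connected_space (mfd_topology (submfd M L))) \<and>
     (\<forall>L\<^sub>x\<in>F. \<forall>x\<in>L\<^sub>x. \<exists>(V, \<psi>)\<in>atlas M. \<exists>U W. let k = mdim (submfd M L\<^sub>x) in
        x \<in> V \<and>
        openin (Euclidean_space k) U \<and> (\<lambda>_. 0) \<in> U \<and>
        openin (Euclidean_space (mdim M - k)) W \<and> (\<lambda>_. 0) \<in> W \<and>
        \<psi> ` V = {cat k u w |u w. u \<in> U \<and> w \<in> W} \<and>
        \<psi> x = (\<lambda>_. 0) \<and>
        (\<forall>L\<in>F. \<exists>l\<subseteq>W. \<psi> ` (L \<inter> V) = {cat k u w |u w. u \<in> U \<and> w \<in> l}))"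


section \<open>The diffeomorphism group\<close>

definition diffeos :: "'a mfd \<Rightarrow> ('a \<Rightarrow> 'a) set" where
  "diffeos M = {f \<in> Bij (points M). smooth_map M M f \<and> smooth_map M M (inv_into (points M) f)}"

definition Diff :: "'a mfd \<Rightarrow> ('a \<Rightarrow> 'a) monoid" where
  "Diff M = BijGroup (points M)\<lparr>carrier := diffeos M\<rparr>"

definition functional_diffeology :: "'a mfd \<Rightarrow> ('a \<Rightarrow> 'a) diffeology" where
  "functional_diffeology M =
     {(m, S, P). openin (Euclidean_space m) S \<and> (\<forall>r\<in>S. P r \<in> carrier (Diff M)) \<and>
        smooth_map (prod_mfd (cart_mfd m S) M) M (\<lambda>(r, x). P r x) \<and>
        smooth_map (prod_mfd (cart_mfd m S) M) M (\<lambda>(r, x). inv_into (points M) (P r) x)}"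

end

theory Submission
  imports Defs "HOL-Homology.Invariance_of_Domain" "HOL-Computational_Algebra.Polynomial"
begin


text \<open>
  Let \<open>G\<close> consist of the members of the smooth families \<open>P\<close> of diffeomorphisms, parametrized by an
  interval around 0, that start at the identity and map every leaf onto itself.  Such a family is a path in
  \<open>G\<close>, so \<open>G\<close> is D-connected, and its orbits lie in the leaves.  Conversely, take a foliation chart
  centred at a point \<open>z\<close> of a leaf \<open>L\<close> of dimension \<open>k\<close>, a small bump function \<open>\<beta>\<close> in it, and
  \<open>u \<in> \<real>\<^sup>k\<close>.  The maps \<open>x \<mapsto> x + t \<beta>(x) u\<close> extend by the identity to a family as above,
  so the orbit of \<open>z\<close> contains a neighbourhood of \<open>z\<close> in its plaque.  This is an injective plot of
  \<open>L\<close> of dimension \<open>dim L\<close>, and by invariance of domain its image is open in \<open>L\<close>.  So the orbits in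
  \<open>L\<close> are open, and as \<open>L\<close> is connected there is only one.
\<close>

section \<open>Smooth functions\<close>

text \<open>The maps \<open>x + t \<beta>(x) u\<close> stand in for flows of vector fields tangent
  to the leaves: they are given by a formula, and inverting one comes down to a single scalar
  equation. The inverse cannot be ignored, since a plot of the diffeomorphism group must have smooth
  inverses; hence the implicit function below. Two facts make such a map preserve the foliation. The
  vector \<open>u\<close> lies in the first \<open>k\<close> coordinates, so the transverse
  coordinates of a point never change; and the chart condition speaks of every leaf meeting the
  chart, of whatever dimension, not just of the leaf through the centre. At time 1 the centre is
  displaced by a fixed positive multiple of \<open>u\<close>. As \<open>u\<close> runs through an
  open cube, the end points fill a cube in the plaque, so a single step reaches a whole
  neighbourhood. Letting every path start at the identity builds connectedness into the definition
  of the group. The price is that closure under composition and inversion has to be shown for paths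
  rather than for single maps.\<close>

abbreviation cart :: "nat \<Rightarrow> (nat \<Rightarrow> real) set" where
  "cart m \<equiv> topspace (Euclidean_space m)"

abbreviation cont_on :: "nat \<Rightarrow> (nat \<Rightarrow> real) set \<Rightarrow> ((nat \<Rightarrow> real) \<Rightarrow> real) \<Rightarrow> bool" where
  "cont_on m S f \<equiv> continuous_map (subtopology (Euclidean_space m) S) euclideanreal f"

section \<open>Cubes and the topology of Cartesian spaces\<close>

definition cube :: "nat \<Rightarrow> (nat \<Rightarrow> real) \<Rightarrow> real \<Rightarrow> (nat \<Rightarrow> real) set" where
  "cube m x e = {y \<in> cart m. \<forall>i<m. \<bar>y i - x i\<bar> < e}"

lemma in_cart_iff: "x \<in> cart m \<longleftrightarrow> (\<forall>i\<ge>m. x i = 0)"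
  by (simp add: topspace_Euclidean_space)

lemma fun_upd_in_cart: "x \<in> cart m \<Longrightarrow> i < m \<Longrightarrow> x(i := t) \<in> cart m"
  by (simp add: in_cart_iff)

lemma continuous_map_coord: "continuous_map (Euclidean_space m) euclideanreal (\<lambda>x. x i)"
  unfolding Euclidean_space_def
  by (intro continuous_map_from_subtopology continuous_map_product_projection) simp

lemma openin_cube: "openin (Euclidean_space m) (cube m x e)"
proof -
  have "openin (Euclidean_space m) {y \<in> cart m. \<bar>y i - x i\<bar> < e}" for i
  proof -
    have "openin (Euclidean_space m) {y \<in> cart m. y i \<in> {x i - e <..< x i + e}}"
      by (rule openin_continuous_map_preimage[OF continuous_map_coord]) simp
    moreover have "{y \<in> cart m. y i \<in> {x i - e <..< x i + e}} = {y \<in> cart m. \<bar>y i - x i\<bar> < e}"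
      by auto
    ultimately show ?thesis by simp
  qed
  then have "openin (Euclidean_space m) (cart m \<inter> (\<Inter>i<m. {y \<in> cart m. \<bar>y i - x i\<bar> < e}))"
    by (cases "m = 0") (auto intro!: openin_Int openin_Inter)
  moreover have "cart m \<inter> (\<Inter>i<m. {y \<in> cart m. \<bar>y i - x i\<bar> < e}) = cube m x e"
    by (auto simp: cube_def)
  ultimately show ?thesis by simp
qed

text \<open>\<open>Euclidean_space m\<close> is a subspace of a product topology, so cubes take the
  place of metric balls. Only the first \<open>m\<close> coordinates can vary, hence a single side
  length suffices.\<close>

lemma openin_Euclidean_space_iff_cube:
  "openin (Euclidean_space m) S \<longleftrightarrow> S \<subseteq> cart m \<and> (\<forall>x\<in>S. \<exists>e>0. cube m x e \<subseteq> S)"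
proof
  assume S: "openin (Euclidean_space m) S"
  then have "openin (subtopology (powertop_real UNIV) {x. \<forall>i\<ge>m. x i = 0}) S"
    by (simp only: Euclidean_space_def)
  then have "\<exists>T. openin (powertop_real UNIV) T \<and> S = T \<inter> {x. \<forall>i\<ge>m. x i = 0}"
    by (simp only: openin_subtopology)
  then obtain T where T: "openin (powertop_real UNIV) T" "S = T \<inter> {x. \<forall>i\<ge>m. x i = 0}"
    by (elim exE conjE)
  have "\<exists>e>0. cube m x e \<subseteq> S" if "x \<in> S" for x
  proof -
    have "x \<in> T" using T(2) that by blast
    from bspec[OF T(1)[unfolded openin_product_topology_alt] this] have "\<exists>U. finite {i \<in> UNIV. U i \<noteq> topspace euclideanreal} \<and>
        (\<forall>i\<in>UNIV. openin euclideanreal (U i)) \<and> x \<in> Pi\<^sub>E UNIV U \<and> Pi\<^sub>E UNIV U \<subseteq> T"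
      .
    then obtain U where U: "\<And>i. open (U i)" "x \<in> Pi\<^sub>E UNIV U" "Pi\<^sub>E UNIV U \<subseteq> T"
      by (auto simp del: topspace_euclidean)
    have "\<exists>e>0. \<forall>t. \<bar>t - x i\<bar> < e \<longrightarrow> t \<in> U i" for i
      using U(1)[of i] U(2) by (auto simp: open_dist dist_real_def PiE_iff)
    then obtain e where e: "\<And>i. e i > 0" "\<And>i t. \<bar>t - x i\<bar> < e i \<Longrightarrow> t \<in> U i"
      by metis
    \<comment> \<open>The 1 keeps the set nonempty when \<open>m = 0\<close>.\<close>
    define d where "d = Min (insert 1 (e ` {..<m}))"
    have d: "d > 0" "\<And>i. i < m \<Longrightarrow> d \<le> e i"
      unfolding d_def using e(1) by auto
    have xm: "x i = 0" if "i \<ge> m" for i using \<open>x \<in> S\<close> T that by auto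
    have "cube m x d \<subseteq> S"
    proof
      fix y assume y: "y \<in> cube m x d"
      have "y i \<in> U i" for i
      proof (cases "i < m")
        case True then show ?thesis using y d(2)[of i] e(2)[of "y i" i] by (auto simp: cube_def)
      next
        case False then show ?thesis using y e(1) xm[of i] by (auto simp: cube_def in_cart_iff intro!: e(2))
      qed
      then show "y \<in> S" using U y T by (auto simp: cube_def in_cart_iff PiE_iff)
    qed
    with d show ?thesis by blast
  qed
  with S show "S \<subseteq> cart m \<and> (\<forall>x\<in>S. \<exists>e>0. cube m x e \<subseteq> S)"
    using openin_subset by blast
next
  assume S: "S \<subseteq> cart m \<and> (\<forall>x\<in>S. \<exists>e>0. cube m x e \<subseteq> S)"
  show "openin (Euclidean_space m) S"
  proof (subst openin_subopen, intro ballI)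
    fix x assume x: "x \<in> S"
    then obtain e where e: "e > 0" "cube m x e \<subseteq> S" using S by blast
    moreover have "x \<in> cube m x e" using x e S by (auto simp: cube_def)
    ultimately show "\<exists>T. openin (Euclidean_space m) T \<and> x \<in> T \<and> T \<subseteq> S"
      using openin_cube by blast
  qed
qed

text \<open>Coordinatewise convergence is convergence in the space. The last assumption fixes the
  coordinates from \<open>m\<close> on, about which the limits say nothing.\<close>

lemma eventually_in_openin:
  assumes "openin (Euclidean_space m) S" "x \<in> S"
    and "\<And>i. i < m \<Longrightarrow> ((\<lambda>t. w t i) \<longlongrightarrow> x i) F" "eventually (\<lambda>t. w t \<in> cart m) F"
  shows "eventually (\<lambda>t. w t \<in> S) F"
proof -
  obtain e where e: "e > 0" "cube m x e \<subseteq> S"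
    using assms openin_Euclidean_space_iff_cube by metis
  have "eventually (\<lambda>t. \<forall>i\<in>{..<m}. \<bar>w t i - x i\<bar> < e) F"
    using assms(3) e(1) by (intro eventually_ball_finite) (auto simp: tendsto_iff dist_real_def)
  with assms(4) show ?thesis
    by eventually_elim (use e in \<open>auto simp: cube_def\<close>)
qed

lemma tendsto_cont_on:
  assumes "openin (Euclidean_space m) S" "cont_on m S f" "x \<in> S"
    and "\<And>i. i < m \<Longrightarrow> ((\<lambda>t. w t i) \<longlongrightarrow> x i) F" "eventually (\<lambda>t. w t \<in> cart m) F"
  shows "((\<lambda>t. f (w t)) \<longlongrightarrow> f x) F"
proof (rule topological_tendstoI)
  fix V assume V: "open V" "f x \<in> V"
  have sub: "S \<subseteq> cart m" using assms(1) openin_subset by blast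
  have "openin (subtopology (Euclidean_space m) S) {y \<in> topspace (subtopology (Euclidean_space m) S). f y \<in> V}"
    using assms(2) V by (intro openin_continuous_map_preimage) auto
  then have "openin (Euclidean_space m) {y \<in> S. f y \<in> V}"
    using assms(1) sub by (simp add: openin_open_subtopology Int_absorb1)
  from eventually_in_openin[OF this _ assms(4,5)] V assms(3)
  show "eventually (\<lambda>t. f (w t) \<in> V) F"
    by (auto elim: eventually_mono)
qed

lemma openin_cont_on_preimage:
  assumes "openin (Euclidean_space m) S" "cont_on m S f" "open V"
  shows "openin (Euclidean_space m) {y \<in> S. f y \<in> V}"
proof -
  have sub: "S \<subseteq> cart m" using assms(1) openin_subset by blast
  have "openin (subtopology (Euclidean_space m) S) {y \<in> topspace (subtopology (Euclidean_space m) S). f y \<in> V}"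
    using assms by (intro openin_continuous_map_preimage) auto
  then show ?thesis
    using assms(1) sub by (simp add: openin_open_subtopology Int_absorb1)
qed

lemma cont_onI:
  assumes "\<And>x e. x \<in> S \<Longrightarrow> e > 0 \<Longrightarrow>
      \<exists>N. openin (Euclidean_space m) N \<and> x \<in> N \<and> (\<forall>y\<in>N \<inter> S. \<bar>f y - f x\<bar> < e)"
  shows "cont_on m S f"
  unfolding continuous_map_def
proof (intro conjI allI impI)
  fix V :: "real set" assume "openin euclideanreal V"
  then have V: "open V" by simp
  show "openin (subtopology (Euclidean_space m) S)
         {x \<in> topspace (subtopology (Euclidean_space m) S). f x \<in> V}"
  proof (subst openin_subopen, intro ballI)
    fix x assume x: "x \<in> {x \<in> topspace (subtopology (Euclidean_space m) S). f x \<in> V}"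
    then obtain e where e: "e > 0" "\<And>y. \<bar>y - f x\<bar> < e \<Longrightarrow> y \<in> V"
      using V by (auto simp: open_dist dist_real_def)
    obtain N where N: "openin (Euclidean_space m) N" "x \<in> N" "\<forall>y\<in>N \<inter> S. \<bar>f y - f x\<bar> < e"
      using assms[of x e] x e by auto
    have "N \<subseteq> cart m" using N openin_subset by blast
    then show "\<exists>T. openin (subtopology (Euclidean_space m) S) T \<and> x \<in> T \<and>
         T \<subseteq> {x \<in> topspace (subtopology (Euclidean_space m) S). f x \<in> V}"
      using N x e(2) by (intro exI[of _ "N \<inter> S"]) (auto simp: openin_subtopology)
  qed
qed auto

lemma cont_on_mono: "cont_on m S f \<Longrightarrow> T \<subseteq> S \<Longrightarrow> cont_on m T f"
  by (rule continuous_map_from_subtopology_mono)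

lemma cont_on_cong: "(\<And>x. x \<in> S \<Longrightarrow> f x = g x) \<Longrightarrow> cont_on m S f \<longleftrightarrow> cont_on m S g"
  using continuous_map_eq[of _ _ f g] continuous_map_eq[of _ _ g f] by fastforce

section \<open>Derivatives along curves\<close>

lemma mean_value_segment:
  fixes f :: "real \<Rightarrow> real"
  assumes "\<And>s. \<bar>s - a\<bar> \<le> \<bar>b - a\<bar> \<Longrightarrow> (f has_real_derivative f' s) (at s)"
  shows "\<exists>\<xi>. \<bar>\<xi> - a\<bar> \<le> \<bar>b - a\<bar> \<and> f b - f a = f' \<xi> * (b - a)"
proof -
  consider "a < b" | "b < a" | "a = b" by linarith
  then show ?thesis
  proof cases
    case 1
    then have "\<exists>z>a. z < b \<and> f b - f a = (b - a) * f' z"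
      by (intro MVT2) (auto intro!: assms)
    then obtain z where "z > a" "z < b" "f b - f a = (b - a) * f' z" by blast
    then show ?thesis by (intro exI[of _ z]) (auto simp: algebra_simps)
  next
    case 2
    then have "\<exists>z>b. z < a \<and> f a - f b = (a - b) * f' z"
      by (intro MVT2) (auto intro!: assms)
    then obtain z where "z > b" "z < a" "f a - f b = (a - b) * f' z" by blast
    then show ?thesis by (intro exI[of _ z]) (auto simp: algebra_simps)
  qed auto
qed

text \<open>The curve moves one coordinate at a time, so that the mean value theorem for functions of one
  variable applies.\<close>

lemma DERIV_along_curve:
  assumes T: "openin (Euclidean_space n) T"
    and dc: "\<And>j. j < n \<Longrightarrow> cont_on n T (d j)"
    and dh: "\<And>x j. x \<in> T \<Longrightarrow> j < n \<Longrightarrow> ((\<lambda>t. h (x(j := t))) has_real_derivative d j x) (at (x j))"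
    and c0: "c t0 \<in> T" and cE: "\<And>t. c t \<in> cart n"
    and c': "\<And>j. j < n \<Longrightarrow> ((\<lambda>t. c t j) has_real_derivative c' j) (at t0)"
  shows "((\<lambda>t. h (c t)) has_real_derivative (\<Sum>j<n. d j (c t0) * c' j)) (at t0)"
proof -
  \<comment> \<open>\<open>hyb k\<close> follows the curve in the first \<open>k\<close> coordinates
    and stays at \<open>c t0\<close> in the others, so the increment of \<open>h\<close> along
    \<open>c\<close> telescopes over \<open>k\<close>.\<close>
  define hyb where "hyb = (\<lambda>k t i. if i < k then c t i else c t0 i)"
  have cont: "((\<lambda>t. c t j) \<longlongrightarrow> c t0 j) (at t0)" for j
  proof (cases "j < n")
    case True
    then show ?thesis using DERIV_isCont[OF c'] by (simp add: isCont_def)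
  next
    case False
    then have "(\<lambda>t. c t j) = (\<lambda>t. c t0 j)" using cE by (simp add: in_cart_iff)
    then show ?thesis by simp
  qed
  have hE: "hyb k t \<in> cart n" for k t
    using cE[of t] cE[of t0] by (simp add: in_cart_iff hyb_def)
  have hlim: "((\<lambda>t. hyb k t i) \<longlongrightarrow> c t0 i) (at t0)" for k i
    using cont[of i] by (cases "i < k") (auto simp: hyb_def)
  obtain e where e: "e > 0" "cube n (c t0) e \<subseteq> T"
    using T c0 openin_Euclidean_space_iff_cube by metis
  have main: "((\<lambda>t. h (hyb k t)) has_real_derivative (\<Sum>j<k. d j (c t0) * c' j)) (at t0)" if "k \<le> n" for k
    using that
  proof (induction k)
    case 0
    then show ?case by (simp add: hyb_def)
  next
    case (Suc k)
    then have k: "k < n" by simp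
    define G where "G = (\<lambda>t. h (hyb (Suc k) t) - h (hyb k t))"
    have G0: "G t0 = 0" by (simp add: G_def hyb_def)
    have ev: "eventually (\<lambda>t. \<exists>\<xi>. \<bar>\<xi> - c t0 k\<bar> \<le> \<bar>c t k - c t0 k\<bar> \<and>
         G t = d k ((hyb k t)(k := \<xi>)) * (c t k - c t0 k)) (at t0)"
    proof -
      have "eventually (\<lambda>t. hyb n t \<in> cube n (c t0) e) (at t0)"
        by (rule eventually_in_openin[OF openin_cube _ hlim])
          (use e c0 T openin_subset in \<open>auto simp: hE cube_def\<close>)
      then show ?thesis
      proof eventually_elim
        case (elim t)
        have el: "\<bar>c t j - c t0 j\<bar> < e" if "j < n" for j
          using elim that by (auto simp: cube_def hyb_def)
        have inT: "(hyb k t)(k := s) \<in> T" if "\<bar>s - c t0 k\<bar> \<le> \<bar>c t k - c t0 k\<bar>" for s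
        proof -
          have "(hyb k t)(k := s) \<in> cube n (c t0) e"
            using that el k hE[of k t] e(1) by (auto simp: cube_def in_cart_iff hyb_def intro: le_less_trans)
          then show ?thesis using e by blast
        qed
        have "\<exists>\<xi>. \<bar>\<xi> - c t0 k\<bar> \<le> \<bar>c t k - c t0 k\<bar> \<and>
           h ((hyb k t)(k := c t k)) - h ((hyb k t)(k := c t0 k)) =
             d k ((hyb k t)(k := \<xi>)) * (c t k - c t0 k)"
        proof (rule mean_value_segment)
          fix s assume "\<bar>s - c t0 k\<bar> \<le> \<bar>c t k - c t0 k\<bar>"
          from dh[OF inT[OF this] k]
          show "((\<lambda>s. h ((hyb k t)(k := s))) has_real_derivative d k ((hyb k t)(k := s))) (at s)"
            by simp
        qed
        moreover have "(hyb k t)(k := c t k) = hyb (Suc k) t" "(hyb k t)(k := c t0 k) = hyb k t"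
          by (auto simp: hyb_def fun_eq_iff less_Suc_eq)
        ultimately show ?case by (simp add: G_def)
      qed
    qed
    \<comment> \<open>The mean value points become a function of \<open>t\<close>. It is meaningful
      only near \<open>t0\<close>, which is enough for limits, and it is squeezed towards
      \<open>c t0 k\<close>.\<close>
    define \<xi> where "\<xi> = (\<lambda>t. SOME \<xi>. \<bar>\<xi> - c t0 k\<bar> \<le> \<bar>c t k - c t0 k\<bar> \<and>
         G t = d k ((hyb k t)(k := \<xi>)) * (c t k - c t0 k))"
    have \<xi>: "eventually (\<lambda>t. \<bar>\<xi> t - c t0 k\<bar> \<le> \<bar>c t k - c t0 k\<bar> \<and>
         G t = d k ((hyb k t)(k := \<xi> t)) * (c t k - c t0 k)) (at t0)"
      using ev by eventually_elim (unfold \<xi>_def, rule someI_ex)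
    have xlim0: "((\<lambda>t. \<xi> t - c t0 k) \<longlongrightarrow> 0) (at t0)"
    proof (rule Lim_null_comparison)
      show "eventually (\<lambda>t. norm (\<xi> t - c t0 k) \<le> \<bar>c t k - c t0 k\<bar>) (at t0)"
        using \<xi> by eventually_elim auto
      show "((\<lambda>t. \<bar>c t k - c t0 k\<bar>) \<longlongrightarrow> 0) (at t0)"
        by (intro tendsto_rabs_zero LIM_zero cont)
    qed
    then have xlim: "(\<xi> \<longlongrightarrow> c t0 k) (at t0)"
      by (rule LIM_zero_cancel)
    have dlim: "((\<lambda>t. d k ((hyb k t)(k := \<xi> t))) \<longlongrightarrow> d k (c t0)) (at t0)"
    proof (rule tendsto_cont_on[OF T dc[OF k] c0])
      show "((\<lambda>t. ((hyb k t)(k := \<xi> t)) i) \<longlongrightarrow> c t0 i) (at t0)" for i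
        using xlim hlim[of k i] by (cases "i = k") auto
    qed (simp add: hE fun_upd_in_cart k)
    have qlim: "((\<lambda>t. (c t k - c t0 k) / (t - t0)) \<longlongrightarrow> c' k) (at t0)"
      using c'[OF k] by (simp add: has_field_derivative_iff)
    have "((\<lambda>t. d k ((hyb k t)(k := \<xi> t)) * ((c t k - c t0 k) / (t - t0))) \<longlongrightarrow> d k (c t0) * c' k) (at t0)"
      by (intro tendsto_mult dlim qlim)
    then have "((\<lambda>t. (G t - G t0) / (t - t0)) \<longlongrightarrow> d k (c t0) * c' k) (at t0)"
      by (rule tendsto_cong[THEN iffD1, rotated]) (use \<xi> in eventually_elim, simp add: G0)
    then have "(G has_real_derivative d k (c t0) * c' k) (at t0)"
      by (simp add: has_field_derivative_iff)
    from DERIV_add[OF Suc.IH this] k show ?case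
      by (simp add: G_def)
  qed
  have "hyb n t = c t" for t
    using cE[of t] cE[of t0] by (auto simp: hyb_def fun_eq_iff in_cart_iff)
  with main[of n] show ?thesis by simp
qed


section \<open>Locality of iterated partial derivatives; coinduction\<close>

lemma eventually_fun_upd_in:
  assumes "openin (Euclidean_space m) S" "x \<in> S" "i < m"
  shows "eventually (\<lambda>t. x(i := t) \<in> S) (nhds (x i))"
proof (rule eventually_in_openin[OF assms(1,2)])
  show "((\<lambda>t. (x(i := t)) j) \<longlongrightarrow> x j) (nhds (x i))" for j
    by (cases "j = i") (auto simp: filterlim_ident)
  have "x \<in> cart m" using assms openin_subset by blast
  then show "eventually (\<lambda>t. x(i := t) \<in> cart m) (nhds (x i))"
    by (simp add: fun_upd_in_cart assms)
qed

lemma DERIV_upd_cong: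
  assumes "openin (Euclidean_space m) S" "x \<in> S" "i < m" "\<And>x. x \<in> S \<Longrightarrow> f x = g x"
  shows "((\<lambda>t. f (x(i := t))) has_real_derivative D) (at (x i)) \<longleftrightarrow>
         ((\<lambda>t. g (x(i := t))) has_real_derivative D) (at (x i))"
proof (rule DERIV_cong_ev)
  show "eventually (\<lambda>t. f (x(i := t)) = g (x(i := t))) (nhds (x i))"
    using eventually_fun_upd_in[OF assms(1-3)] by eventually_elim (rule assms(4))
qed auto

lemma iter_partial_Cons: "iter_partial (i # is) f = partial i (iter_partial is f)"
  by (simp add: iter_partial_def)

lemma iter_partial_Nil [simp]: "iter_partial [] f = f"
  by (simp add: iter_partial_def)

lemma iter_partial_snoc: "iter_partial (is @ [i]) f = iter_partial is (partial i f)"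
  by (simp add: iter_partial_def)

text \<open>\<open>deriv\<close> chooses some number satisfying the derivative relation. That
  relation is the same for two functions agreeing near a point, so the chosen numbers coincide even
  where no derivative exists.\<close>

lemma iter_partial_cong:
  assumes S: "openin (Euclidean_space m) S" and fg: "\<And>x. x \<in> S \<Longrightarrow> f x = g x"
    and "set is \<subseteq> {..<m}" "x \<in> S"
  shows "iter_partial is f x = iter_partial is g x"
  using assms(3,4)
proof (induction "is" arbitrary: x)
  case Nil
  then show ?case by (simp add: fg)
next
  case (Cons i "is")
  then show ?case
    unfolding iter_partial_Cons partial_def deriv_def
    by (subst DERIV_upd_cong[OF S, of x i "iter_partial is f" "iter_partial is g"]) auto
qed

lemma smooth_fun_cong:
  assumes S: "openin (Euclidean_space m) S" and fg: "\<And>x. x \<in> S \<Longrightarrow> f x = g x"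
    and f: "smooth_fun m S f"
  shows "smooth_fun m S g"
  unfolding smooth_fun_def
proof (intro allI impI conjI ballI)
  fix "is" assume "is": "set is \<subseteq> {..<m}"
  have eq: "iter_partial is f x = iter_partial is g x" if "x \<in> S" for x
    by (rule iter_partial_cong[OF S fg "is" that])
  show "cont_on m S (iter_partial is g)"
    using f "is" cont_on_cong[of S "iter_partial is f" "iter_partial is g", OF eq]
    unfolding smooth_fun_def by blast
  fix x i assume x: "x \<in> S" "i < m"
  have "(\<lambda>t. iter_partial is f (x(i := t))) differentiable (at (x i))"
    using f "is" x by (simp add: smooth_fun_def)
  then show "(\<lambda>t. iter_partial is g (x(i := t))) differentiable (at (x i))"
    unfolding real_differentiable_def
    using DERIV_upd_cong[OF S x, of "iter_partial is f" "iter_partial is g", OF eq] by simp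
qed

lemma smooth_fun_cont: "smooth_fun m S f \<Longrightarrow> cont_on m S f"
  unfolding smooth_fun_def by (drule spec[of _ "[]"]) simp

lemma smooth_fun_partial:
  assumes "smooth_fun m S f" "i < m"
  shows "smooth_fun m S (partial i f)"
  unfolding smooth_fun_def
proof (intro allI impI)
  fix "is" assume "set is \<subseteq> {..<m}"
  then have "set (is @ [i]) \<subseteq> {..<m}" using assms(2) by auto
  with assms(1)
  show "cont_on m S (iter_partial is (partial i f)) \<and> (\<forall>x\<in>S. \<forall>j<m.
      (\<lambda>t. iter_partial is (partial i f) (x(j := t))) differentiable at (x j))"
    unfolding smooth_fun_def iter_partial_snoc[symmetric] by blast
qed

lemma smooth_fun_DERIV:
  assumes "smooth_fun m S f" "x \<in> S" "i < m"
  shows "((\<lambda>t. f (x(i := t))) has_real_derivative partial i f x) (at (x i))"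
proof -
  have "(\<lambda>t. f (x(i := t))) differentiable (at (x i))"
    using assms unfolding smooth_fun_def by (metis empty_subsetI iter_partial_Nil list.set(1))
  then show ?thesis
    unfolding partial_def by (simp add: DERIV_deriv_iff_real_differentiable)
qed

text \<open>Smoothness is the largest property on \<open>S\<close> that implies continuity and
  passes to partial derivatives. The derivative is compared with a member of \<open>P\<close> on
  \<open>S\<close> only, because \<open>iter_partial\<close> is uncontrolled elsewhere.\<close>

lemma smooth_fun_coinduct:
  assumes S: "openin (Euclidean_space m) S" and Pf: "P f"
    and cont: "\<And>f. P f \<Longrightarrow> cont_on m S f"
    and der: "\<And>f i. P f \<Longrightarrow> i < m \<Longrightarrow> \<exists>g. P g \<and>
          (\<forall>x\<in>S. ((\<lambda>t. f (x(i := t))) has_real_derivative g x) (at (x i)))"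
  shows "smooth_fun m S f"
proof -
  have *: "\<exists>g. P g \<and> (\<forall>x\<in>S. iter_partial is f x = g x)" if "set is \<subseteq> {..<m}" for "is"
    using that
  proof (induction "is")
    case Nil
    then show ?case using Pf by auto
  next
    case (Cons i "is")
    then obtain g where g: "P g" "\<forall>x\<in>S. iter_partial is f x = g x" by auto
    have i: "i < m" using Cons by simp
    obtain g' where g': "P g'" "\<forall>x\<in>S. ((\<lambda>t. g (x(i := t))) has_real_derivative g' x) (at (x i))"
      using der[OF g(1) i] by blast
    have "iter_partial (i # is) f x = g' x" if "x \<in> S" for x
      unfolding iter_partial_Cons partial_def
      by (rule DERIV_imp_deriv, subst DERIV_upd_cong[OF S that i, of _ g]) (use g g' that in auto)
    then show ?case using g'(1) by blast
  qed
  show ?thesis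
    unfolding smooth_fun_def
  proof (intro allI impI conjI ballI)
    fix "is" assume "is": "set is \<subseteq> {..<m}"
    obtain g where g: "P g" "\<And>x. x \<in> S \<Longrightarrow> iter_partial is f x = g x" using *[OF "is"] by auto
    then show "cont_on m S (iter_partial is f)" using cont cont_on_cong[of S "iter_partial is f" g] by blast
    fix x i assume x: "x \<in> S" "i < m"
    then obtain g' where "\<forall>x\<in>S. ((\<lambda>t. g (x(i := t))) has_real_derivative g' x) (at (x i))"
      using der[OF g(1)] by blast
    then have "((\<lambda>t. iter_partial is f (x(i := t))) has_real_derivative g' x) (at (x i))"
      using DERIV_upd_cong[OF S x, of "iter_partial is f" g, OF g(2)] x by simp
    then show "(\<lambda>t. iter_partial is f (x(i := t))) differentiable (at (x i))"
      unfolding real_differentiable_def by blast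
  qed
qed

section \<open>Closure properties of smooth functions\<close>

lemma smooth_fun_mono: "smooth_fun m S f \<Longrightarrow> T \<subseteq> S \<Longrightarrow> smooth_fun m T f"
  unfolding smooth_fun_def using cont_on_mono by (meson subsetD)

lemma smooth_fun_const: "openin (Euclidean_space m) S \<Longrightarrow> smooth_fun m S (\<lambda>x. c)"
  by (rule smooth_fun_coinduct[where P = "\<lambda>f. \<exists>c. f = (\<lambda>x. c)"]) (auto intro!: exI[of _ "\<lambda>x. 0"])

lemma smooth_fun_coord:
  assumes S: "openin (Euclidean_space m) S"
  shows "smooth_fun m S (\<lambda>x. x j)"
proof (rule smooth_fun_coinduct[where P = "\<lambda>f. (\<exists>c. f = (\<lambda>x. c)) \<or> f = (\<lambda>x. x j)", OF S])
  show "cont_on m S f" if "(\<exists>c. f = (\<lambda>x. c)) \<or> f = (\<lambda>x. x j)" for f :: "(nat \<Rightarrow> real) \<Rightarrow> real"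
    using that continuous_map_from_subtopology[OF continuous_map_coord] by auto
next
  fix f :: "(nat \<Rightarrow> real) \<Rightarrow> real" and i
  assume "(\<exists>c. f = (\<lambda>x. c)) \<or> f = (\<lambda>x. x j)" and "i < m"
  then consider c where "f = (\<lambda>x. c)" | "f = (\<lambda>x. x j)" "i = j" | "f = (\<lambda>x. x j)" "i \<noteq> j" by blast
  then show "\<exists>g. ((\<exists>c. g = (\<lambda>x. c)) \<or> g = (\<lambda>x. x j)) \<and>
          (\<forall>x\<in>S. ((\<lambda>t. f (x(i := t))) has_real_derivative g x) (at (x i)))"
  proof cases
    case 2
    then show ?thesis by (intro exI[of _ "\<lambda>x. 1"]) auto
  qed (auto intro!: exI[of _ "\<lambda>x. 0"])
qed simp

text \<open>The Leibniz rule and the chain rule show that this class is closed under partial derivatives, which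
  gives the smoothness of sums, products and compositions by one coinduction.\<close>

inductive smooth_closure :: "nat \<Rightarrow> (nat \<Rightarrow> real) set \<Rightarrow> ((nat \<Rightarrow> real) \<Rightarrow> real) \<Rightarrow> bool"
  for m S where
  base: "smooth_fun m S f \<Longrightarrow> smooth_closure m S f"
| add: "smooth_closure m S f \<Longrightarrow> smooth_closure m S g \<Longrightarrow> smooth_closure m S (\<lambda>x. f x + g x)"
| mult: "smooth_closure m S f \<Longrightarrow> smooth_closure m S g \<Longrightarrow> smooth_closure m S (\<lambda>x. f x * g x)"
| comp: "openin (Euclidean_space n) T \<Longrightarrow> smooth_fun n T h \<Longrightarrow> F ` S \<subseteq> T \<Longrightarrow>
     (\<And>j. j < n \<Longrightarrow> smooth_fun m S (\<lambda>x. F x j)) \<Longrightarrow> smooth_closure m S (\<lambda>x. h (F x))"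

lemma smooth_closure_sum:
  assumes "openin (Euclidean_space m) S" "finite A" "\<And>j. j \<in> A \<Longrightarrow> smooth_closure m S (f j)"
  shows "smooth_closure m S (\<lambda>x. \<Sum>j\<in>A. f j x)"
  using assms(2,3)
proof (induction A rule: finite_induct)
  case empty
  then show ?case by (simp add: smooth_closure.base smooth_fun_const assms(1))
next
  case (insert a A)
  then show ?case using smooth_closure.add[of m S "f a" "\<lambda>x. \<Sum>j\<in>A. f j x"] by simp
qed

lemma continuous_map_into_open:
  assumes T: "openin (Euclidean_space n) T" and F: "F ` S \<subseteq> T" "\<And>j. j < n \<Longrightarrow> cont_on m S (\<lambda>x. F x j)"
  shows "continuous_map (subtopology (Euclidean_space m) S) (subtopology (Euclidean_space n) T) F"
proof -
  have "T \<subseteq> cart n" using T openin_subset by blast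
  then have eq: "F x = (\<lambda>i. if i < n then F x i else 0)" if "x \<in> S" for x
    using F(1) that by (force simp: in_cart_iff fun_eq_iff)
  have "continuous_map (subtopology (Euclidean_space m) S) (Euclidean_space n) (\<lambda>x i. if i < n then F x i else 0)"
    using F(2) by (simp add: continuous_map_componentwise_Euclidean_space)
  then have "continuous_map (subtopology (Euclidean_space m) S) (Euclidean_space n) F"
    by (rule continuous_map_eq) (use eq in auto)
  then show ?thesis using F(1) by (auto simp: continuous_map_in_subtopology)
qed

lemma DERIV_compose_smooth:
  assumes S: "openin (Euclidean_space m) S" and T: "openin (Euclidean_space n) T"
    and h: "smooth_fun n T h" and F: "F ` S \<subseteq> T"
    and D: "\<And>j. j < n \<Longrightarrow> ((\<lambda>t. F (x(i := t)) j) has_real_derivative F' j) (at (x i))"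
    and x: "x \<in> S" "i < m"
  shows "((\<lambda>t. h (F (x(i := t)))) has_real_derivative (\<Sum>j<n. partial j h (F x) * F' j)) (at (x i))"
proof -
  have T': "T \<subseteq> cart n" using T openin_subset by blast
  \<comment> \<open>\<open>F\<close> is controlled on \<open>S\<close> only, but
    \<open>DERIV_along_curve\<close> wants a curve lying in \<open>cart n\<close> for all times;
    cutting off the coordinates from \<open>n\<close> on achieves this and changes nothing while
    \<open>x(i := t)\<close> stays in \<open>S\<close>.\<close>
  define c where "c = (\<lambda>t j. if j < n then F (x(i := t)) j else 0)"
  have eqF: "c t = F (x(i := t))" if "x(i := t) \<in> S" for t
  proof -
    have "F (x(i := t)) \<in> cart n" using F T' that by blast
    then show ?thesis by (auto simp: c_def in_cart_iff fun_eq_iff)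
  qed
  have cx: "c (x i) = F x" using eqF[of "x i"] x by simp
  have "((\<lambda>t. h (c t)) has_real_derivative (\<Sum>j<n. partial j h (c (x i)) * F' j)) (at (x i))"
  proof (rule DERIV_along_curve[OF T])
    show "cont_on n T (partial j h)" if "j < n" for j
      using smooth_fun_cont[OF smooth_fun_partial[OF h that]] .
    show "((\<lambda>t. h (x(j := t))) has_real_derivative partial j h x) (at (x j))" if "x \<in> T" "j < n" for x j
      using smooth_fun_DERIV[OF h that] .
    show "c (x i) \<in> T" using F x cx by auto
    show "c t \<in> cart n" for t by (simp add: c_def in_cart_iff)
    show "((\<lambda>t. c t j) has_real_derivative F' j) (at (x i))" if "j < n" for j
      using D[OF that] that by (simp add: c_def)
  qed
  moreover have "((\<lambda>t. h (c t)) has_real_derivative (\<Sum>j<n. partial j h (c (x i)) * F' j)) (at (x i)) \<longleftrightarrow>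
    ((\<lambda>t. h (F (x(i := t)))) has_real_derivative (\<Sum>j<n. partial j h (c (x i)) * F' j)) (at (x i))"
  proof (rule DERIV_cong_ev)
    show "eventually (\<lambda>t. h (c t) = h (F (x(i := t)))) (nhds (x i))"
      using eventually_fun_upd_in[OF S x] by eventually_elim (simp add: eqF)
  qed simp_all
  ultimately show ?thesis by (simp add: cx)
qed

lemma smooth_closure_imp_smooth:
  assumes S: "openin (Euclidean_space m) S" and f: "smooth_closure m S f"
  shows "smooth_fun m S f"
proof (rule smooth_fun_coinduct[where P = "smooth_closure m S", OF S f])
  show "cont_on m S f" if "smooth_closure m S f" for f
    using that
  proof induction
    case (comp n T h F)
    then have "continuous_map (subtopology (Euclidean_space m) S) (subtopology (Euclidean_space n) T) F"
      using continuous_map_into_open[OF comp(1,3) smooth_fun_cont[OF comp(4)]] by blast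
    from continuous_map_compose[OF this smooth_fun_cont[OF comp(2)]] show ?case
      by (simp add: o_def)
  next
    case (add f g)
    then show ?case by (intro continuous_map_add)
  next
    case (mult f g)
    then show ?case by (intro continuous_map_real_mult)
  next
    case (base f)
    then show ?case by (rule smooth_fun_cont)
  qed
next
  fix f i assume i: "i < m" and "smooth_closure m S f"
  from this(2) show "\<exists>g. smooth_closure m S g \<and>
          (\<forall>x\<in>S. ((\<lambda>t. f (x(i := t))) has_real_derivative g x) (at (x i)))"
  proof induction
    case (base f)
    then show ?case using smooth_fun_DERIV[OF base _ i] smooth_fun_partial[OF base i]
      by (blast intro: smooth_closure.base)
  next
    case (add f g)
    then obtain f' g' where
      *: "smooth_closure m S f'" "\<forall>x\<in>S. ((\<lambda>t. f (x(i := t))) has_real_derivative f' x) (at (x i))"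
      "smooth_closure m S g'" "\<forall>x\<in>S. ((\<lambda>t. g (x(i := t))) has_real_derivative g' x) (at (x i))"
      by blast
    show ?case
    proof (intro exI[of _ "\<lambda>x. f' x + g' x"] conjI ballI)
      show "smooth_closure m S (\<lambda>x. f' x + g' x)"
        by (rule smooth_closure.add[OF *(1,3)])
      show "((\<lambda>t. f (x(i := t)) + g (x(i := t))) has_real_derivative f' x + g' x) (at (x i))"
        if "x \<in> S" for x
        by (rule DERIV_add[OF bspec[OF *(2) that] bspec[OF *(4) that]])
    qed
  next
    case (mult f g)
    then obtain f' g' where
      *: "smooth_closure m S f'" "\<forall>x\<in>S. ((\<lambda>t. f (x(i := t))) has_real_derivative f' x) (at (x i))"
      "smooth_closure m S g'" "\<forall>x\<in>S. ((\<lambda>t. g (x(i := t))) has_real_derivative g' x) (at (x i))"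
      by blast
    show ?case
    proof (intro exI[of _ "\<lambda>x. f' x * g x + g' x * f x"] conjI ballI)
      show "smooth_closure m S (\<lambda>x. f' x * g x + g' x * f x)"
        by (rule smooth_closure.add[OF smooth_closure.mult[OF *(1) mult(2)] smooth_closure.mult[OF *(3) mult(1)]])
      show "((\<lambda>t. f (x(i := t)) * g (x(i := t))) has_real_derivative f' x * g x + g' x * f x) (at (x i))"
        if "x \<in> S" for x
        using DERIV_mult[OF bspec[OF *(2) that] bspec[OF *(4) that]] by simp
    qed
  next
    case (comp n T h F)
    show ?case
    proof (intro exI[of _ "\<lambda>x. \<Sum>j<n. partial j h (F x) * partial i (\<lambda>x. F x j) x"] conjI ballI)
      show "smooth_closure m S (\<lambda>x. \<Sum>j<n. partial j h (F x) * partial i (\<lambda>x. F x j) x)"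
      proof (rule smooth_closure_sum[OF S], simp)
        fix j assume j: "j \<in> {..<n}"
        then have "smooth_closure m S (\<lambda>x. partial j h (F x))"
          using smooth_closure.comp[OF comp(1) smooth_fun_partial[OF comp(2)] comp(3,4)] by simp
        then show "smooth_closure m S (\<lambda>x. partial j h (F x) * partial i (\<lambda>x. F x j) x)"
          using smooth_closure.base[OF smooth_fun_partial[OF comp(4) i]] j
          by (intro smooth_closure.mult) auto
      qed
      show "((\<lambda>t. h (F (x(i := t)))) has_real_derivative
          (\<Sum>j<n. partial j h (F x) * partial i (\<lambda>x. F x j) x)) (at (x i))" if "x \<in> S" for x
        by (rule DERIV_compose_smooth[OF S comp(1-3) _ that i])
          (rule smooth_fun_DERIV[OF comp(4) that i])
    qed
  qed
qed

lemma smooth_fun_add: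
  "openin (Euclidean_space m) S \<Longrightarrow> smooth_fun m S f \<Longrightarrow> smooth_fun m S g \<Longrightarrow> smooth_fun m S (\<lambda>x. f x + g x)"
  by (rule smooth_closure_imp_smooth) (auto intro: smooth_closure.add smooth_closure.base)

lemma smooth_fun_mult:
  "openin (Euclidean_space m) S \<Longrightarrow> smooth_fun m S f \<Longrightarrow> smooth_fun m S g \<Longrightarrow> smooth_fun m S (\<lambda>x. f x * g x)"
  by (rule smooth_closure_imp_smooth) (auto intro: smooth_closure.mult smooth_closure.base)

lemma smooth_fun_diff:
  assumes "openin (Euclidean_space m) S" "smooth_fun m S f" "smooth_fun m S g"
  shows "smooth_fun m S (\<lambda>x. f x - g x)"
  using smooth_fun_add[OF assms(1,2) smooth_fun_mult[OF assms(1) smooth_fun_const[OF assms(1), of "-1"] assms(3)]]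
  by simp

lemma smooth_fun_sum:
  assumes "openin (Euclidean_space m) S" "finite A" "\<And>j. j \<in> A \<Longrightarrow> smooth_fun m S (f j)"
  shows "smooth_fun m S (\<lambda>x. \<Sum>j\<in>A. f j x)"
  using assms(2,3)
proof (induction A rule: finite_induct)
  case (insert a A)
  then show ?case using smooth_fun_add[OF assms(1), of "f a" "\<lambda>x. \<Sum>j\<in>A. f j x"] by simp
qed (simp add: smooth_fun_const assms(1))

lemma smooth_fun_prod:
  assumes "openin (Euclidean_space m) S" "finite A" "\<And>j. j \<in> A \<Longrightarrow> smooth_fun m S (f j)"
  shows "smooth_fun m S (\<lambda>x. \<Prod>j\<in>A. f j x)"
  using assms(2,3)
proof (induction A rule: finite_induct)
  case (insert a A)
  then show ?case using smooth_fun_mult[OF assms(1), of "f a" "\<lambda>x. \<Prod>j\<in>A. f j x"] by simp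
qed (simp add: smooth_fun_const assms(1))

lemma smooth_fun_compose:
  assumes "openin (Euclidean_space m) S" "openin (Euclidean_space n) T"
    and "smooth_fun n T h" "F ` S \<subseteq> T" "\<And>j. j < n \<Longrightarrow> smooth_fun m S (\<lambda>x. F x j)"
  shows "smooth_fun m S (\<lambda>x. h (F x))"
  by (rule smooth_closure_imp_smooth[OF assms(1) smooth_closure.comp[OF assms(2-5)]])

lemma smooth_cart_compose:
  assumes "openin (Euclidean_space m) S" "openin (Euclidean_space n) T"
    and "smooth_cart m S n F" "smooth_cart n T k h" "F ` S \<subseteq> T"
  shows "smooth_cart m S k (\<lambda>x. h (F x))"
  unfolding smooth_cart_def
proof (intro conjI allI impI)
  show "(\<lambda>x. h (F x)) ` S \<subseteq> cart k" using assms(4,5) unfolding smooth_cart_def by blast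
  fix j assume "j < k"
  then have h: "smooth_fun n T (\<lambda>x. h x j)" using assms(4) unfolding smooth_cart_def by blast
  show "smooth_fun m S (\<lambda>x. h (F x) j)"
    by (rule smooth_fun_compose[OF assms(1,2) h assms(5)]) (use assms(3) in \<open>auto simp: smooth_cart_def\<close>)
qed

lemma smooth_cart_cong:
  assumes "openin (Euclidean_space m) S" "\<And>x. x \<in> S \<Longrightarrow> f x = g x" "smooth_cart m S n f"
  shows "smooth_cart m S n g"
  unfolding smooth_cart_def
proof (intro conjI allI impI)
  show "g ` S \<subseteq> cart n" using assms(2,3) unfolding smooth_cart_def by force
  fix j assume "j < n"
  then have h: "smooth_fun m S (\<lambda>x. f x j)" using assms(3) unfolding smooth_cart_def by blast
  show "smooth_fun m S (\<lambda>x. g x j)"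
    by (rule smooth_fun_cong[OF assms(1) _ h]) (simp add: assms(2))
qed

lemma smooth_cart_mono: "smooth_cart m S n f \<Longrightarrow> T \<subseteq> S \<Longrightarrow> smooth_cart m T n f"
  unfolding smooth_cart_def using smooth_fun_mono by blast

lemma smooth_cart_continuous_map:
  assumes "openin (Euclidean_space m) S" "smooth_cart m S n F"
  shows "continuous_map (subtopology (Euclidean_space m) S) (Euclidean_space n) F"
  using continuous_map_into_open[of n "cart n" F S m] assms
  by (auto simp: smooth_cart_def smooth_fun_cont)

lemma openin_smooth_cart_preimage:
  assumes "openin (Euclidean_space m) S" "smooth_cart m S n F" "openin (Euclidean_space n) T"
  shows "openin (Euclidean_space m) {x \<in> S. F x \<in> T}"
proof -
  have "openin (subtopology (Euclidean_space m) S) {x \<in> topspace (subtopology (Euclidean_space m) S). F x \<in> T}"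
    by (rule openin_continuous_map_preimage[OF smooth_cart_continuous_map[OF assms(1,2)] assms(3)])
  moreover have "S \<subseteq> cart m" using assms openin_subset by blast
  ultimately show ?thesis
    using assms(1) by (simp add: openin_open_subtopology Int_absorb1)
qed


section \<open>Bump functions and the implicit function\<close>

lemma continuous_map_real_coord:
  assumes "openin (Euclidean_space m) S" "\<And>x. x \<in> S \<Longrightarrow> isCont f (x i)" "i < m"
  shows "cont_on m S (\<lambda>x. f (x i))"
proof (rule cont_onI)
  fix x and e :: real assume x: "x \<in> S" and e: "e > 0"
  obtain d where d: "d > 0" "\<And>t. \<bar>t - x i\<bar> < d \<Longrightarrow> \<bar>f t - f (x i)\<bar> < e"
    using assms(2)[OF x] e unfolding continuous_at_eps_delta dist_real_def by metis
  have "x \<in> cube m x d" using x d assms(1) openin_subset by (fastforce simp: cube_def)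
  then show "\<exists>N. openin (Euclidean_space m) N \<and> x \<in> N \<and> (\<forall>y\<in>N \<inter> S. \<bar>f (y i) - f (x i)\<bar> < e)"
    using d(2) assms(3) openin_cube[of m x d] by (intro exI[of _ "cube m x d"]) (simp add: cube_def)
qed

lemma openin_real_coord: "open A \<Longrightarrow> openin (Euclidean_space m) {x \<in> cart m. x i \<in> A}"
  by (rule openin_continuous_map_preimage[OF continuous_map_coord]) simp

text \<open>Coinduction for functions of a real variable, which are read as functions of coordinate
  0 on the one-dimensional space so that \<open>smooth_fun_compose\<close> can take them as outer
  function.\<close>

lemma smooth_fun_real:
  fixes P :: "(real \<Rightarrow> real) \<Rightarrow> bool"
  assumes A: "open A" and "P p" and der: "\<And>p. P p \<Longrightarrow> \<exists>q. P q \<and> (\<forall>t\<in>A. (p has_real_derivative q t) (at t))"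
  shows "smooth_fun 1 {x \<in> cart 1. x 0 \<in> A} (\<lambda>x. p (x 0))"
proof (rule smooth_fun_coinduct[where P = "\<lambda>f. \<exists>p. P p \<and> f = (\<lambda>x. p (x 0))"])
  show S: "openin (Euclidean_space 1) {x \<in> cart 1. x 0 \<in> A}" by (rule openin_real_coord[OF A])
  show "\<exists>p'. P p' \<and> (\<lambda>x. p (x 0)) = (\<lambda>x. p' (x 0))" using assms(2) by blast
  fix f :: "(nat \<Rightarrow> real) \<Rightarrow> real" assume "\<exists>p. P p \<and> f = (\<lambda>x. p (x 0))"
  then obtain p where p: "P p" "f = (\<lambda>x. p (x 0))" by blast
  then obtain q where q: "P q" "\<And>t. t \<in> A \<Longrightarrow> (p has_real_derivative q t) (at t)" using der by blast
  show "cont_on 1 {x \<in> cart 1. x 0 \<in> A} f"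
    unfolding p(2) by (rule continuous_map_real_coord[OF S]) (auto intro: DERIV_isCont q(2))
  show "\<exists>g. (\<exists>p. P p \<and> g = (\<lambda>x. p (x 0))) \<and>
      (\<forall>x\<in>{x \<in> cart 1. x 0 \<in> A}. ((\<lambda>t. f (x(i := t))) has_real_derivative g x) (at (x i)))"
    if "i < 1" for i
    using that q by (intro exI[of _ "\<lambda>x. q (x 0)"]) (auto simp: p(2))
qed

lemma smooth_fun_inverse:
  assumes S: "openin (Euclidean_space m) S" and f: "smooth_fun m S f" and pos: "\<And>x. x \<in> S \<Longrightarrow> f x > 0"
  shows "smooth_fun m S (\<lambda>x. inverse (f x))"
proof -
  have "smooth_fun 1 {x \<in> cart 1. x 0 \<in> {0<..}} (\<lambda>x. 1 * inverse (x 0) ^ 1)"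
  \<comment> \<open>The multiples of powers of \<open>1/t\<close> are closed under
    differentiation.\<close>
  proof (rule smooth_fun_real[where P = "\<lambda>p. \<exists>c k. p = (\<lambda>t. c * inverse t ^ k)"])
    fix p :: "real \<Rightarrow> real" assume "\<exists>c k. p = (\<lambda>t. c * inverse t ^ k)"
    then obtain c k where p: "p = (\<lambda>t. c * inverse t ^ k)" by blast
    have "(p has_real_derivative (- c * real k) * inverse t ^ Suc k) (at t)" if "t > 0" for t
      using DERIV_cmult[OF DERIV_power[OF DERIV_inverse], of t c k] that
      unfolding p by (cases k) (simp_all add: power2_eq_square mult_ac)
    then show "\<exists>q. (\<exists>c k. q = (\<lambda>t. c * inverse t ^ k)) \<and> (\<forall>t\<in>{0<..}. (p has_real_derivative q t) (at t))"
      by (intro exI[of _ "\<lambda>t. (- c * real k) * inverse t ^ Suc k"]) blast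
  qed (auto intro!: exI[of _ 1])
  then have sm: "smooth_fun 1 {x \<in> cart 1. x 0 \<in> {0<..}} (\<lambda>x. inverse (x 0))" by simp
  show ?thesis
    using smooth_fun_compose[OF S openin_real_coord[OF open_greaterThan] sm, of "\<lambda>x i. if i = 0 then f x else 0"] pos f
    by (simp add: in_cart_iff image_subset_iff)
qed

text \<open>\<open>flat_exp 1\<close> is the standard flat function \<open>exp (- 1/t)\<close>. The
  polynomial in \<open>1/t\<close> is carried along because all derivatives of that function have
  this form.\<close>

definition flat_exp :: "real poly \<Rightarrow> real \<Rightarrow> real" where
  "flat_exp p t = (if t > 0 then poly p (inverse t) * exp (- inverse t) else 0)"

lemma tendsto_poly_exp_minus: "((\<lambda>y::real. poly p y * exp (- y)) \<longlongrightarrow> 0) at_top"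
proof -
  have "((\<lambda>y::real. \<Sum>i\<le>Polynomial.degree p. Polynomial.coeff p i * (y ^ i / exp y)) \<longlongrightarrow> 0) at_top"
    by (intro tendsto_null_sum tendsto_mult_right_zero tendsto_power_div_exp_0)
  then show ?thesis
    by (simp add: poly_altdef sum_distrib_right exp_minus divide_inverse mult.assoc)
qed

text \<open>With \<open>y = 1/t\<close>, the derivative of \<open>p(y) exp(-y)\<close> in
  \<open>t\<close> is \<open>(p(y) - p'(y)) y^2 exp(-y)\<close>; the factor \<open>y^2\<close> is
  the polynomial \<open>[:0, 0, 1:]\<close>.\<close>

lemma DERIV_flat_exp:
  "(flat_exp p has_real_derivative flat_exp ((p - pderiv p) * [:0, 0, 1:]) t) (at t)"
proof -
  consider "t > 0" | "t < 0" | "t = 0" by linarith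
  then show ?thesis
  proof cases
    case 1
    have "((\<lambda>t. poly p (inverse t) * exp (- inverse t)) has_real_derivative
        flat_exp ((p - pderiv p) * [:0, 0, 1:]) t) (at t)"
      using 1 by (auto intro!: derivative_eq_intros DERIV_chain2[OF poly_DERIV]
          simp: flat_exp_def algebra_simps power2_eq_square)
    moreover have "eventually (\<lambda>t. flat_exp p t = poly p (inverse t) * exp (- inverse t)) (nhds t)"
      using eventually_nhds_in_open[of "{0<..}" t] 1 by (auto elim!: eventually_mono simp: flat_exp_def)
    ultimately show ?thesis by (subst DERIV_cong_ev[OF refl _ refl]) auto
  next
    case 2
    have "eventually (\<lambda>t. flat_exp p t = 0) (nhds t)"
      using eventually_nhds_in_open[of "{..<0}" t] 2 by (auto elim!: eventually_mono simp: flat_exp_def)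
    then show ?thesis
      by (subst DERIV_cong_ev[OF refl _ refl, of _ "\<lambda>_. 0"]) (use 2 in \<open>auto simp: flat_exp_def\<close>)
  next
    case 3
    have "((\<lambda>h. flat_exp p h / h) \<longlongrightarrow> 0) (at_left 0)"
      by (rule tendsto_eventually) (auto simp: eventually_at_filter flat_exp_def)
    moreover have "((\<lambda>h. flat_exp p h / h) \<longlongrightarrow> 0) (at_right 0)"
    proof -
      \<comment> \<open>\<open>pCons 0 p\<close> is \<open>p\<close> times the variable: it absorbs
        the factor \<open>1/h\<close> of the difference quotient.\<close>
      have "((\<lambda>h::real. poly (pCons 0 p) (inverse h) * exp (- inverse h)) \<longlongrightarrow> 0) (at_right 0)"
        by (rule filterlim_compose[OF tendsto_poly_exp_minus filterlim_inverse_at_top_right])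
      then show ?thesis
        by (rule tendsto_cong[THEN iffD1, rotated])
          (auto simp: eventually_at_filter flat_exp_def divide_inverse)
    qed
    ultimately have "((\<lambda>h. flat_exp p h / h) \<longlongrightarrow> 0) (at 0)"
      by (rule filterlim_split_at)
    then show ?thesis using 3 by (simp add: has_field_derivative_iff flat_exp_def)
  qed
qed

lemma smooth_fun_flat_exp:
  assumes S: "openin (Euclidean_space m) S" and f: "smooth_fun m S f"
  shows "smooth_fun m S (\<lambda>x. flat_exp p (f x))"
proof -
  have sm: "smooth_fun 1 {x \<in> cart 1. x 0 \<in> UNIV} (\<lambda>x. flat_exp p (x 0))"
    by (rule smooth_fun_real[where P = "\<lambda>f. \<exists>p. f = flat_exp p"]) (auto intro: DERIV_flat_exp)
  show ?thesis
    using smooth_fun_compose[OF S openin_real_coord[OF open_UNIV] sm, of "\<lambda>x i. if i = 0 then f x else 0"] f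
    by (simp add: in_cart_iff image_subset_iff)
qed

text \<open>The unknown is the last coordinate, of index \<open>m\<close>.  The partial derivatives of \<open>g\<close> are smooth
  functions composed with \<open>z \<mapsto> (z, g z)\<close>, and such compositions are closed under partial
  derivatives.\<close>

lemma smooth_implicit:
  assumes Z: "openin (Euclidean_space m) Z"
    and T: "T = {w \<in> cart (Suc m). w(m := 0) \<in> Z}"
    and Phi: "smooth_fun (Suc m) T \<Phi>"
    and pos: "\<And>w. w \<in> T \<Longrightarrow> partial m \<Phi> w > 0"
    and zero: "\<And>z. z \<in> Z \<Longrightarrow> \<Phi> (z(m := g z)) = 0"
  shows "smooth_fun m Z g"
proof -
  have Zc: "Z \<subseteq> cart m" using Z openin_subset by blast
  have oT: "openin (Euclidean_space (Suc m)) T"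
    unfolding T
    by (rule openin_smooth_cart_preimage[OF openin_topspace _ Z])
      (auto simp: smooth_cart_def in_cart_iff not_less_eq_eq intro!: smooth_fun_coord)
  have inT: "z(m := a) \<in> T" if "z \<in> Z" for z a
  proof -
    have "z \<in> cart m" using that Zc by blast
    then have "z(m := 0) = z" by (auto simp: in_cart_iff)
    then show ?thesis using that Zc by (auto simp: T in_cart_iff)
  qed
  have der: "((\<lambda>a. \<Phi> (z(m := a))) has_real_derivative partial m \<Phi> (z(m := a))) (at a)" if "z \<in> Z" for z a
    using smooth_fun_DERIV[OF Phi inT[OF that, of a], of m] by simp
  have mono: "\<Phi> (z(m := a)) < \<Phi> (z(m := b))" if "z \<in> Z" "a < b" for z a b
    by (rule DERIV_pos_imp_increasing[OF that(2)]) (use der[OF that(1)] pos[OF inT[OF that(1)]] in blast)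
  have smF: "smooth_fun m Z (\<lambda>z. h (z(m := a)))" if "smooth_fun (Suc m) T h" for h a
  proof (rule smooth_fun_compose[OF Z oT that])
    show "smooth_fun m Z (\<lambda>z. (z(m := a)) j)" for j
      by (cases "j = m") (simp_all add: Z smooth_fun_coord smooth_fun_const)
  qed (auto simp: inT)
  have gcont: "cont_on m Z g"
  proof (rule cont_onI)
    fix x and e :: real assume x: "x \<in> Z" and e: "e > 0"
    \<comment> \<open>On \<open>N\<close> the function \<open>\<Phi>\<close> is negative at height
      \<open>g x - e\<close> and positive at height \<open>g x + e\<close>, so by monotonicity its
      zero lies in between.\<close>
    define N where "N = {z \<in> Z. \<Phi> (z(m := g x - e)) \<in> {..<0}} \<inter> {z \<in> Z. \<Phi> (z(m := g x + e)) \<in> {0<..}}"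
    have "openin (Euclidean_space m) N"
      unfolding N_def by (intro openin_Int openin_cont_on_preimage Z smooth_fun_cont smF Phi) auto
    moreover have "x \<in> N"
      using mono[OF x, of "g x - e" "g x"] mono[OF x, of "g x" "g x + e"] x e zero[OF x] by (auto simp: N_def)
    moreover have "\<bar>g y - g x\<bar> < e" if "y \<in> N" for y
    proof -
      have y: "y \<in> Z" "\<Phi> (y(m := g x - e)) < 0" "\<Phi> (y(m := g x + e)) > 0" using that by (auto simp: N_def)
      have "\<not> g y \<le> g x - e" "\<not> g y \<ge> g x + e"
        using mono[OF y(1), of "g y" "g x - e"] mono[OF y(1), of "g x + e" "g y"] y zero[OF y(1)]
        by (metis less_le not_less_iff_gr_or_eq)+
      then show ?thesis by linarith
    qed
    ultimately show "\<exists>N. openin (Euclidean_space m) N \<and> x \<in> N \<and> (\<forall>y\<in>N \<inter> Z. \<bar>g y - g x\<bar> < e)" by blast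
  qed
  \<comment> \<open>The expected partial derivative of \<open>g\<close>, written as a function of
    the point \<open>(z, g z)\<close> of \<open>T\<close> rather than of \<open>z\<close>, so that
    it is a smooth function composed with the graph map.\<close>
  define G where "G = (\<lambda>i w. - (partial i \<Phi> w * inverse (partial m \<Phi> w)))"
  have smG: "smooth_fun (Suc m) T (G i)" if "i < m" for i
  proof -
    have "smooth_fun (Suc m) T (\<lambda>w. (-1) * (partial i \<Phi> w * inverse (partial m \<Phi> w)))"
      using that by (intro smooth_fun_mult smooth_fun_const oT smooth_fun_inverse smooth_fun_partial Phi pos) auto
    then show ?thesis by (simp add: G_def)
  qed
  have gder: "((\<lambda>t. g (x(i := t))) has_real_derivative G i (x(m := g x))) (at (x i))"
    if x: "x \<in> Z" and i: "i < m" for x i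
  proof -
    define zt where "zt = (\<lambda>t. x(i := t))"
    have zx: "zt (x i) = x" by (simp add: zt_def)
    have ztc: "zt t \<in> cart m" for t using x Zc i by (auto simp: zt_def in_cart_iff)
    have evZ: "eventually (\<lambda>t. zt t \<in> Z) (at (x i))"
      using eventually_fun_upd_in[OF Z x i] unfolding zt_def eventually_at_filter by (auto elim: eventually_mono)
    have ztl: "((\<lambda>t. zt t j) \<longlongrightarrow> x j) (at (x i))" for j
      by (cases "j = i") (auto simp: zt_def)
    have glim: "((\<lambda>t. g (zt t)) \<longlongrightarrow> g x) (at (x i))"
      by (rule tendsto_cont_on[OF Z gcont x ztl]) (simp add: ztc)
    \<comment> \<open>Since \<open>\<Phi>\<close> vanishes at \<open>(z, g z)\<close>, the mean
      value theorem in the last coordinate writes \<open>\<Phi>\<close> at \<open>(z, g x)\<close>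
      as a multiple of \<open>g z - g x\<close>. Dividing turns a difference quotient of
      \<open>\<Phi>\<close> at fixed height into one of \<open>g\<close>.\<close>
    have "\<exists>\<xi>. \<bar>\<xi> - g x\<bar> \<le> \<bar>g z - g x\<bar> \<and>
        \<Phi> (z(m := g z)) - \<Phi> (z(m := g x)) = partial m \<Phi> (z(m := \<xi>)) * (g z - g x)" if "z \<in> Z" for z
      by (rule mean_value_segment) (rule der[OF that])
    then obtain \<xi> where \<xi>: "\<And>z. z \<in> Z \<Longrightarrow> \<bar>\<xi> z - g x\<bar> \<le> \<bar>g z - g x\<bar>"
       "\<And>z. z \<in> Z \<Longrightarrow> \<Phi> (z(m := g z)) - \<Phi> (z(m := g x)) = partial m \<Phi> (z(m := \<xi> z)) * (g z - g x)"
      by metis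
    have xlim: "((\<lambda>t. \<xi> (zt t)) \<longlongrightarrow> g x) (at (x i))"
    proof (rule LIM_zero_cancel, rule Lim_null_comparison)
      show "eventually (\<lambda>t. norm (\<xi> (zt t) - g x) \<le> \<bar>g (zt t) - g x\<bar>) (at (x i))"
        using evZ by eventually_elim (use \<xi> in auto)
      show "((\<lambda>t. \<bar>g (zt t) - g x\<bar>) \<longlongrightarrow> 0) (at (x i))"
        by (intro tendsto_rabs_zero LIM_zero glim)
    qed
    have plim: "((\<lambda>t. partial m \<Phi> ((zt t)(m := \<xi> (zt t)))) \<longlongrightarrow> partial m \<Phi> (x(m := g x))) (at (x i))"
    proof (rule tendsto_cont_on[OF oT smooth_fun_cont[OF smooth_fun_partial[OF Phi]] inT[OF x]])
      show "((\<lambda>t. ((zt t)(m := \<xi> (zt t))) j) \<longlongrightarrow> (x(m := g x)) j) (at (x i))" for j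
        using xlim ztl[of j] by (cases "j = m") auto
      show "eventually (\<lambda>t. (zt t)(m := \<xi> (zt t)) \<in> cart (Suc m)) (at (x i))"
        using ztc by (auto simp: in_cart_iff)
    qed simp
    have "((\<lambda>t. \<Phi> ((x(m := g x))(i := t))) has_real_derivative partial i \<Phi> (x(m := g x))) (at ((x(m := g x)) i))"
      using i by (intro smooth_fun_DERIV[OF Phi inT[OF x]]) auto
    then have "((\<lambda>t. \<Phi> ((zt t)(m := g x))) has_real_derivative partial i \<Phi> (x(m := g x))) (at (x i))"
      using i by (simp add: zt_def fun_upd_twist)
    then have qlim: "((\<lambda>t. \<Phi> ((zt t)(m := g x)) / (t - x i)) \<longlongrightarrow> partial i \<Phi> (x(m := g x))) (at (x i))"
      by (simp add: has_field_derivative_iff zx zero[OF x])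
    have "((\<lambda>t. - (\<Phi> ((zt t)(m := g x)) / (t - x i) * inverse (partial m \<Phi> ((zt t)(m := \<xi> (zt t))))))
        \<longlongrightarrow> G i (x(m := g x))) (at (x i))"
      unfolding G_def using pos[OF inT[OF x, of "g x"]]
      by (intro tendsto_minus tendsto_mult qlim tendsto_inverse plim) auto
    moreover have "eventually (\<lambda>t. - (\<Phi> ((zt t)(m := g x)) / (t - x i) * inverse (partial m \<Phi> ((zt t)(m := \<xi> (zt t)))))
        = (g (zt t) - g x) / (t - x i)) (at (x i))"
      using evZ
    proof eventually_elim
      case (elim t)
      have "\<Phi> ((zt t)(m := g x)) = - (partial m \<Phi> ((zt t)(m := \<xi> (zt t))) * (g (zt t) - g x))"
        using \<xi>(2)[OF elim] zero[OF elim] by simp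
      moreover have "partial m \<Phi> ((zt t)(m := \<xi> (zt t))) \<noteq> 0" using pos[OF inT[OF elim]] by (metis less_irrefl)
      moreover have "- (- (P * D) / s * inverse P) = D / s" if "P \<noteq> 0" for P D s :: real
        using that by (cases "s = 0") (simp_all add: field_simps)
      ultimately show ?case by simp
    qed
    ultimately have "((\<lambda>t. (g (zt t) - g x) / (t - x i)) \<longlongrightarrow> G i (x(m := g x))) (at (x i))"
      by (rule Lim_transform_eventually)
    then show ?thesis by (simp add: has_field_derivative_iff zt_def)
  qed
  have F: "(\<lambda>z. z(m := g z)) ` Z \<subseteq> T" using inT by blast
  show ?thesis
  proof (rule smooth_fun_coinduct[where P = "\<lambda>f. \<exists>h. smooth_fun (Suc m) T h \<and> f = (\<lambda>z. h (z(m := g z)))", OF Z])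
    \<comment> \<open>\<open>g\<close> itself is the last coordinate composed with the graph
      map.\<close>
    show "\<exists>h. smooth_fun (Suc m) T h \<and> g = (\<lambda>z. h (z(m := g z)))"
      by (intro exI[of _ "\<lambda>w. w m"]) (simp add: smooth_fun_coord oT)
  next
    fix f assume "\<exists>h. smooth_fun (Suc m) T h \<and> f = (\<lambda>z. h (z(m := g z)))"
    then obtain h where h: "smooth_fun (Suc m) T h" "f = (\<lambda>z. h (z(m := g z)))" by blast
    have "cont_on m Z (\<lambda>x. (x(m := g x)) j)" for j
      using gcont continuous_map_from_subtopology[OF continuous_map_coord, of m Z j] by (cases "j = m") auto
    then have "continuous_map (subtopology (Euclidean_space m) Z) (subtopology (Euclidean_space (Suc m)) T)
        (\<lambda>z. z(m := g z))"
      by (intro continuous_map_into_open oT F)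
    from continuous_map_compose[OF this smooth_fun_cont[OF h(1)]]
    show "cont_on m Z f" by (simp add: o_def h(2))
  next
    fix f i assume "\<exists>h. smooth_fun (Suc m) T h \<and> f = (\<lambda>z. h (z(m := g z)))" and i: "i < m"
    then obtain h where h: "smooth_fun (Suc m) T h" "f = (\<lambda>z. h (z(m := g z)))" by blast
    \<comment> \<open>The derivatives, with respect to coordinate \<open>i\<close>, of the
      coordinates of the graph map.\<close>
    define F' where "F' = (\<lambda>j w. if j = i then 1 else if j = m then G i w else 0)"
    define h' where "h' = (\<lambda>w. \<Sum>j<Suc m. partial j h w * F' j w)"
    have smF': "smooth_fun (Suc m) T (F' j)" for j
      unfolding F'_def using smG[OF i] i by (cases "j = i"; cases "j = m") (auto intro: smooth_fun_const oT)
    have "smooth_fun (Suc m) T (\<lambda>w. partial j h w * F' j w)" if "j < Suc m" for j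
      by (rule smooth_fun_mult[OF oT smooth_fun_partial[OF h(1) that] smF'])
    then have "smooth_fun (Suc m) T h'"
      unfolding h'_def by (intro smooth_fun_sum oT) auto
    moreover have "((\<lambda>t. f (x(i := t))) has_real_derivative h' (x(m := g x))) (at (x i))" if x: "x \<in> Z" for x
      unfolding h(2) h'_def
    proof (rule DERIV_compose_smooth[OF Z oT h(1) F _ x i])
      fix j assume "j < Suc m"
      show "((\<lambda>t. ((x(i := t))(m := g (x(i := t)))) j) has_real_derivative F' j (x(m := g x))) (at (x i))"
        using gder[OF x i] i by (cases "j = i"; cases "j = m") (auto simp: F'_def)
    qed
    ultimately show "\<exists>g'. (\<exists>h. smooth_fun (Suc m) T h \<and> g' = (\<lambda>z. h (z(m := g z)))) \<and>
         (\<forall>x\<in>Z. ((\<lambda>t. f (x(i := t))) has_real_derivative g' x) (at (x i)))"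
      by (intro exI[of _ "\<lambda>z. h' (z(m := g z))"]) blast
  qed
qed


section \<open>Compactly supported diffeomorphisms of a Cartesian space\<close>

text \<open>A product of one-variable bumps rather than a function of the norm, so that it vanishes
  outside a cube, in keeping with the basis of the topology.\<close>

definition product_bump :: "nat \<Rightarrow> real \<Rightarrow> (nat \<Rightarrow> real) \<Rightarrow> real" where
  "product_bump n e x = (\<Prod>j<n. flat_exp 1 (e\<^sup>2 - (x j)\<^sup>2))"

lemma flat_exp_1_bounds: "0 \<le> flat_exp 1 t" "flat_exp 1 t \<le> 1"
  by (auto simp: flat_exp_def)

lemma product_bump_bounds: "0 \<le> product_bump n e x" "product_bump n e x \<le> 1"
  unfolding product_bump_def by (auto intro!: prod_nonneg prod_le_1 flat_exp_1_bounds)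

lemma product_bump_centre: "e \<noteq> 0 \<Longrightarrow> product_bump n e (\<lambda>_. 0) > 0"
  unfolding product_bump_def by (intro prod_pos) (auto simp: flat_exp_def)

lemma product_bump_outside:
  assumes "j < n" "\<bar>x j\<bar> > \<bar>e\<bar>"
  shows "product_bump n e x = 0"
proof -
  have "e\<^sup>2 < (x j)\<^sup>2" using power_strict_mono[OF assms(2), of 2] by simp
  then have "flat_exp 1 (e\<^sup>2 - (x j)\<^sup>2) = 0" by (simp add: flat_exp_def)
  then show ?thesis unfolding product_bump_def using assms(1) by (intro prod_zero) auto
qed

lemma smooth_product_bump:
  assumes S: "openin (Euclidean_space m) S" and F: "\<And>j. j < n \<Longrightarrow> smooth_fun m S (\<lambda>x. F x j)"
  shows "smooth_fun m S (\<lambda>x. product_bump n e (F x))"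
  unfolding product_bump_def power2_eq_square
  by (intro smooth_fun_prod S smooth_fun_flat_exp smooth_fun_diff smooth_fun_mult smooth_fun_const F) auto

definition closed_cube :: "nat \<Rightarrow> real \<Rightarrow> (nat \<Rightarrow> real) set" where
  "closed_cube n e = {x \<in> cart n. \<forall>i<n. \<bar>x i\<bar> \<le> e}"

text \<open>Tychonoff: the closed cube is a product of intervals and, from index \<open>n\<close>
  on, of singletons.\<close>

lemma compactin_closed_cube: "compactin (Euclidean_space n) (closed_cube n e)"
proof -
  have "compactin (powertop_real UNIV) (PiE UNIV (\<lambda>i. if i < n then {-e..e} else {0}))"
    by (auto simp: compactin_PiE)
  moreover have "PiE UNIV (\<lambda>i. if i < n then {-e..e} else {0}) = closed_cube n e"
    by (auto simp: closed_cube_def in_cart_iff PiE_iff abs_le_iff split: if_splits)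
      (metis (full_types) minus_le_iff atLeastAtMost_iff)+
  ultimately show ?thesis
    by (auto simp: Euclidean_space_def compactin_subtopology closed_cube_def in_cart_iff)
qed

text \<open>Compactness bounds the sum on the closed cube; every point outside has a neighbourhood
  on which the bump is zero, so the partial derivatives vanish there.\<close>

lemma bounded_partials_product_bump:
  obtains B where "B > 0" "\<And>x. x \<in> cart n \<Longrightarrow> (\<Sum>j<n. \<bar>partial j (product_bump n e) x\<bar>) \<le> B"
proof -
  have sm: "smooth_fun n (cart n) (product_bump n e)"
    using smooth_product_bump[of n "cart n" n "\<lambda>x. x" e] by (simp add: smooth_fun_coord)
  define s where "s = (\<lambda>x. \<Sum>j<n. \<bar>partial j (product_bump n e) x\<bar>)"
  have "cont_on n (cart n) s"
    unfolding s_def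
    by (intro continuous_map_sum continuous_map_real_abs smooth_fun_cont smooth_fun_partial sm) auto
  then have "continuous_map (Euclidean_space n) euclideanreal s" by simp
  from image_compactin[OF compactin_closed_cube this, of "\<bar>e\<bar>"]
  have "bounded (s ` closed_cube n \<bar>e\<bar>)" by (simp add: compact_imp_bounded)
  then obtain B where B: "\<And>x. x \<in> closed_cube n \<bar>e\<bar> \<Longrightarrow> \<bar>s x\<bar> \<le> B"
    unfolding bounded_iff by auto
  have out: "s x = 0" if x: "x \<in> cart n" "x \<notin> closed_cube n \<bar>e\<bar>" for x
  proof -
    obtain i where i: "i < n" "\<bar>x i\<bar> > \<bar>e\<bar>" using x by (auto simp: closed_cube_def)
    define N where "N = {y \<in> cart n. y i \<in> {t. \<bar>t\<bar> > \<bar>e\<bar>}}"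
    have N: "openin (Euclidean_space n) N"
      unfolding N_def by (intro openin_real_coord open_Collect_less continuous_intros)
    \<comment> \<open>The one-element list makes the locality lemma for iterated derivatives
      applicable to a single one.\<close>
    have "iter_partial [j] (product_bump n e) x = iter_partial [j] (\<lambda>_. 0) x" if "j < n" for j
      by (rule iter_partial_cong[OF N]) (use x i that in \<open>auto simp: N_def intro!: product_bump_outside[of i]\<close>)
    then have "partial j (product_bump n e) x = 0" if "j < n" for j
      using that by (simp add: iter_partial_Cons partial_def)
    then show ?thesis by (simp add: s_def)
  qed
  have "s x \<le> \<bar>B\<bar> + 1" if "x \<in> cart n" for x
    using B[of x] out[OF that] by (cases "x \<in> closed_cube n \<bar>e\<bar>") auto
  then show thesis by (intro that[of "\<bar>B\<bar> + 1"]) (auto simp: s_def)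
qed

text \<open>A smooth isotopy from the identity, with inverses \<open>g t\<close>; no group law in
  \<open>t\<close> is claimed. Time is coordinate 0 of \<open>w\<close> and the point follows it,
  shifted by one index. That points move by multiples of \<open>u\<close> is what preserves leaves;
  that nothing moves outside \<open>K\<close> is what allows extension by the identity.\<close>

definition local_flow :: "nat \<Rightarrow> (nat \<Rightarrow> real) set \<Rightarrow> (nat \<Rightarrow> real) set \<Rightarrow> (nat \<Rightarrow> real) \<Rightarrow>
    (real \<Rightarrow> (nat \<Rightarrow> real) \<Rightarrow> nat \<Rightarrow> real) \<Rightarrow> (real \<Rightarrow> (nat \<Rightarrow> real) \<Rightarrow> nat \<Rightarrow> real) \<Rightarrow> bool" where
  "local_flow n \<Omega> K u f g \<longleftrightarrow>
     smooth_cart (Suc n) {w \<in> cart (Suc n). \<bar>w 0\<bar> < 2} n (\<lambda>w. f (w 0) (\<lambda>i. w (Suc i))) \<and>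
     smooth_cart (Suc n) {w \<in> cart (Suc n). \<bar>w 0\<bar> < 2} n (\<lambda>w. g (w 0) (\<lambda>i. w (Suc i))) \<and>
     (\<forall>t x. \<bar>t\<bar> < 2 \<longrightarrow> x \<in> \<Omega> \<longrightarrow> f t x \<in> \<Omega> \<and> g t x \<in> \<Omega> \<and> g t (f t x) = x \<and> f t (g t x) = x \<and>
        (\<exists>a. f t x = (\<lambda>i. x i + a * u i)) \<and> (\<exists>a. g t x = (\<lambda>i. x i + a * u i)) \<and>
        (x \<notin> K \<longrightarrow> f t x = x \<and> g t x = x)) \<and>
     (\<forall>x\<in>\<Omega>. f 0 x = x)"

text \<open>The diffeomorphism \<open>x \<mapsto> x + t c bmp(x) u\<close> shifts every point along \<open>u\<close>, so inverting it amounts to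
  one scalar equation for the length of the shift.\<close>

lemma exists_local_flow:
  assumes Om: "openin (Euclidean_space n) \<Omega>" "(\<lambda>_. 0) \<in> \<Omega>"
  obtains K c where "compactin (Euclidean_space n) K" "K \<subseteq> \<Omega>" "c > 0"
    "\<And>u. u \<in> cart n \<Longrightarrow> (\<And>i. i < n \<Longrightarrow> \<bar>u i\<bar> < 1) \<Longrightarrow>
       \<exists>f g. local_flow n \<Omega> K u f g \<and> f 1 (\<lambda>_. 0) = (\<lambda>i. c * u i)"
proof -
  have Omc: "\<Omega> \<subseteq> cart n" using Om openin_subset by blast
  obtain e0 where e0: "e0 > 0" "cube n (\<lambda>_. 0) e0 \<subseteq> \<Omega>"
    using Om openin_Euclidean_space_iff_cube by metis
  \<comment> \<open>Halving puts the closed cube of radius \<open>e\<close> inside the open cube of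
    radius \<open>e0\<close>.\<close>
  define e where "e = e0 / 2"
  have e: "e > 0" using e0 by (simp add: e_def)
  define K where "K = closed_cube n e"
  have K: "K \<subseteq> \<Omega>" using e0 by (force simp: K_def closed_cube_def cube_def e_def)
  define bmp where "bmp = product_bump n e"
  have smbmp: "smooth_fun n (cart n) bmp"
    using smooth_product_bump[of n "cart n" n "\<lambda>x. x" e] by (simp add: smooth_fun_coord bmp_def)
  have bmpK: "bmp x = 0" if "x \<in> cart n" "x \<notin> K" for x
    using that e by (auto simp: K_def closed_cube_def bmp_def not_le intro!: product_bump_outside)
  obtain B where B: "B > 0" "\<And>x. x \<in> cart n \<Longrightarrow> (\<Sum>j<n. \<bar>partial j bmp x\<bar>) \<le> B"
    unfolding bmp_def using bounded_partials_product_bump[of n e] by blast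
  \<comment> \<open>For times below 2 in modulus, \<open>c B < 1/4\<close> bounds the derivative of
    the shift length by 1/2, and \<open>c < 1/4\<close> bounds the shift length itself.\<close>
  define c where "c = 1 / (4 * (B + 1))"
  have c: "c > 0" "c * B < 1 / 4" "c < 1 / 4" using B(1) by (auto simp: c_def field_simps)
  have "\<exists>f g. local_flow n \<Omega> K u f g \<and> f 1 (\<lambda>_. 0) = (\<lambda>i. (c * bmp (\<lambda>_. 0)) * u i)"
    if u: "u \<in> cart n" "\<And>i. i < n \<Longrightarrow> \<bar>u i\<bar> < 1" for u
  proof -
    define sh where "sh = (\<lambda>y a i. y i - a * u i :: real)"
    have shc: "sh y a \<in> cart n" if "y \<in> cart n" for y a
      using that u by (simp add: sh_def in_cart_iff)
    define Z where "Z = {w \<in> cart (Suc n). w 0 \<in> {-2<..<2}}"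
    have oZ: "openin (Euclidean_space (Suc n)) Z" unfolding Z_def by (rule openin_real_coord) simp
    define T where "T = {w \<in> cart (Suc (Suc n)). w(Suc n := 0) \<in> Z}"
    have oT: "openin (Euclidean_space (Suc (Suc n))) T"
      unfolding T_def
      by (rule openin_smooth_cart_preimage[OF openin_topspace _ oZ])
        (auto simp: smooth_cart_def in_cart_iff not_less_eq_eq intro!: smooth_fun_coord)
    \<comment> \<open>Here \<open>w\<close> encodes a time, a point \<open>y\<close> and a candidate
      shift length \<open>a\<close>, in this order; \<open>X w\<close> is the point
      \<open>y - a u\<close> from which \<open>y\<close> would have come.\<close>
    define X where "X = (\<lambda>w i. if i < n then w (Suc i) - w (Suc n) * u i else 0)"
    have Xc: "X w \<in> cart n" for w by (simp add: X_def in_cart_iff)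
    have smX: "smooth_fun (Suc (Suc n)) T (\<lambda>w. X w j)" if "j < n" for j
      using that by (simp add: X_def) (intro smooth_fun_diff smooth_fun_mult smooth_fun_coord smooth_fun_const oT)
    \<comment> \<open>A zero means \<open>a = t c bmp(y - a u)\<close>, that is, \<open>y\<close> is
      the image of \<open>y - a u\<close> at time \<open>t\<close>.\<close>
    define \<Phi> where "\<Phi> = (\<lambda>w. w (Suc n) - w 0 * c * bmp (X w))"
    have smbmpX: "smooth_fun (Suc (Suc n)) T (\<lambda>w. bmp (X w))"
      by (rule smooth_fun_compose[OF oT openin_topspace smbmp]) (use Xc smX in auto)
    have sm\<Phi>: "smooth_fun (Suc (Suc n)) T \<Phi>"
      unfolding \<Phi>_def by (intro smooth_fun_diff smooth_fun_mult smooth_fun_coord smooth_fun_const oT smbmpX)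
    have pos: "partial (Suc n) \<Phi> w > 0" if w: "w \<in> T" for w
    proof -
      define D where "D = (\<Sum>j<n. partial j bmp (X w) * (- u j))"
      have "((\<lambda>t. bmp (X (w(Suc n := t)))) has_real_derivative D) (at (w (Suc n)))"
        unfolding D_def
        by (rule DERIV_compose_smooth[OF oT openin_topspace smbmp _ _ w])
          (use Xc in \<open>auto simp: X_def intro!: derivative_eq_intros\<close>)
      then have "((\<lambda>t. \<Phi> (w(Suc n := t))) has_real_derivative (1 - w 0 * c * D)) (at (w (Suc n)))"
        unfolding \<Phi>_def by (auto intro!: derivative_eq_intros)
      then have eq: "partial (Suc n) \<Phi> w = 1 - w 0 * c * D"
        unfolding partial_def by (rule DERIV_imp_deriv)
      have "\<bar>D\<bar> \<le> (\<Sum>j<n. \<bar>partial j bmp (X w) * (- u j)\<bar>)"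
        unfolding D_def by (rule sum_abs)
      also have "\<dots> \<le> (\<Sum>j<n. \<bar>partial j bmp (X w)\<bar>)"
        using u(2) by (intro sum_mono) (auto simp: abs_mult less_imp_le intro!: mult_left_le)
      also have "\<dots> \<le> B" by (rule B(2)[OF Xc])
      finally have "\<bar>D\<bar> \<le> B" .
      then have "c * \<bar>D\<bar> \<le> c * B" using c by simp
      then have cD: "c * \<bar>D\<bar> < 1 / 4" using c by linarith
      have w0: "\<bar>w 0\<bar> < 2" using w by (auto simp: T_def Z_def)
      have "\<bar>w 0 * c * D\<bar> = \<bar>w 0\<bar> * (c * \<bar>D\<bar>)" using c by (simp add: abs_mult)
      also have "\<dots> \<le> 2 * (1 / 4)" using cD w0 c by (intro mult_mono) auto
      finally show ?thesis unfolding eq by linarith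
    qed
    have inT: "z(Suc n := a) \<in> T" if "z \<in> Z" for z a
    proof -
      have "z(Suc n := 0) = z" using that by (auto simp: Z_def in_cart_iff)
      then show ?thesis using that by (auto simp: T_def Z_def in_cart_iff)
    qed
    have mono: "\<Phi> (z(Suc n := a)) < \<Phi> (z(Suc n := b))" if "z \<in> Z" "a < b" for z a b
    proof (rule DERIV_pos_imp_increasing[OF that(2)])
      fix x
      show "\<exists>y. ((\<lambda>a. \<Phi> (z(Suc n := a))) has_real_derivative y) (at x) \<and> 0 < y"
        using smooth_fun_DERIV[OF sm\<Phi> inT[OF that(1), of x], of "Suc n"] pos[OF inT[OF that(1), of x]] by auto
    qed
    have root: "\<exists>a. \<Phi> (z(Suc n := a)) = 0" if z: "z \<in> Z" for z
    proof -
      have small: "\<bar>z 0 * c * bmp y\<bar> \<le> 1" for y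
      proof -
        have "\<bar>z 0 * c * bmp y\<bar> = (\<bar>z 0\<bar> * c) * bmp y"
          using c product_bump_bounds[of n e y] by (simp add: abs_mult bmp_def)
        also have "\<dots> \<le> (2 * (1 / 4)) * 1"
          using c z product_bump_bounds[of n e y] by (intro mult_mono) (auto simp: Z_def bmp_def)
        finally show ?thesis by simp
      qed
      \<comment> \<open>The bump term is at most 1 in modulus, so \<plusminus>2 enclose a
        zero.\<close>
      have lo: "\<Phi> (z(Suc n := -2)) \<le> 0" and hi: "\<Phi> (z(Suc n := 2)) \<ge> 0"
        using small[of "X (z(Suc n := -2))"] small[of "X (z(Suc n := 2))"] by (auto simp: \<Phi>_def)
      have "\<exists>a\<ge>-2. a \<le> 2 \<and> \<Phi> (z(Suc n := a)) = 0"
      proof (rule IVT[where f = "\<lambda>a. \<Phi> (z(Suc n := a))", OF lo hi])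
        show "\<forall>a. -2 \<le> a \<and> a \<le> 2 \<longrightarrow> isCont (\<lambda>a. \<Phi> (z(Suc n := a))) a"
        proof (intro allI impI)
          fix a
          show "isCont (\<lambda>a. \<Phi> (z(Suc n := a))) a"
            using DERIV_isCont[OF smooth_fun_DERIV[OF sm\<Phi> inT[OF z, of a], of "Suc n"]] by simp
        qed
      qed simp
      then show ?thesis by blast
    qed
    then obtain lam where lam: "\<And>z. z \<in> Z \<Longrightarrow> \<Phi> (z(Suc n := lam z)) = 0" by metis
    have smlam: "smooth_fun (Suc n) Z lam"
      by (rule smooth_implicit[OF oZ T_def sm\<Phi> pos lam])
    define W where "W = (\<lambda>t (y :: nat \<Rightarrow> real). case_nat t y)"
    have WZ: "W t y \<in> Z" if "\<bar>t\<bar> < 2" "y \<in> cart n" for t y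
      using that by (auto simp: W_def Z_def in_cart_iff split: nat.splits)
    have PhiW: "\<Phi> ((W t y)(Suc n := a)) = a - t * c * bmp (sh y a)" if "y \<in> cart n" for t y a
    proof -
      have "X ((W t y)(Suc n := a)) = sh y a"
        using that u by (auto simp: X_def W_def sh_def in_cart_iff fun_eq_iff)
      then show ?thesis by (simp add: \<Phi>_def W_def)
    qed
    define f where "f = (\<lambda>t x. sh x (- (t * c * bmp x)))"
    define g where "g = (\<lambda>t y. sh y (lam (W t y)))"
    have fc: "f t x \<in> cart n" and gc: "g t x \<in> cart n" if "x \<in> cart n" for t x
      using shc[OF that] by (auto simp: f_def g_def)
    have fg: "f t (g t y) = y" if "\<bar>t\<bar> < 2" "y \<in> cart n" for t y
    proof -
      have "lam (W t y) = t * c * bmp (sh y (lam (W t y)))"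
        using lam[OF WZ[OF that]] PhiW[OF that(2)] by simp
      then show ?thesis unfolding f_def g_def by (simp add: sh_def fun_eq_iff)
    qed
    \<comment> \<open>The shift made by \<open>f\<close> is a zero, and by strict monotonicity it is
      the only one, hence the one that \<open>lam\<close> returns.\<close>
    have gf: "g t (f t x) = x" if "\<bar>t\<bar> < 2" "x \<in> cart n" for t x
    proof -
      define b where "b = t * c * bmp x"
      have shb: "sh (f t x) b = x" by (simp add: sh_def f_def b_def fun_eq_iff)
      have Z1: "W t (f t x) \<in> Z" using WZ that fc by blast
      have "\<Phi> ((W t (f t x))(Suc n := b)) = 0"
        using PhiW[OF fc[OF that(2)], of t t b] shb by (simp add: b_def)
      then have "lam (W t (f t x)) = b"
        using lam[OF Z1] mono[OF Z1, of b "lam (W t (f t x))"] mono[OF Z1, of "lam (W t (f t x))" b]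
        by (metis less_irrefl linorder_less_linear)
      then show ?thesis using shb by (simp add: g_def)
    qed
    have fK: "f t x = x" if "x \<in> cart n" "x \<notin> K" for t x
      using bmpK[OF that] by (simp add: f_def sh_def)
    have gK: "g t x = x" if "\<bar>t\<bar> < 2" "x \<in> cart n" "x \<notin> K" for t x
      using gf[OF that(1,2)] fK[OF that(2,3)] by simp
    \<comment> \<open>A point of \<open>K\<close> cannot leave \<open>K\<close>: its image would be
      fixed by \<open>f t\<close>, and injectivity would make it equal to the point itself.\<close>
    have fO: "f t x \<in> \<Omega>" if "\<bar>t\<bar> < 2" "x \<in> \<Omega>" for t x
    proof (cases "x \<in> K \<and> f t x \<notin> K")
      case True
      then have "f t (f t x) = f t x" using fK fc that Omc by blast
      then show ?thesis using gf that fc Omc by (metis subsetD)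
    next
      case False
      then show ?thesis using fK that K Omc by (metis subsetD)
    qed
    have gO: "g t x \<in> \<Omega>" if "\<bar>t\<bar> < 2" "x \<in> \<Omega>" for t x
    proof (cases "x \<in> K \<and> g t x \<notin> K")
      case True
      then have "f t (g t x) = g t x" using fK gc that Omc by blast
      then show ?thesis using fg that Omc by (metis subsetD)
    next
      case False
      then show ?thesis using gK that K Omc by (metis subsetD)
    qed
    have Zeq: "{w \<in> cart (Suc n). \<bar>w 0\<bar> < 2} = Z" by (auto simp: Z_def abs_less_iff)
    have smbmpZ: "smooth_fun (Suc n) Z (\<lambda>w. bmp (\<lambda>i. w (Suc i)))"
    proof (rule smooth_fun_compose[OF oZ openin_topspace smbmp])
      show "smooth_fun (Suc n) Z (\<lambda>w. w (Suc j))" for j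
        by (rule smooth_fun_coord[OF oZ])
    qed (auto simp: Z_def in_cart_iff)
    have smf: "smooth_cart (Suc n) Z n (\<lambda>w. f (w 0) (\<lambda>i. w (Suc i)))"
      unfolding smooth_cart_def
    proof (intro conjI allI impI)
      show "(\<lambda>w. f (w 0) (\<lambda>i. w (Suc i))) ` Z \<subseteq> cart n"
        by (auto intro!: fc simp: Z_def in_cart_iff)
      fix j assume "j < n"
      have "smooth_fun (Suc n) Z (\<lambda>w. w (Suc j) + w 0 * c * bmp (\<lambda>i. w (Suc i)) * u j)"
        by (intro smooth_fun_add smooth_fun_mult smooth_fun_coord smooth_fun_const oZ smbmpZ)
      then show "smooth_fun (Suc n) Z (\<lambda>w. f (w 0) (\<lambda>i. w (Suc i)) j)"
        by (simp add: f_def sh_def)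
    qed
    have Weq: "W (w 0) (\<lambda>i. w (Suc i)) = w" for w
      by (auto simp: W_def fun_eq_iff split: nat.splits)
    have smg: "smooth_cart (Suc n) Z n (\<lambda>w. g (w 0) (\<lambda>i. w (Suc i)))"
      unfolding smooth_cart_def
    proof (intro conjI allI impI)
      show "(\<lambda>w. g (w 0) (\<lambda>i. w (Suc i))) ` Z \<subseteq> cart n"
        by (auto intro!: gc simp: Z_def in_cart_iff)
      fix j assume "j < n"
      have "smooth_fun (Suc n) Z (\<lambda>w. w (Suc j) - lam w * u j)"
        by (intro smooth_fun_diff smooth_fun_mult smooth_fun_coord smooth_fun_const oZ smlam)
      then show "smooth_fun (Suc n) Z (\<lambda>w. g (w 0) (\<lambda>i. w (Suc i)) j)"
        by (simp add: g_def sh_def Weq)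
    qed
    have shx: "\<exists>a. sh x b = (\<lambda>i. x i + a * u i)" for x b
      by (rule exI[of _ "-b"]) (simp add: sh_def)
    have "local_flow n \<Omega> K u f g"
      unfolding local_flow_def Zeq
      using smf smg fO gO Omc fg gf fK gK shx unfolding f_def[symmetric]
      by (auto simp: f_def g_def sh_def intro!: subsetD[OF Omc])
    moreover have "f 1 (\<lambda>_. 0) = (\<lambda>i. (c * bmp (\<lambda>_. 0)) * u i)"
      by (simp add: f_def sh_def)
    ultimately show ?thesis by blast
  qed
  moreover have "c * bmp (\<lambda>_. 0) > 0"
    using c e product_bump_centre[of e n] by (simp add: bmp_def)
  ultimately show thesis
    using that[of K "c * bmp (\<lambda>_. 0)"] K compactin_closed_cube[of n e] by (simp add: K_def)
qed


section \<open>Smooth maps in charts\<close>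

lemma is_chartD:
  assumes "is_chart n X (D, \<phi>)"
  shows "D \<subseteq> X" "\<phi> \<in> extensional D" "inj_on \<phi> D" "openin (Euclidean_space n) (\<phi> ` D)"
  using assms by (auto simp: is_chart_def)

lemma compatible_sym: "compatible n c c' \<Longrightarrow> compatible n c' c"
  by (auto simp: compatible_def Int_commute split: prod.splits)

lemma compatibleD:
  assumes "compatible n (D, \<phi>) (E, \<xi>)"
  shows "openin (Euclidean_space n) (\<phi> ` (D \<inter> E))" "openin (Euclidean_space n) (\<xi> ` (D \<inter> E))"
    "smooth_cart n (\<phi> ` (D \<inter> E)) n (\<xi> \<circ> inv_into D \<phi>)"
    "smooth_cart n (\<xi> ` (D \<inter> E)) n (\<phi> \<circ> inv_into E \<xi>)"
  using assms by (auto simp: compatible_def)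

text \<open>\<open>smooth_map\<close> lets the charts be chosen and asks that \<open>f\<close> map
  one domain into the other. Here the charts are prescribed and the shrinking happens in an open set
  \<open>N\<close> of coordinates, so that charts can be exchanged and maps composed.\<close>

definition smooth_in_charts ::
    "nat \<Rightarrow> 'a set \<Rightarrow> ('a \<Rightarrow> nat \<Rightarrow> real) \<Rightarrow> nat \<Rightarrow> 'b set \<Rightarrow> ('b \<Rightarrow> nat \<Rightarrow> real) \<Rightarrow> ('a \<Rightarrow> 'b) \<Rightarrow> 'a \<Rightarrow> bool" where
  "smooth_in_charts m D \<phi> n E \<xi> f x \<longleftrightarrow> x \<in> D \<and>
     (\<exists>N. openin (Euclidean_space m) N \<and> \<phi> x \<in> N \<and> N \<subseteq> \<phi> ` D \<and>
        (\<forall>z\<in>N. f (inv_into D \<phi> z) \<in> E) \<and> smooth_cart m N n (\<lambda>z. \<xi> (f (inv_into D \<phi> z))))"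

lemma smooth_in_charts_source:
  assumes c: "compatible m (D, \<phi>) (D', \<phi>')" and i: "inj_on \<phi> D" "inj_on \<phi>' D'" and x: "x \<in> D'"
    and f: "smooth_in_charts m D \<phi> n E \<xi> f x"
  shows "smooth_in_charts m D' \<phi>' n E \<xi> f x"
proof -
  obtain N where N: "openin (Euclidean_space m) N" "\<phi> x \<in> N" "N \<subseteq> \<phi> ` D"
     "\<forall>z\<in>N. f (inv_into D \<phi> z) \<in> E" "smooth_cart m N n (\<lambda>z. \<xi> (f (inv_into D \<phi> z)))" and xD: "x \<in> D"
    using f by (auto simp: smooth_in_charts_def)
  note c' = compatibleD[OF c]
  define N' where "N' = {z \<in> \<phi>' ` (D \<inter> D'). (\<phi> \<circ> inv_into D' \<phi>') z \<in> N}"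
  have oN': "openin (Euclidean_space m) N'"
    unfolding N'_def by (rule openin_smooth_cart_preimage[OF c'(2,4) N(1)])
  have inv: "inv_into D \<phi> (\<phi> (inv_into D' \<phi>' z)) = inv_into D' \<phi>' z"
    and N'D: "\<phi> (inv_into D' \<phi>' z) \<in> N" "z \<in> \<phi>' ` D'" if "z \<in> N'" for z
    using that i by (auto simp: N'_def)
  have "smooth_cart m N' n (\<lambda>z. (\<lambda>z. \<xi> (f (inv_into D \<phi> z))) ((\<phi> \<circ> inv_into D' \<phi>') z))"
    by (rule smooth_cart_compose[OF oN' N(1) smooth_cart_mono[OF c'(4)] N(5)]) (auto simp: N'_def)
  then have "smooth_cart m N' n (\<lambda>z. \<xi> (f (inv_into D' \<phi>' z)))"
    by (rule smooth_cart_cong[OF oN', rotated]) (simp add: inv)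
  moreover have "\<phi>' x \<in> N'" using x xD i N by (auto simp: N'_def)
  moreover have "\<forall>z\<in>N'. f (inv_into D' \<phi>' z) \<in> E"
    using N(4) N'D(1) inv by force
  moreover have "N' \<subseteq> \<phi>' ` D'" using N'D(2) by blast
  ultimately show ?thesis
    using oN' x unfolding smooth_in_charts_def by (intro conjI exI[of _ N'])
qed

lemma smooth_in_charts_target:
  assumes c: "compatible n (E, \<xi>) (E', \<xi>')" and i: "inj_on \<xi> E" and x: "f x \<in> E'"
    and iD: "inj_on \<phi> D"
    and f: "smooth_in_charts m D \<phi> n E \<xi> f x"
  shows "smooth_in_charts m D \<phi> n E' \<xi>' f x"
proof -
  obtain N where N: "openin (Euclidean_space m) N" "\<phi> x \<in> N" "N \<subseteq> \<phi> ` D"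
     "\<forall>z\<in>N. f (inv_into D \<phi> z) \<in> E" "smooth_cart m N n (\<lambda>z. \<xi> (f (inv_into D \<phi> z)))" and xD: "x \<in> D"
    using f by (auto simp: smooth_in_charts_def)
  note c' = compatibleD[OF c]
  define N' where "N' = {z \<in> N. \<xi> (f (inv_into D \<phi> z)) \<in> \<xi> ` (E \<inter> E')}"
  have oN': "openin (Euclidean_space m) N'"
    unfolding N'_def by (rule openin_smooth_cart_preimage[OF N(1,5) c'(1)])
  have inE: "f (inv_into D \<phi> z) \<in> E \<inter> E'" if "z \<in> N'" for z
    using that N(4) i by (auto simp: N'_def dest: inj_onD)
  have "smooth_cart m N' n (\<lambda>z. (\<xi>' \<circ> inv_into E \<xi>) (\<xi> (f (inv_into D \<phi> z))))"
    by (rule smooth_cart_compose[OF oN' c'(1) smooth_cart_mono[OF N(5)] c'(3)]) (auto simp: N'_def)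
  then have "smooth_cart m N' n (\<lambda>z. \<xi>' (f (inv_into D \<phi> z)))"
    by (rule smooth_cart_cong[OF oN', rotated]) (use inE i in simp)
  moreover have "\<phi> x \<in> N'"
    using x xD iD N by (force simp: N'_def)
  moreover have "N' \<subseteq> \<phi> ` D" using N(3) by (auto simp: N'_def)
  moreover have "\<forall>z\<in>N'. f (inv_into D \<phi> z) \<in> E'" using inE by blast
  ultimately show ?thesis
    using oN' xD unfolding smooth_in_charts_def by (intro conjI exI[of _ N'])
qed

lemma smooth_in_charts_compose:
  assumes f: "smooth_in_charts m D \<phi> n E \<xi> f x" and g: "smooth_in_charts n E \<xi> k G \<zeta> g (f x)"
    and iD: "inj_on \<phi> D" and iE: "inj_on \<xi> E"
  shows "smooth_in_charts m D \<phi> k G \<zeta> (\<lambda>x. g (f x)) x"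
proof -
  obtain N where N: "openin (Euclidean_space m) N" "\<phi> x \<in> N" "N \<subseteq> \<phi> ` D"
     "\<forall>z\<in>N. f (inv_into D \<phi> z) \<in> E" "smooth_cart m N n (\<lambda>z. \<xi> (f (inv_into D \<phi> z)))" and xD: "x \<in> D"
    using f by (auto simp: smooth_in_charts_def)
  obtain Q where Q: "openin (Euclidean_space n) Q" "\<xi> (f x) \<in> Q" "Q \<subseteq> \<xi> ` E"
     "\<forall>z\<in>Q. g (inv_into E \<xi> z) \<in> G" "smooth_cart n Q k (\<lambda>z. \<zeta> (g (inv_into E \<xi> z)))"
    using g by (auto simp: smooth_in_charts_def)
  define N' where "N' = {z \<in> N. \<xi> (f (inv_into D \<phi> z)) \<in> Q}"
  have oN': "openin (Euclidean_space m) N'"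
    unfolding N'_def by (rule openin_smooth_cart_preimage[OF N(1,5) Q(1)])
  have inv: "inv_into E \<xi> (\<xi> (f (inv_into D \<phi> z))) = f (inv_into D \<phi> z)" if "z \<in> N'" for z
    using that N(4) iE by (auto simp: N'_def)
  have "smooth_cart m N' k (\<lambda>z. (\<lambda>z. \<zeta> (g (inv_into E \<xi> z))) (\<xi> (f (inv_into D \<phi> z))))"
    by (rule smooth_cart_compose[OF oN' Q(1) smooth_cart_mono[OF N(5)] Q(5)]) (auto simp: N'_def)
  then have "smooth_cart m N' k (\<lambda>z. \<zeta> (g (f (inv_into D \<phi> z))))"
    by (rule smooth_cart_cong[OF oN', rotated]) (simp add: inv)
  moreover have "\<phi> x \<in> N'" using xD iD N Q by (auto simp: N'_def)
  moreover have "\<forall>z\<in>N'. g (f (inv_into D \<phi> z)) \<in> G"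
    using Q(4) inv by (force simp: N'_def)
  moreover have "N' \<subseteq> \<phi> ` D" using N(3) by (auto simp: N'_def)
  ultimately show ?thesis
    using oN' xD unfolding smooth_in_charts_def by (intro conjI exI[of _ N'])
qed

lemma smooth_in_chartsI:
  assumes "openin (Euclidean_space m) N" "x \<in> D" "\<phi> x \<in> N" "N \<subseteq> \<phi> ` D"
    "\<And>z. z \<in> N \<Longrightarrow> f (inv_into D \<phi> z) \<in> E" "smooth_cart m N n h"
    "\<And>z. z \<in> N \<Longrightarrow> h z = \<xi> (f (inv_into D \<phi> z))"
  shows "smooth_in_charts m D \<phi> n E \<xi> f x"
proof -
  have "smooth_cart m N n (\<lambda>z. \<xi> (f (inv_into D \<phi> z)))"
    by (rule smooth_cart_cong[OF assms(1) _ assms(6)]) (rule assms(7))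
  then show ?thesis
    unfolding smooth_in_charts_def using assms(1-5) by (intro conjI exI[of _ N]) auto
qed

text \<open>The common form of the atlases of manifolds, \<open>cart_mfd\<close> and
  \<open>prod_mfd\<close>: all charts compatible with some family \<open>A\<close>. It does not say
  that two members are compatible with each other; \<open>ref_chart\<close> singles out members
  compatible with all.\<close>

definition maximal_mfd :: "'a mfd \<Rightarrow> bool" where
  "maximal_mfd N \<longleftrightarrow> 
     (\<exists>A. (\<forall>c\<in>A. is_chart (mdim N) (points N) c) \<and> atlas N = maximal_atlas (mdim N) (points N) A)"

definition ref_chart :: "'a mfd \<Rightarrow> 'a set \<Rightarrow> ('a \<Rightarrow> nat \<Rightarrow> real) \<Rightarrow> bool" where
  "ref_chart N D \<phi> \<longleftrightarrow> (D, \<phi>) \<in> atlas N \<and> (\<forall>c\<in>atlas N. compatible (mdim N) c (D, \<phi>))"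

lemma maximal_mfd_is_chart: "maximal_mfd N \<Longrightarrow> c \<in> atlas N \<Longrightarrow> is_chart (mdim N) (points N) c"
  by (auto simp: maximal_mfd_def maximal_atlas_def)

lemma ref_chart_inj: "maximal_mfd N \<Longrightarrow> ref_chart N D \<phi> \<Longrightarrow> inj_on \<phi> D"
  using is_chartD(3)[OF maximal_mfd_is_chart] unfolding ref_chart_def by blast

lemma manifold_maximal:
  assumes "manifold M"
  shows "maximal_mfd M"
  unfolding maximal_mfd_def
proof (intro exI[of _ "atlas M"] conjI)
  show "\<forall>c\<in>atlas M. is_chart (mdim M) (points M) c"
    using assms unfolding manifold_def smooth_atlas_def by (elim conjE)
  show "atlas M = maximal_atlas (mdim M) (points M) (atlas M)"
    using assms unfolding manifold_def by (elim conjE) (rule sym)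
qed

lemma manifold_ref_chart: "manifold M \<Longrightarrow> ref_chart M D \<phi> \<longleftrightarrow> (D, \<phi>) \<in> atlas M"
  by (auto simp: manifold_def smooth_atlas_def ref_chart_def)

lemma manifold_chart_at:
  assumes "manifold M" "x \<in> points M"
  obtains D \<phi> where "(D, \<phi>) \<in> atlas M" "x \<in> D"
proof -
  have "\<Union> (fst ` atlas M) = points M"
    using assms(1) unfolding manifold_def smooth_atlas_def by (elim conjE)
  with assms(2) obtain c where "c \<in> atlas M" "x \<in> fst c" by blast
  then show thesis using that[of "fst c" "snd c"] by simp
qed

text \<open>The charts supplied by \<open>smooth_map\<close> are traded for the prescribed ones
  through transition maps, which are smooth because the latter are reference charts.\<close>

lemma smooth_map_in_charts:
  assumes N: "maximal_mfd N" and M: "maximal_mfd M" and f: "smooth_map N M f" and x: "x \<in> D"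
    and D: "ref_chart N D \<phi>" and E: "ref_chart M E \<xi>" and fx: "f x \<in> E"
  shows "smooth_in_charts (mdim N) D \<phi> (mdim M) E \<xi> f x"
proof -
  have "x \<in> points N"
    using is_chartD(1)[OF maximal_mfd_is_chart[OF N]] D x unfolding ref_chart_def by blast
  then have "\<exists>c\<in>atlas N. \<exists>c'\<in>atlas M. x \<in> fst c \<and> f ` fst c \<subseteq> fst c' \<and>
      smooth_cart (mdim N) (snd c ` fst c) (mdim M) (snd c' \<circ> f \<circ> inv_into (fst c) (snd c))"
    using f unfolding smooth_map_def case_prod_unfold by blast
  then obtain D' \<phi>' E' \<xi>' where *: "(D', \<phi>') \<in> atlas N" "(E', \<xi>') \<in> atlas M" "x \<in> D'" "f ` D' \<subseteq> E'"
    "smooth_cart (mdim N) (\<phi>' ` D') (mdim M) (\<xi>' \<circ> f \<circ> inv_into D' \<phi>')"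
    by (auto simp only: fst_conv snd_conv)
  note cD = is_chartD[OF maximal_mfd_is_chart[OF N *(1)]] and cE = is_chartD[OF maximal_mfd_is_chart[OF M *(2)]]
  have "smooth_in_charts (mdim N) D' \<phi>' (mdim M) E' \<xi>' f x"
    unfolding smooth_in_charts_def using * cD
    by (intro conjI exI[of _ "\<phi>' ` D'"]) (auto simp: o_def)
  then have "smooth_in_charts (mdim N) D \<phi> (mdim M) E' \<xi>' f x"
    using D *(1) ref_chart_inj[OF N D] cD x
    by (intro smooth_in_charts_source[of "mdim N" D' \<phi>' D \<phi>]) (auto simp: ref_chart_def)
  then show ?thesis
    using E *(2) ref_chart_inj[OF N D] cE fx
    by (intro smooth_in_charts_target[of "mdim M" E' \<xi>' E \<xi>]) (auto simp: ref_chart_def)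
qed

text \<open>Shrinking a chart stays within the atlas. This turns the open set of coordinates in
  \<open>smooth_in_charts\<close> back into the chart domain demanded by
  \<open>smooth_map\<close>.\<close>

lemma restrict_chart:
  assumes N: "maximal_mfd N" and D: "(D, \<phi>) \<in> atlas N"
    and Q: "openin (Euclidean_space (mdim N)) Q" "Q \<subseteq> \<phi> ` D"
  defines "D' \<equiv> inv_into D \<phi> ` Q"
  shows "(D', restrict \<phi> D') \<in> atlas N"
proof -
  obtain A where A: "atlas N = maximal_atlas (mdim N) (points N) A"
    and cA: "\<And>c. c \<in> A \<Longrightarrow> is_chart (mdim N) (points N) c"
    using N by (auto simp: maximal_mfd_def)
  note c = is_chartD[OF maximal_mfd_is_chart[OF N D]]
  have D': "D' \<subseteq> D" unfolding D'_def using Q(2) by (auto intro: inv_into_into)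
  have im: "\<phi> ` D' = Q" unfolding D'_def using Q(2) by (force simp: image_iff f_inv_into_f subset_iff)
  have inj': "inj_on \<phi> D'" using c(3) D' inj_on_subset by blast
  have inv: "inv_into D' (restrict \<phi> D') z = inv_into D \<phi> z" if "z \<in> \<phi> ` D'" for z
    using that D' c(3) by (auto intro!: inv_into_f_eq[of _ D'] simp: inj_on_restrict_eq inj')
  have "is_chart (mdim N) (points N) (D', restrict \<phi> D')"
    using c D' im Q(1) by (auto simp: is_chart_def inj_on_restrict_eq inj')
  moreover have "compatible (mdim N) (D', restrict \<phi> D') (E, \<xi>)" if E: "(E, \<xi>) \<in> A" for E \<xi>
  proof -
    have co: "compatible (mdim N) (D, \<phi>) (E, \<xi>)" using D E A by (auto simp: maximal_atlas_def)
    note cc = compatibleD[OF co]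
    note iE = is_chartD(3)[OF cA[OF E]]
    have D'Q: "y \<in> D' \<longleftrightarrow> \<phi> y \<in> Q" if "y \<in> D" for y
      using im D' c(3) that by (auto simp: inj_on_def)
    have im1: "restrict \<phi> D' ` (D' \<inter> E) = Q \<inter> \<phi> ` (D \<inter> E)"
      using D'Q D' by auto
    have im2: "\<xi> ` (D' \<inter> E) = {w \<in> \<xi> ` (D \<inter> E). (\<phi> \<circ> inv_into E \<xi>) w \<in> Q}"
      using D'Q D' iE by auto
    have o1: "openin (Euclidean_space (mdim N)) (restrict \<phi> D' ` (D' \<inter> E))"
      unfolding im1 using Q(1) cc(1) by blast
    have o2: "openin (Euclidean_space (mdim N)) (\<xi> ` (D' \<inter> E))"
      unfolding im2 by (rule openin_smooth_cart_preimage[OF cc(2,4) Q(1)])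
    have s1: "smooth_cart (mdim N) (restrict \<phi> D' ` (D' \<inter> E)) (mdim N) (\<xi> \<circ> inv_into D' (restrict \<phi> D'))"
      by (rule smooth_cart_cong[OF o1 _ smooth_cart_mono[OF cc(3)]]) (use inv im D' in auto)
    have s2: "smooth_cart (mdim N) (\<xi> ` (D' \<inter> E)) (mdim N) (restrict \<phi> D' \<circ> inv_into E \<xi>)"
      by (rule smooth_cart_cong[OF o2 _ smooth_cart_mono[OF cc(4)]]) (use iE D' in auto)
    show ?thesis using o1 o2 s1 s2 by (simp add: compatible_def)
  qed
  ultimately show ?thesis unfolding A by (auto simp: maximal_atlas_def)
qed


lemma smooth_mapI:
  assumes N: "maximal_mfd N" and f: "f ` points N \<subseteq> points M"
    and loc: "\<And>x. x \<in> points N \<Longrightarrow> \<exists>D \<phi> E \<xi>. (D, \<phi>) \<in> atlas N \<and> (E, \<xi>) \<in> atlas M \<and>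
        smooth_in_charts (mdim N) D \<phi> (mdim M) E \<xi> f x"
  shows "smooth_map N M f"
  unfolding smooth_map_def
proof (intro conjI ballI f)
  fix x assume "x \<in> points N"
  then obtain D \<phi> E \<xi> where D: "(D, \<phi>) \<in> atlas N" and E: "(E, \<xi>) \<in> atlas M"
    and "smooth_in_charts (mdim N) D \<phi> (mdim M) E \<xi> f x" using loc by blast
  then obtain Q where Q: "openin (Euclidean_space (mdim N)) Q" "\<phi> x \<in> Q" "Q \<subseteq> \<phi> ` D"
     "\<forall>z\<in>Q. f (inv_into D \<phi> z) \<in> E" and sm: "smooth_cart (mdim N) Q (mdim M) (\<lambda>z. \<xi> (f (inv_into D \<phi> z)))"
    and xD: "x \<in> D"
    unfolding smooth_in_charts_def by (elim conjE exE)
  define D' where "D' = inv_into D \<phi> ` Q"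
  note iD = is_chartD(3)[OF maximal_mfd_is_chart[OF N D]]
  have xD': "x \<in> D'" unfolding D'_def using Q(2) xD iD by (intro image_eqI[of _ _ "\<phi> x"]) simp_all
  have eq: "restrict \<phi> D' (inv_into D \<phi> z) = z" "inv_into D \<phi> z \<in> D'" if "z \<in> Q" for z
    using that Q(3) unfolding D'_def by (auto simp: f_inv_into_f subset_iff)
  have im: "restrict \<phi> D' ` D' = Q" using eq by (force simp: D'_def)
  have "inj_on (restrict \<phi> D') D'"
    by (rule inj_on_inverseI[of _ "inv_into D \<phi>"]) (use eq in \<open>force simp: D'_def\<close>)
  then have inv: "inv_into D' (restrict \<phi> D') z = inv_into D \<phi> z" if "z \<in> Q" for z
    using eq[OF that] by (metis inv_into_f_f)
  have "smooth_cart (mdim N) Q (mdim M) (\<xi> \<circ> f \<circ> inv_into D' (restrict \<phi> D'))"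
    by (rule smooth_cart_cong[OF Q(1) _ sm]) (simp add: inv)
  moreover have "f ` D' \<subseteq> E" using Q(4) by (auto simp: D'_def)
  ultimately have *: "x \<in> D' \<and> f ` D' \<subseteq> E \<and>
      smooth_cart (mdim N) (restrict \<phi> D' ` D') (mdim M) (\<xi> \<circ> f \<circ> inv_into D' (restrict \<phi> D'))"
    unfolding im using xD' by blast
  have D': "(D', restrict \<phi> D') \<in> atlas N"
    unfolding D'_def by (rule restrict_chart[OF N D Q(1,3)])
  show "\<exists>(D, \<phi>)\<in>atlas N. \<exists>(E, \<xi>)\<in>atlas M. x \<in> D \<and> f ` D \<subseteq> E \<and>
        smooth_cart (mdim N) (\<phi> ` D) (mdim M) (\<xi> \<circ> f \<circ> inv_into D \<phi>)"
    by (rule bexI[OF _ D'], unfold case_prod_conv, rule bexI[OF _ E], unfold case_prod_conv, fact)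
qed

section \<open>Open sets of Cartesian spaces as manifolds\<close>

lemma smooth_cart_ident: "openin (Euclidean_space m) S \<Longrightarrow> smooth_cart m S m (\<lambda>x. x)"
  using openin_subset by (auto simp: smooth_cart_def smooth_fun_coord)

lemma is_chart_id: "openin (Euclidean_space m) S \<Longrightarrow> is_chart m S (S, \<lambda>x\<in>S. x)"
  by (auto simp: is_chart_def inj_on_def)

lemma inv_into_restrict_id: "z \<in> S \<Longrightarrow> inv_into S (\<lambda>x\<in>S. x) z = z"
  by (rule inv_into_f_eq) (auto simp: inj_on_def)

lemma compatible_id:
  assumes "openin (Euclidean_space m) S"
  shows "compatible m (S, \<lambda>x\<in>S. x) (S, \<lambda>x\<in>S. x)"
proof -
  have "smooth_cart m S m ((\<lambda>x\<in>S. x) \<circ> inv_into S (\<lambda>x\<in>S. x))"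
    by (rule smooth_cart_cong[OF assms _ smooth_cart_ident[OF assms]]) (simp add: inv_into_restrict_id)
  then show ?thesis using assms by (simp add: compatible_def)
qed

lemma cart_mfd_simps [simp]: "points (cart_mfd m S) = S" "mdim (cart_mfd m S) = m"
  by (simp_all add: cart_mfd_def)

lemma maximal_cart_mfd: "openin (Euclidean_space m) S \<Longrightarrow> maximal_mfd (cart_mfd m S)"
  unfolding maximal_mfd_def cart_mfd_def
  by (intro exI[of _ "{(S, \<lambda>x\<in>S. x)}"]) (simp add: is_chart_id)

lemma cart_mfd_ref_chart:
  assumes "openin (Euclidean_space m) S"
  shows "ref_chart (cart_mfd m S) S (\<lambda>x\<in>S. x)"
  using assms by (simp add: ref_chart_def cart_mfd_def maximal_atlas_def is_chart_id compatible_id)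

section \<open>The two projections that undo \<open>cat\<close>\<close>

definition block1 :: "nat \<Rightarrow> (nat \<Rightarrow> real) \<Rightarrow> nat \<Rightarrow> real" where
  "block1 m w = (\<lambda>i. if i < m then w i else 0)"

definition block2 :: "nat \<Rightarrow> (nat \<Rightarrow> real) \<Rightarrow> nat \<Rightarrow> real" where
  "block2 m w = (\<lambda>i. w (m + i))"

lemma cat_blocks: "cat m (block1 m w) (block2 m w) = w"
  by (auto simp: cat_def block1_def block2_def fun_eq_iff)

lemma block1_cat: "a \<in> cart m \<Longrightarrow> block1 m (cat m a b) = a"
  by (auto simp: cat_def block1_def in_cart_iff fun_eq_iff)

lemma block2_cat: "block2 m (cat m a b) = b"
  by (auto simp: cat_def block2_def fun_eq_iff)

lemma cat_in_cart: "cat m a b \<in> cart (m + n) \<longleftrightarrow> b \<in> cart n"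
proof
  assume *: "cat m a b \<in> cart (m + n)"
  have "b i = 0" if "i \<ge> n" for i
    using * that by (auto simp: in_cart_iff cat_def dest: spec[of _ "m + i"])
  then show "b \<in> cart n" by (simp add: in_cart_iff)
qed (auto simp: in_cart_iff cat_def)

lemma smooth_cart_block1: "openin (Euclidean_space (m + n)) S \<Longrightarrow> smooth_cart (m + n) S m (block1 m)"
  by (auto simp: smooth_cart_def block1_def in_cart_iff smooth_fun_coord)

lemma smooth_cart_block2:
  assumes "openin (Euclidean_space (m + n)) S"
  shows "smooth_cart (m + n) S n (block2 m)"
  using openin_subset[OF assms] by (auto simp: smooth_cart_def block2_def in_cart_iff smooth_fun_coord[OF assms])

lemma smooth_cart_cat:
  assumes "smooth_cart k S m f" "smooth_cart k S n g"
  shows "smooth_cart k S (m + n) (\<lambda>x. cat m (f x) (g x))"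
  unfolding smooth_cart_def
proof (intro conjI allI impI)
  show "(\<lambda>x. cat m (f x) (g x)) ` S \<subseteq> cart (m + n)"
    using assms(2) by (auto simp: cat_in_cart smooth_cart_def)
  show "smooth_fun k S (\<lambda>x. cat m (f x) (g x) j)" if "j < m + n" for j
    using assms that by (cases "j < m") (auto simp: cat_def smooth_cart_def)
qed

lemma cat_image_eq:
  assumes "A \<subseteq> cart m" "B \<subseteq> cart n"
  shows "{cat m a b |a b. a \<in> A \<and> b \<in> B} = {w \<in> cart (m + n). block1 m w \<in> A \<and> block2 m w \<in> B}"
    (is "?L = ?R")
proof (intro Set.set_eqI iffI)
  fix w assume "w \<in> ?L"
  then obtain a b where "w = cat m a b" "a \<in> A" "b \<in> B" by blast
  then show "w \<in> ?R" using assms by (auto simp: cat_in_cart block1_cat block2_cat subset_iff)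
next
  fix w assume "w \<in> ?R"
  then show "w \<in> ?L" using cat_blocks[of m w] by force
qed

lemma openin_cat_image:
  assumes "openin (Euclidean_space m) A" "openin (Euclidean_space n) B"
  shows "openin (Euclidean_space (m + n)) {cat m a b |a b. a \<in> A \<and> b \<in> B}"
proof -
  have "{w \<in> cart (m + n). block1 m w \<in> A \<and> block2 m w \<in> B} =
      {w \<in> cart (m + n). block1 m w \<in> A} \<inter> {w \<in> cart (m + n). block2 m w \<in> B}" by blast
  moreover have "openin (Euclidean_space (m + n)) {w \<in> cart (m + n). block1 m w \<in> A}"
    by (rule openin_smooth_cart_preimage[OF _ smooth_cart_block1 assms(1)]) auto
  moreover have "openin (Euclidean_space (m + n)) {w \<in> cart (m + n). block2 m w \<in> B}"
    by (rule openin_smooth_cart_preimage[OF _ smooth_cart_block2 assms(2)]) auto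
  ultimately show ?thesis
    by (simp add: cat_image_eq[OF openin_subset[OF assms(1)] openin_subset[OF assms(2)]] openin_Int)
qed

section \<open>Product charts and the product atlas\<close>

definition prod_chart ::
    "nat \<Rightarrow> 'a set \<Rightarrow> ('a \<Rightarrow> nat \<Rightarrow> real) \<Rightarrow> 'b set \<Rightarrow> ('b \<Rightarrow> nat \<Rightarrow> real) \<Rightarrow> 'a \<times> 'b \<Rightarrow> nat \<Rightarrow> real" where
  "prod_chart m D \<phi> E \<xi> = (\<lambda>(x, y)\<in>D \<times> E. cat m (\<phi> x) (\<xi> y))"

lemma prod_chart_apply: "x \<in> D \<Longrightarrow> y \<in> E \<Longrightarrow> prod_chart m D \<phi> E \<xi> (x, y) = cat m (\<phi> x) (\<xi> y)"
  by (simp add: prod_chart_def)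

lemma prod_chart_image:
  "D' \<subseteq> D \<Longrightarrow> E' \<subseteq> E \<Longrightarrow>
   prod_chart m D \<phi> E \<xi> ` (D' \<times> E') = {cat m a b |a b. a \<in> \<phi> ` D' \<and> b \<in> \<xi> ` E'}"
  by (force simp: prod_chart_def image_iff)

context
  fixes m n :: nat and X :: "'a set" and Y :: "'b set" and D \<phi> E \<xi>
  assumes D: "is_chart m X (D, \<phi>)" and E: "is_chart n Y (E, \<xi>)"
begin

lemma block1_prod_chart: "x \<in> D \<Longrightarrow> y \<in> E \<Longrightarrow> block1 m (prod_chart m D \<phi> E \<xi> (x, y)) = \<phi> x"
  using openin_subset[OF is_chartD(4)[OF D]] by (auto simp: prod_chart_apply block1_cat)

lemma block2_prod_chart: "x \<in> D \<Longrightarrow> y \<in> E \<Longrightarrow> block2 m (prod_chart m D \<phi> E \<xi> (x, y)) = \<xi> y"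
  by (auto simp: prod_chart_apply block2_cat)

lemma inj_prod_chart: "inj_on (prod_chart m D \<phi> E \<xi>) (D \<times> E)"
proof (rule inj_onI)
  fix p q assume pq: "p \<in> D \<times> E" "q \<in> D \<times> E" "prod_chart m D \<phi> E \<xi> p = prod_chart m D \<phi> E \<xi> q"
  obtain x y x' y' where "p = (x, y)" "q = (x', y')" by (cases p; cases q) blast
  then show "p = q"
    using pq block1_prod_chart[of x y] block1_prod_chart[of x' y'] block2_prod_chart[of x y]
      block2_prod_chart[of x' y'] is_chartD(3)[OF D] is_chartD(3)[OF E]
    by (auto dest: inj_onD)
qed

lemma inv_prod_chart_block:
  assumes "w \<in> prod_chart m D \<phi> E \<xi> ` (D \<times> E)"
  shows "inv_into (D \<times> E) (prod_chart m D \<phi> E \<xi>) w = (inv_into D \<phi> (block1 m w), inv_into E \<xi> (block2 m w))"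
    "block1 m w \<in> \<phi> ` D" "block2 m w \<in> \<xi> ` E"
proof -
  obtain x y where w: "x \<in> D" "y \<in> E" "w = prod_chart m D \<phi> E \<xi> (x, y)" using assms by auto
  then show "inv_into (D \<times> E) (prod_chart m D \<phi> E \<xi>) w =
      (inv_into D \<phi> (block1 m w), inv_into E \<xi> (block2 m w))"
    "block1 m w \<in> \<phi> ` D" "block2 m w \<in> \<xi> ` E"
    using is_chartD(3)[OF D] is_chartD(3)[OF E] inj_prod_chart
    by (simp_all add: block1_prod_chart block2_prod_chart)
qed

lemma is_chart_prod: "is_chart (m + n) (X \<times> Y) (D \<times> E, prod_chart m D \<phi> E \<xi>)"
  using is_chartD[OF D] is_chartD[OF E] inj_prod_chart openin_cat_image[of m "\<phi> ` D" n "\<xi> ` E"]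
  unfolding is_chart_def by (auto simp: prod_chart_image) (auto simp: prod_chart_def)

end

text \<open>A transition map between product charts acts on the two blocks separately.\<close>

lemma prod_transition:
  assumes D: "is_chart m X (D, \<phi>)" and E: "is_chart n Y (E, \<xi>)"
    and cD: "compatible m (D, \<phi>) (D', \<phi>')" and cE: "compatible n (E, \<xi>) (E', \<xi>')"
  defines "R \<equiv> prod_chart m D \<phi> E \<xi> ` (D \<times> E \<inter> D' \<times> E')"
  shows "openin (Euclidean_space (m + n)) R"
    "smooth_cart (m + n) R (m + n) (prod_chart m D' \<phi>' E' \<xi>' \<circ> inv_into (D \<times> E) (prod_chart m D \<phi> E \<xi>))"
proof -
  have R: "R = {cat m a b |a b. a \<in> \<phi> ` (D \<inter> D') \<and> b \<in> \<xi> ` (E \<inter> E')}"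
    unfolding R_def Times_Int_Times by (rule prod_chart_image) auto
  show oR: "openin (Euclidean_space (m + n)) R"
    unfolding R by (rule openin_cat_image[OF compatibleD(1)[OF cD] compatibleD(1)[OF cE]])
  have bl: "block1 m w \<in> \<phi> ` (D \<inter> D')" "block2 m w \<in> \<xi> ` (E \<inter> E')" if "w \<in> R" for w
    using that openin_subset[OF compatibleD(1)[OF cD]] openin_subset[OF compatibleD(1)[OF cE]]
    unfolding R by (auto simp: block1_cat block2_cat subset_iff)
  have "smooth_cart (m + n) R m (\<lambda>w. (\<phi>' \<circ> inv_into D \<phi>) (block1 m w))"
    by (rule smooth_cart_compose[OF oR compatibleD(1)[OF cD] smooth_cart_block1[OF oR] compatibleD(3)[OF cD]])
      (use bl in blast)
  moreover have "smooth_cart (m + n) R n (\<lambda>w. (\<xi>' \<circ> inv_into E \<xi>) (block2 m w))"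
    by (rule smooth_cart_compose[OF oR compatibleD(1)[OF cE] smooth_cart_block2[OF oR] compatibleD(3)[OF cE]])
      (use bl in blast)
  ultimately have sm: "smooth_cart (m + n) R (m + n)
      (\<lambda>w. cat m ((\<phi>' \<circ> inv_into D \<phi>) (block1 m w)) ((\<xi>' \<circ> inv_into E \<xi>) (block2 m w)))"
    by (rule smooth_cart_cat)
  show "smooth_cart (m + n) R (m + n)
      (prod_chart m D' \<phi>' E' \<xi>' \<circ> inv_into (D \<times> E) (prod_chart m D \<phi> E \<xi>))"
  proof (rule smooth_cart_cong[OF oR _ sm])
    fix w assume w: "w \<in> R"
    then have w': "w \<in> prod_chart m D \<phi> E \<xi> ` (D \<times> E)" unfolding R_def by blast
    have "inv_into D \<phi> (block1 m w) \<in> D'" "inv_into E \<xi> (block2 m w) \<in> E'"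
      using bl[OF w] is_chartD(3)[OF D] is_chartD(3)[OF E] by auto
    then show "cat m ((\<phi>' \<circ> inv_into D \<phi>) (block1 m w)) ((\<xi>' \<circ> inv_into E \<xi>) (block2 m w)) =
        (prod_chart m D' \<phi>' E' \<xi>' \<circ> inv_into (D \<times> E) (prod_chart m D \<phi> E \<xi>)) w"
      by (simp add: inv_prod_chart_block(1)[OF D E w'] prod_chart_apply)
  qed
qed

lemma compatible_prod:
  assumes "is_chart m X (D, \<phi>)" "is_chart n Y (E, \<xi>)" "is_chart m X (D', \<phi>')" "is_chart n Y (E', \<xi>')"
    and cD: "compatible m (D, \<phi>) (D', \<phi>')" and cE: "compatible n (E, \<xi>) (E', \<xi>')"
  shows "compatible (m + n) (D \<times> E, prod_chart m D \<phi> E \<xi>) (D' \<times> E', prod_chart m D' \<phi>' E' \<xi>')"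
  using prod_transition[OF assms(1,2) cD cE]
    prod_transition[OF assms(3,4) compatible_sym[OF cD] compatible_sym[OF cE]]
  by (simp add: compatible_def Int_commute)

lemma prod_mfd_simps [simp]:
  "points (prod_mfd M N) = points M \<times> points N" "mdim (prod_mfd M N) = mdim M + mdim N"
  by (simp_all add: prod_mfd_def)

lemma atlas_prod_mfd:
  "atlas (prod_mfd M N) = maximal_atlas (mdim M + mdim N) (points M \<times> points N)
     {(D \<times> E, prod_chart (mdim M) D \<phi> E \<xi>) |D \<phi> E \<xi>. (D, \<phi>) \<in> atlas M \<and> (E, \<xi>) \<in> atlas N}"
  by (simp add: prod_mfd_def prod_chart_def)

lemma maximal_prod_mfd:
  assumes "maximal_mfd M" "maximal_mfd N"
  shows "maximal_mfd (prod_mfd M N)"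
  unfolding maximal_mfd_def
proof (intro exI conjI)
  show "atlas (prod_mfd M N) = maximal_atlas (mdim (prod_mfd M N)) (points (prod_mfd M N))
     {(D \<times> E, prod_chart (mdim M) D \<phi> E \<xi>) |D \<phi> E \<xi>. (D, \<phi>) \<in> atlas M \<and> (E, \<xi>) \<in> atlas N}"
    by (simp add: atlas_prod_mfd)
qed (auto intro!: is_chart_prod maximal_mfd_is_chart assms)

text \<open>Members of the product atlas are compatible with the generating product charts by
  definition; it remains to see that this generator belongs to the atlas itself.\<close>

lemma prod_ref_chart:
  assumes M: "maximal_mfd M" and N: "maximal_mfd N" and D: "ref_chart M D \<phi>" and E: "ref_chart N E \<xi>"
  shows "ref_chart (prod_mfd M N) (D \<times> E) (prod_chart (mdim M) D \<phi> E \<xi>)"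
proof -
  have D': "(D, \<phi>) \<in> atlas M" and E': "(E, \<xi>) \<in> atlas N" using D E by (auto simp: ref_chart_def)
  note cD = maximal_mfd_is_chart[OF M D'] and cE = maximal_mfd_is_chart[OF N E']
  have "compatible (mdim M + mdim N) (D \<times> E, prod_chart (mdim M) D \<phi> E \<xi>)
      (D' \<times> E', prod_chart (mdim M) D' \<phi>' E' \<xi>')" if "(D', \<phi>') \<in> atlas M" "(E', \<xi>') \<in> atlas N" for D' \<phi>' E' \<xi>'
    using that D E
    by (intro compatible_prod[OF cD cE maximal_mfd_is_chart[OF M] maximal_mfd_is_chart[OF N]] compatible_sym[of _ "(D', \<phi>')"] compatible_sym[of _ "(E', \<xi>')"])
      (auto simp: ref_chart_def)
  then have "(D \<times> E, prod_chart (mdim M) D \<phi> E \<xi>) \<in> atlas (prod_mfd M N)"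
    unfolding atlas_prod_mfd maximal_atlas_def using is_chart_prod[OF cD cE] by auto
  moreover have "compatible (mdim M + mdim N) c (D \<times> E, prod_chart (mdim M) D \<phi> E \<xi>)"
    if "c \<in> atlas (prod_mfd M N)" for c
    using that D' E' unfolding atlas_prod_mfd maximal_atlas_def by blast
  ultimately show ?thesis by (simp add: ref_chart_def)
qed


section \<open>Smooth families of maps\<close>

lemma smooth_in_charts_snd:
  assumes D: "is_chart m X (D, \<phi>)" and E: "is_chart n Y (E, \<xi>)" and p: "p \<in> D \<times> E"
  shows "smooth_in_charts (m + n) (D \<times> E) (prod_chart m D \<phi> E \<xi>) n E \<xi> snd p"
proof (rule smooth_in_chartsI[where h = "block2 m"])
  show o: "openin (Euclidean_space (m + n)) (prod_chart m D \<phi> E \<xi> ` (D \<times> E))"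
    by (rule is_chartD(4)[OF is_chart_prod[OF D E]])
  show "smooth_cart (m + n) (prod_chart m D \<phi> E \<xi> ` (D \<times> E)) n (block2 m)"
    by (rule smooth_cart_block2[OF o])
  fix z assume z: "z \<in> prod_chart m D \<phi> E \<xi> ` (D \<times> E)"
  show "snd (inv_into (D \<times> E) (prod_chart m D \<phi> E \<xi>) z) \<in> E"
    "block2 m z = \<xi> (snd (inv_into (D \<times> E) (prod_chart m D \<phi> E \<xi>) z))"
    using inv_prod_chart_block[OF D E z] by (auto simp: f_inv_into_f inv_into_into)
qed (use p in auto)

text \<open>Freezing the parameter; used to pass from a smooth family to its members.\<close>

lemma smooth_in_charts_slice:
  assumes D: "is_chart m X (D, \<phi>)" and E: "is_chart n Y (E, \<xi>)" and "r \<in> D" "x \<in> E"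
  shows "smooth_in_charts n E \<xi> (m + n) (D \<times> E) (prod_chart m D \<phi> E \<xi>) (\<lambda>x. (r, x)) x"
proof (rule smooth_in_chartsI[where h = "\<lambda>z. cat m (\<phi> r) z"])
  show o: "openin (Euclidean_space n) (\<xi> ` E)" by (rule is_chartD(4)[OF E])
  have "\<phi> r \<in> cart m" using openin_subset[OF is_chartD(4)[OF D]] assms(3) by blast
  then have "smooth_cart n (\<xi> ` E) m (\<lambda>z. \<phi> r)"
    by (auto simp: smooth_cart_def smooth_fun_const o)
  then show "smooth_cart n (\<xi> ` E) (m + n) (\<lambda>z. cat m (\<phi> r) z)"
    by (intro smooth_cart_cat smooth_cart_ident o)
  fix z assume z: "z \<in> \<xi> ` E"
  then show "(r, inv_into E \<xi> z) \<in> D \<times> E"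
    "cat m (\<phi> r) z = prod_chart m D \<phi> E \<xi> (r, inv_into E \<xi> z)"
    using assms(3) by (auto simp: f_inv_into_f inv_into_into prod_chart_apply)
qed (use assms in auto)

text \<open>The reparametrization \<open>\<sigma>\<close> is built in so that composition of
  families also covers rescaled paths.\<close>

lemma smooth_in_charts_pair:
  assumes S: "openin (Euclidean_space m) S" and E: "is_chart n Y (E, \<xi>)"
    and s: "smooth_cart m S m \<sigma>" "\<sigma> ` S \<subseteq> S" and G: "is_chart n Y (G, \<zeta>)"
    and k: "smooth_in_charts (m + n) (S \<times> E) (prod_chart m S (\<lambda>x\<in>S. x) E \<xi>) n G \<zeta> k p"
  shows "smooth_in_charts (m + n) (S \<times> E) (prod_chart m S (\<lambda>x\<in>S. x) E \<xi>)
      (m + n) (S \<times> G) (prod_chart m S (\<lambda>x\<in>S. x) G \<zeta>) (\<lambda>p. (\<sigma> (fst p), k p)) p"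
proof -
  let ?D = "prod_chart m S (\<lambda>x\<in>S. x) E \<xi>"
  note iS = is_chart_id[OF S]
  obtain N where N: "openin (Euclidean_space (m + n)) N" "?D p \<in> N" "N \<subseteq> ?D ` (S \<times> E)"
     "\<forall>z\<in>N. k (inv_into (S \<times> E) ?D z) \<in> G" "smooth_cart (m + n) N n (\<lambda>z. \<zeta> (k (inv_into (S \<times> E) ?D z)))"
     and p: "p \<in> S \<times> E"
    using k unfolding smooth_in_charts_def by (elim conjE exE)
  have inv: "fst (inv_into (S \<times> E) ?D z) = block1 m z" "block1 m z \<in> S" if "z \<in> N" for z
    using inv_prod_chart_block[OF iS E subsetD[OF N(3) that]] by (auto simp: inv_into_restrict_id)
  show ?thesis
  proof (rule smooth_in_chartsI[where h = "\<lambda>z. cat m (\<sigma> (block1 m z)) (\<zeta> (k (inv_into (S \<times> E) ?D z)))", OF N(1) p N(2,3)])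
    have "smooth_cart (m + n) N m (\<lambda>z. \<sigma> (block1 m z))"
      by (rule smooth_cart_compose[OF N(1) S smooth_cart_block1[OF N(1)] s(1)]) (use inv in auto)
    then show "smooth_cart (m + n) N (m + n) (\<lambda>z. cat m (\<sigma> (block1 m z)) (\<zeta> (k (inv_into (S \<times> E) ?D z))))"
      by (rule smooth_cart_cat[OF _ N(5)])
    fix z assume z: "z \<in> N"
    then show "(\<sigma> (fst (inv_into (S \<times> E) ?D z)), k (inv_into (S \<times> E) ?D z)) \<in> S \<times> G"
      "cat m (\<sigma> (block1 m z)) (\<zeta> (k (inv_into (S \<times> E) ?D z))) =
       prod_chart m S (\<lambda>x\<in>S. x) G \<zeta> (\<sigma> (fst (inv_into (S \<times> E) ?D z)), k (inv_into (S \<times> E) ?D z))"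
      using inv N(4) s(2) by (auto simp: prod_chart_apply image_subset_iff)
  qed
qed

text \<open>Smoothness at a point depends only on the germ of the map there.\<close>

lemma smooth_in_charts_cong:
  assumes f: "smooth_in_charts m D \<phi> n E \<xi> f x" and iD: "inj_on \<phi> D"
    and Q: "openin (Euclidean_space m) Q" "\<phi> x \<in> Q"
    and eq: "\<And>y. y \<in> D \<Longrightarrow> \<phi> y \<in> Q \<Longrightarrow> f y = g y"
  shows "smooth_in_charts m D \<phi> n E \<xi> g x"
proof -
  obtain N where N: "openin (Euclidean_space m) N" "\<phi> x \<in> N" "N \<subseteq> \<phi> ` D"
     "\<forall>z\<in>N. f (inv_into D \<phi> z) \<in> E" "smooth_cart m N n (\<lambda>z. \<xi> (f (inv_into D \<phi> z)))" and x: "x \<in> D"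
    using f unfolding smooth_in_charts_def by (elim conjE exE)
  have eq': "f (inv_into D \<phi> z) = g (inv_into D \<phi> z)" if "z \<in> N \<inter> Q" for z
    using that N(3) by (intro eq) (auto simp: f_inv_into_f inv_into_into subset_iff)
  show ?thesis
  proof (rule smooth_in_chartsI[where N = "N \<inter> Q" and h = "\<lambda>z. \<xi> (f (inv_into D \<phi> z))"])
    show "smooth_cart m (N \<inter> Q) n (\<lambda>z. \<xi> (f (inv_into D \<phi> z)))"
      by (rule smooth_cart_mono[OF N(5)]) blast
    show "g (inv_into D \<phi> z) \<in> E" if "z \<in> N \<inter> Q" for z
      using eq'[OF that] N(4) that by auto
  qed (use N Q x eq' in auto)
qed

text \<open>A plot of \<open>functional_diffeology\<close> is a family of diffeomorphisms that is
  smooth in this sense together with the family of its inverses.\<close>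

definition smooth_family :: "nat \<Rightarrow> (nat \<Rightarrow> real) set \<Rightarrow> 'a mfd \<Rightarrow> ((nat \<Rightarrow> real) \<Rightarrow> 'a \<Rightarrow> 'a) \<Rightarrow> bool" where
  "smooth_family m S M h \<longleftrightarrow> smooth_map (prod_mfd (cart_mfd m S) M) M (\<lambda>(r, x). h r x)"

context
  fixes m :: nat and S :: "(nat \<Rightarrow> real) set" and M :: "'a mfd"
  assumes S: "openin (Euclidean_space m) S" and M: "manifold M"
begin

abbreviation (input) pc :: "'a set \<Rightarrow> ('a \<Rightarrow> nat \<Rightarrow> real) \<Rightarrow> (nat \<Rightarrow> real) \<times> 'a \<Rightarrow> nat \<Rightarrow> real" where
  "pc E \<xi> \<equiv> prod_chart m S (\<lambda>x\<in>S. x) E \<xi>"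

lemma maximal_SM: "maximal_mfd (prod_mfd (cart_mfd m S) M)"
  by (intro maximal_prod_mfd maximal_cart_mfd S manifold_maximal M)

lemma atlas_is_chart: "(E, \<xi>) \<in> atlas M \<Longrightarrow> is_chart (mdim M) (points M) (E, \<xi>)"
  by (rule maximal_mfd_is_chart[OF manifold_maximal[OF M]])

lemma pc_ref: "(E, \<xi>) \<in> atlas M \<Longrightarrow> ref_chart (prod_mfd (cart_mfd m S) M) (S \<times> E) (pc E \<xi>)"
  using prod_ref_chart[OF maximal_cart_mfd[OF S] manifold_maximal[OF M] cart_mfd_ref_chart[OF S]]
  by (simp add: manifold_ref_chart[OF M])

lemma pc_inj: "(E, \<xi>) \<in> atlas M \<Longrightarrow> inj_on (pc E \<xi>) (S \<times> E)"
  by (rule ref_chart_inj[OF maximal_SM pc_ref])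

lemma smooth_family_in_charts:
  assumes "smooth_family m S M h" "r \<in> S" "x \<in> E" "h r x \<in> G" "(E, \<xi>) \<in> atlas M" "(G, \<zeta>) \<in> atlas M"
  shows "smooth_in_charts (m + mdim M) (S \<times> E) (pc E \<xi>) (mdim M) G \<zeta> (\<lambda>(r, x). h r x) (r, x)"
  using smooth_map_in_charts[OF maximal_SM manifold_maximal[OF M] _ _ pc_ref, of "\<lambda>(r, x). h r x" "(r, x)" E \<xi> G \<zeta>]
    assms by (simp add: smooth_family_def manifold_ref_chart[OF M])

lemma smooth_familyI:
  assumes "\<And>r x. r \<in> S \<Longrightarrow> x \<in> points M \<Longrightarrow> h r x \<in> points M"
    and "\<And>r x. r \<in> S \<Longrightarrow> x \<in> points M \<Longrightarrow> \<exists>E \<xi> G \<zeta>. (E, \<xi>) \<in> atlas M \<and> (G, \<zeta>) \<in> atlas M \<and>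
        smooth_in_charts (m + mdim M) (S \<times> E) (pc E \<xi>) (mdim M) G \<zeta> (\<lambda>(r, x). h r x) (r, x)"
  shows "smooth_family m S M h"
  unfolding smooth_family_def
proof (rule smooth_mapI[OF maximal_SM])
  show "(\<lambda>(r, x). h r x) ` points (prod_mfd (cart_mfd m S) M) \<subseteq> points M" using assms(1) by auto
  fix p assume "p \<in> points (prod_mfd (cart_mfd m S) M)"
  then obtain r x where p: "p = (r, x)" "r \<in> S" "x \<in> points M" by auto
  then obtain E \<xi> G \<zeta> where *: "(E, \<xi>) \<in> atlas M" "(G, \<zeta>) \<in> atlas M"
        "smooth_in_charts (m + mdim M) (S \<times> E) (pc E \<xi>) (mdim M) G \<zeta> (\<lambda>(r, x). h r x) (r, x)"
    using assms(2) by blast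
  have "(S \<times> E, pc E \<xi>) \<in> atlas (prod_mfd (cart_mfd m S) M)"
    using pc_ref[OF *(1)] by (simp add: ref_chart_def)
  then show "\<exists>D \<phi> E \<xi>. (D, \<phi>) \<in> atlas (prod_mfd (cart_mfd m S) M) \<and> (E, \<xi>) \<in> atlas M \<and>
      smooth_in_charts (mdim (prod_mfd (cart_mfd m S) M)) D \<phi> (mdim M) E \<xi> (\<lambda>(r, x). h r x) p"
    using * unfolding p(1) by auto
qed

lemma smooth_family_points:
  "smooth_family m S M h \<Longrightarrow> r \<in> S \<Longrightarrow> x \<in> points M \<Longrightarrow> h r x \<in> points M"
  by (auto simp: smooth_family_def smooth_map_def)

lemma smooth_family_ident: "smooth_family m S M (\<lambda>r x. x)"
proof (rule smooth_familyI)
  fix r x assume r: "r \<in> S" and x: "x \<in> points M"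
  obtain E \<xi> where E: "(E, \<xi>) \<in> atlas M" "x \<in> E" by (rule manifold_chart_at[OF M x])
  have "snd = (\<lambda>(r :: nat \<Rightarrow> real, x :: 'a). x)" by auto
  moreover have "smooth_in_charts (m + mdim M) (S \<times> E) (pc E \<xi>) (mdim M) E \<xi> snd (r, x)"
    by (rule smooth_in_charts_snd[OF is_chart_id[OF S] atlas_is_chart[OF E(1)]]) (use r E in auto)
  ultimately have *: "smooth_in_charts (m + mdim M) (S \<times> E) (pc E \<xi>) (mdim M) E \<xi> (\<lambda>(r, x). x) (r, x)"
    by (simp only:)
  show "\<exists>E \<xi> G \<zeta>. (E, \<xi>) \<in> atlas M \<and> (G, \<zeta>) \<in> atlas M \<and>
        smooth_in_charts (m + mdim M) (S \<times> E) (pc E \<xi>) (mdim M) G \<zeta> (\<lambda>(r, x). x) (r, x)"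
    by (intro exI[of _ E] exI[of _ \<xi>] conjI E(1) *)
qed

text \<open>The composite factors through \<open>(r, x) \<mapsto> (\<sigma> r, k r x)\<close>, a map
  of the product into itself.\<close>

lemma smooth_family_compose:
  assumes h: "smooth_family m S M h" and k: "smooth_family m S M k"
    and s: "smooth_cart m S m \<sigma>" "\<sigma> ` S \<subseteq> S"
  shows "smooth_family m S M (\<lambda>r x. h (\<sigma> r) (k r x))"
proof (rule smooth_familyI)
  fix r x assume r: "r \<in> S" and x: "x \<in> points M"
  then have sr: "\<sigma> r \<in> S" using s by blast
  have kx: "k r x \<in> points M" by (rule smooth_family_points[OF k r x])
  then show hk: "h (\<sigma> r) (k r x) \<in> points M" using smooth_family_points[OF h] sr by blast
  obtain E \<xi> where E: "(E, \<xi>) \<in> atlas M" "x \<in> E" by (rule manifold_chart_at[OF M x])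
  obtain D \<phi> where D: "(D, \<phi>) \<in> atlas M" "k r x \<in> D" by (rule manifold_chart_at[OF M kx])
  obtain G \<zeta> where G: "(G, \<zeta>) \<in> atlas M" "h (\<sigma> r) (k r x) \<in> G" by (rule manifold_chart_at[OF M hk])
  let ?k = "\<lambda>p. (\<sigma> (fst p), (\<lambda>(r, x). k r x) p)"
  have "smooth_in_charts (m + mdim M) (S \<times> E) (pc E \<xi>) (m + mdim M) (S \<times> D) (pc D \<phi>) ?k (r, x)"
    by (rule smooth_in_charts_pair[OF S atlas_is_chart[OF E(1)] s atlas_is_chart[OF D(1)]
          smooth_family_in_charts[OF k r E(2) D(2) E(1) D(1)]])
  moreover have "smooth_in_charts (m + mdim M) (S \<times> D) (pc D \<phi>) (mdim M) G \<zeta> (\<lambda>(r, x). h r x) (?k (r, x))"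
    using smooth_family_in_charts[OF h sr D(2) G(2) D(1) G(1)] by simp
  ultimately have "smooth_in_charts (m + mdim M) (S \<times> E) (pc E \<xi>) (mdim M) G \<zeta> (\<lambda>p. (\<lambda>(r, x). h r x) (?k p)) (r, x)"
    by (rule smooth_in_charts_compose[OF _ _ pc_inj[OF E(1)] pc_inj[OF D(1)]])
  moreover have "(\<lambda>p. (\<lambda>(r, x). h r x) (?k p)) = (\<lambda>(r, x). h (\<sigma> r) (k r x))" by auto
  ultimately have *: "smooth_in_charts (m + mdim M) (S \<times> E) (pc E \<xi>) (mdim M) G \<zeta>
      (\<lambda>(r, x). h (\<sigma> r) (k r x)) (r, x)"
    by (simp only:)
  show "\<exists>E \<xi> G \<zeta>. (E, \<xi>) \<in> atlas M \<and> (G, \<zeta>) \<in> atlas M \<and>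
        smooth_in_charts (m + mdim M) (S \<times> E) (pc E \<xi>) (mdim M) G \<zeta> (\<lambda>(r, x). h (\<sigma> r) (k r x)) (r, x)"
    by (intro exI[of _ E] exI[of _ \<xi>] exI[of _ G] exI[of _ \<zeta>] conjI E(1) G(1) *)
qed

lemma smooth_family_slice:
  assumes h: "smooth_family m S M h" and r: "r \<in> S"
  shows "smooth_map M M (h r)"
proof (rule smooth_mapI[OF manifold_maximal[OF M]])
  show "h r ` points M \<subseteq> points M" using smooth_family_points[OF h r] by blast
  fix x assume x: "x \<in> points M"
  obtain E \<xi> where E: "(E, \<xi>) \<in> atlas M" "x \<in> E" by (rule manifold_chart_at[OF M x])
  obtain G \<zeta> where G: "(G, \<zeta>) \<in> atlas M" "h r x \<in> G"
    by (rule manifold_chart_at[OF M smooth_family_points[OF h r x]])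
  have "smooth_in_charts (mdim M) E \<xi> (m + mdim M) (S \<times> E) (pc E \<xi>) (\<lambda>x. (r, x)) x"
    by (rule smooth_in_charts_slice[OF is_chart_id[OF S] atlas_is_chart[OF E(1)] r E(2)])
  from smooth_in_charts_compose[OF this smooth_family_in_charts[OF h r E(2) G(2) E(1) G(1)]
      is_chartD(3)[OF atlas_is_chart[OF E(1)]] pc_inj[OF E(1)]]
  show "\<exists>D \<phi> E \<xi>. (D, \<phi>) \<in> atlas M \<and> (E, \<xi>) \<in> atlas M \<and>
      smooth_in_charts (mdim M) D \<phi> (mdim M) E \<xi> (h r) x"
    using E(1) G(1) by auto
qed

end


section \<open>The group of leaf-preserving diffeomorphisms\<close>

lemma manifold_smooth_atlas: "manifold M \<Longrightarrow> smooth_atlas (mdim M) (points M) (atlas M)"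
  by (simp add: manifold_def)

section \<open>Extension of maps by the identity\<close>

lemma continuous_map_chart_inverse:
  assumes M: "manifold M" and V: "(V, \<psi>) \<in> atlas M"
  shows "continuous_map (subtopology (Euclidean_space (mdim M)) (\<psi> ` V)) (mfd_topology M) (inv_into V \<psi>)"
proof -
  note sa = manifold_smooth_atlas[OF M]
  note c = is_chartD[OF maximal_mfd_is_chart[OF manifold_maximal[OF M] V]]
  have sub: "\<psi> ` V \<subseteq> cart (mdim M)" using openin_subset[OF c(4)] .
  show ?thesis
    unfolding continuous_map_def
  proof (intro conjI allI impI)
    show "inv_into V \<psi> \<in> topspace (subtopology (Euclidean_space (mdim M)) (\<psi> ` V)) \<rightarrow> topspace (mfd_topology M)"
      using c(1,3) by (auto simp: topspace_mfd_topology[OF sa])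
    fix U assume "openin (mfd_topology M) U"
    then have "openin (Euclidean_space (mdim M)) (\<psi> ` (U \<inter> V))"
      using V by (auto simp: openin_mfd_topology[OF sa])
    moreover have "{z \<in> topspace (subtopology (Euclidean_space (mdim M)) (\<psi> ` V)). inv_into V \<psi> z \<in> U} = \<psi> ` (U \<inter> V)"
      using sub c(3) by auto
    ultimately show "openin (subtopology (Euclidean_space (mdim M)) (\<psi> ` V))
        {z \<in> topspace (subtopology (Euclidean_space (mdim M)) (\<psi> ` V)). inv_into V \<psi> z \<in> U}"
      using c(4) by (auto simp: openin_open_subtopology)
  qed
qed

text \<open>The use of the Hausdorff property: a compact set inside a chart is closed in all of
  \<open>M\<close>, so its complement and the chart domain form an open cover.\<close>

lemma closedin_chart_inverse_compact:
  assumes M: "manifold M" and V: "(V, \<psi>) \<in> atlas M"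
    and K: "compactin (Euclidean_space (mdim M)) K" "K \<subseteq> \<psi> ` V"
  shows "closedin (mfd_topology M) (inv_into V \<psi> ` K)"
proof (rule compactin_imp_closedin)
  show "Hausdorff_space (mfd_topology M)" using M by (simp add: manifold_def)
  show "compactin (mfd_topology M) (inv_into V \<psi> ` K)"
    by (rule image_compactin[OF _ continuous_map_chart_inverse[OF M V]]) (simp add: compactin_subtopology K)
qed

text \<open>Not all of \<open>\<real>\<close>: the maps of \<^const>\<open>local_flow\<close> are invertible for small times only.\<close>

definition time_interval :: "(nat \<Rightarrow> real) set" where
  "time_interval = {r \<in> cart 1. \<bar>r 0\<bar> < 2}"

lemma openin_time_interval: "openin (Euclidean_space 1) time_interval"
proof -
  have "time_interval = {r \<in> cart 1. r 0 \<in> {-2<..<2}}" by (auto simp: time_interval_def)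
  then show ?thesis using openin_real_coord[of "{-2<..<2}" 1 0] by simp
qed

definition extend_by_id :: "'a set \<Rightarrow> ('a \<Rightarrow> nat \<Rightarrow> real) \<Rightarrow> ((nat \<Rightarrow> real) \<Rightarrow> nat \<Rightarrow> real) \<Rightarrow> 'a \<Rightarrow> 'a" where
  "extend_by_id V \<psi> f x = (if x \<in> V then inv_into V \<psi> (f (\<psi> x)) else x)"

text \<open>On \<open>V\<close> the family is \<open>f\<close> read in the chart; on the open
  complement of the compact set it is the identity, also at those points of the complement that lie
  in \<open>V\<close>.\<close>

lemma smooth_family_extend_by_id:
  assumes M: "manifold M" and V: "(V, \<psi>) \<in> atlas M"
    and K: "compactin (Euclidean_space (mdim M)) K" "K \<subseteq> \<psi> ` V"
    and sm: "smooth_cart (Suc (mdim M)) {w \<in> cart (Suc (mdim M)). \<bar>w 0\<bar> < 2} (mdim M) (\<lambda>w. f (w 0) (\<lambda>i. w (Suc i)))"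
    and fO: "\<And>t x. \<bar>t\<bar> < 2 \<Longrightarrow> x \<in> \<psi> ` V \<Longrightarrow> f t x \<in> \<psi> ` V"
    and fK: "\<And>t x. \<bar>t\<bar> < 2 \<Longrightarrow> x \<in> \<psi> ` V \<Longrightarrow> x \<notin> K \<Longrightarrow> f t x = x"
  shows "smooth_family 1 time_interval M (\<lambda>r. extend_by_id V \<psi> (f (r 0)))"
proof (rule smooth_familyI[OF openin_time_interval M])
  let ?J = time_interval
  note iJ = is_chart_id[OF openin_time_interval] and ch = maximal_mfd_is_chart[OF manifold_maximal[OF M]]
  note cV = is_chartD[OF ch[OF V]]
  fix r x assume r: "r \<in> ?J" and x: "x \<in> points M"
  have r2: "\<bar>r 0\<bar> < 2" using r by (simp add: time_interval_def)
  have "inv_into V \<psi> (f (r 0) (\<psi> x)) \<in> V" if "x \<in> V"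
    by (rule inv_into_into[OF fO[OF r2]]) (use that in blast)
  then show "extend_by_id V \<psi> (f (r 0)) x \<in> points M"
    using x cV(1) by (auto simp: extend_by_id_def)
  show "\<exists>E \<xi> G \<zeta>. (E, \<xi>) \<in> atlas M \<and> (G, \<zeta>) \<in> atlas M \<and>
        smooth_in_charts (1 + mdim M) (?J \<times> E) (prod_chart 1 ?J (\<lambda>x\<in>?J. x) E \<xi>) (mdim M) G \<zeta>
          (\<lambda>(r, x). extend_by_id V \<psi> (f (r 0)) x) (r, x)"
  proof (cases "x \<in> V")
    case True
    let ?p = "prod_chart 1 ?J (\<lambda>x\<in>?J. x) V \<psi>"
    have "smooth_in_charts (1 + mdim M) (?J \<times> V) ?p (mdim M) V \<psi>
          (\<lambda>(r, x). extend_by_id V \<psi> (f (r 0)) x) (r, x)"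
    proof (rule smooth_in_chartsI[where N = "?p ` (?J \<times> V)" and h = "\<lambda>w. f (w 0) (\<lambda>i. w (Suc i))"])
      show o: "openin (Euclidean_space (1 + mdim M)) (?p ` (?J \<times> V))"
        by (rule is_chartD(4)[OF is_chart_prod[OF iJ ch[OF V]]])
      \<comment> \<open>\<open>prod_chart 1\<close> puts the time in coordinate 0 and the chart
        coordinates behind it, which is the layout of \<open>local_flow\<close>.\<close>
      have w: "\<bar>w 0\<bar> < 2" "(\<lambda>i. w (Suc i)) \<in> \<psi> ` V"
        "inv_into (?J \<times> V) ?p w = (block1 1 w, inv_into V \<psi> (\<lambda>i. w (Suc i)))" "block1 1 w 0 = w 0"
        if "w \<in> ?p ` (?J \<times> V)" for w
        using inv_prod_chart_block[OF iJ ch[OF V] that]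
        by (auto simp: time_interval_def block1_def block2_def inv_into_restrict_id)
      show "smooth_cart (1 + mdim M) (?p ` (?J \<times> V)) (mdim M) (\<lambda>w. f (w 0) (\<lambda>i. w (Suc i)))"
        using smooth_cart_mono[OF sm, of "?p ` (?J \<times> V)"] w(1) openin_subset[OF o] by auto
      fix z assume z: "z \<in> ?p ` (?J \<times> V)"
      have fz: "f (z 0) (\<lambda>i. z (Suc i)) \<in> \<psi> ` V" by (rule fO[OF w(1,2)[OF z]])
      have *: "(\<lambda>(r, x). extend_by_id V \<psi> (f (r 0)) x) (inv_into (?J \<times> V) ?p z) =
         inv_into V \<psi> (f (z 0) (\<lambda>i. z (Suc i)))"
        unfolding w(3)[OF z] case_prod_conv w(4)[OF z]
        using w(2)[OF z] by (simp add: extend_by_id_def inv_into_into f_inv_into_f)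
      show "(\<lambda>(r, x). extend_by_id V \<psi> (f (r 0)) x) (inv_into (?J \<times> V) ?p z) \<in> V"
        unfolding * by (rule inv_into_into[OF fz])
      show "f (z 0) (\<lambda>i. z (Suc i)) =
          \<psi> ((\<lambda>(r, x). extend_by_id V \<psi> (f (r 0)) x) (inv_into (?J \<times> V) ?p z))"
        unfolding * by (rule f_inv_into_f[OF fz, symmetric])
    qed (use r True in auto)
    then show ?thesis using V by blast
  next
    case False
    define C where "C = inv_into V \<psi> ` K"
    have "openin (mfd_topology M) (points M - C)"
      using closedin_chart_inverse_compact[OF M V K]
        openin_diff[OF openin_topspace, of "mfd_topology M" C]
      by (simp add: C_def topspace_mfd_topology[OF manifold_smooth_atlas[OF M]])
    then have oE: "openin (Euclidean_space (mdim M)) (\<xi> ` ((points M - C) \<inter> E))" if "(E, \<xi>) \<in> atlas M" for E \<xi>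
      using that by (auto simp: openin_mfd_topology[OF manifold_smooth_atlas[OF M]])
    have C: "C \<subseteq> V" unfolding C_def using K(2) by (auto intro: inv_into_into)
    obtain E \<xi> where E: "(E, \<xi>) \<in> atlas M" "x \<in> E" by (rule manifold_chart_at[OF M x])
    let ?p = "prod_chart 1 ?J (\<lambda>x\<in>?J. x) E \<xi>"
    \<comment> \<open>The coordinates of pairs whose point avoids \<open>C\<close>; there the family
      agrees with the second projection.\<close>
    define Q where "Q = {w \<in> cart (1 + mdim M). block2 1 w \<in> \<xi> ` ((points M - C) \<inter> E)}"
    have "smooth_in_charts (1 + mdim M) (?J \<times> E) ?p (mdim M) E \<xi>
          (\<lambda>(r, x). extend_by_id V \<psi> (f (r 0)) x) (r, x)"
    proof (rule smooth_in_charts_cong[OF smooth_in_charts_snd[OF iJ ch[OF E(1)]] inj_prod_chart[OF iJ ch[OF E(1)]]])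
      show "openin (Euclidean_space (1 + mdim M)) Q"
        unfolding Q_def
        by (rule openin_smooth_cart_preimage[OF openin_topspace smooth_cart_block2[OF openin_topspace] oE[OF E(1)]])
      have "?p (r, x) \<in> cart (1 + mdim M)"
        using openin_subset[OF is_chartD(4)[OF is_chart_prod[OF iJ ch[OF E(1)]]]] r E(2) by blast
      then show "?p (r, x) \<in> Q"
        using block2_prod_chart[OF iJ ch[OF E(1)] r E(2)] x False C E(2) by (auto simp: Q_def)
      fix y assume y: "y \<in> ?J \<times> E" "?p y \<in> Q"
      obtain r' x' where y': "y = (r', x')" "r' \<in> ?J" "x' \<in> E" using y(1) by auto
      have "\<xi> x' \<in> \<xi> ` ((points M - C) \<inter> E)"
        using y(2) block2_prod_chart[OF iJ ch[OF E(1)] y'(2,3)] by (simp add: Q_def y')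
      then have xC: "x' \<notin> C" using is_chartD(3)[OF ch[OF E(1)]] y'(3) by (auto dest: inj_onD)
      have r': "\<bar>r' 0\<bar> < 2" using y'(2) by (simp add: time_interval_def)
      have "extend_by_id V \<psi> (f (r' 0)) x' = x'"
      proof (cases "x' \<in> V")
        case True
        then have "\<psi> x' \<notin> K" using xC cV(3) by (force simp: C_def image_iff)
        then show ?thesis using fK[OF r', of "\<psi> x'"] True cV(3) by (simp add: extend_by_id_def)
      qed (simp add: extend_by_id_def)
      then show "snd y = (\<lambda>(r, x). extend_by_id V \<psi> (f (r 0)) x) y" by (simp add: y')
    qed (use r E in auto)
    then show ?thesis using E(1) by blast
  qed
qed

text \<open>Members of \<open>Bij\<close> are extensional, while families such as
  \<open>extend_by_id\<close> are total functions; this passes between a map and its restriction to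
  the points.\<close>

lemma smooth_map_cong:
  assumes N: "maximal_mfd N" and eq: "\<And>x. x \<in> points N \<Longrightarrow> f x = g x" and f: "smooth_map N M f"
  shows "smooth_map N M g"
  unfolding smooth_map_def
proof (intro conjI ballI)
  show "g ` points N \<subseteq> points M" using f eq by (auto simp: smooth_map_def)
  fix x assume "x \<in> points N"
  then obtain c c' where c: "c \<in> atlas N" "c' \<in> atlas M" "x \<in> fst c" "f ` fst c \<subseteq> fst c'"
      "smooth_cart (mdim N) (snd c ` fst c) (mdim M) (snd c' \<circ> f \<circ> inv_into (fst c) (snd c))"
    using f unfolding smooth_map_def case_prod_unfold by blast
  have ic: "is_chart (mdim N) (points N) (fst c, snd c)" using maximal_mfd_is_chart[OF N c(1)] by simp
  have eq': "f y = g y" if "y \<in> fst c" for y using eq is_chartD(1)[OF ic] that by blast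
  have "smooth_cart (mdim N) (snd c ` fst c) (mdim M) (snd c' \<circ> g \<circ> inv_into (fst c) (snd c))"
    by (rule smooth_cart_cong[OF is_chartD(4)[OF ic] _ c(5)]) (use is_chartD(3)[OF ic] eq' in auto)
  moreover have "g ` fst c \<subseteq> fst c'" using c(4) eq' by auto
  ultimately show "\<exists>(D, \<phi>)\<in>atlas N. \<exists>(E, \<xi>)\<in>atlas M. x \<in> D \<and> g ` D \<subseteq> E \<and>
      smooth_cart (mdim N) (\<phi> ` D) (mdim M) (\<xi> \<circ> g \<circ> inv_into D \<phi>)"
    using c(1-3) unfolding case_prod_unfold by blast
qed

lemma smooth_family_cong:
  assumes "openin (Euclidean_space m) S" "manifold M" "smooth_family m S M h"
    and "\<And>r x. r \<in> S \<Longrightarrow> x \<in> points M \<Longrightarrow> h r x = k r x"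
  shows "smooth_family m S M k"
  using assms(3) unfolding smooth_family_def
  by (rule smooth_map_cong[OF maximal_SM[OF assms(1,2)], rotated]) (use assms(4) in auto)

section \<open>Paths of leaf-preserving diffeomorphisms\<close>

definition leaf_path :: "'a mfd \<Rightarrow> 'a set set \<Rightarrow> ((nat \<Rightarrow> real) \<Rightarrow> 'a \<Rightarrow> 'a) \<Rightarrow> bool" where
  "leaf_path M F P \<longleftrightarrow>
     (\<forall>r\<in>time_interval. P r \<in> Bij (points M) \<and> (\<forall>L\<in>F. P r ` L = L)) \<and>
     smooth_family 1 time_interval M P \<and>
     smooth_family 1 time_interval M (\<lambda>r. inv_into (points M) (P r)) \<and>
     P (\<lambda>_. 0) = (\<lambda>x\<in>points M. x)"

definition leaf_group :: "'a mfd \<Rightarrow> 'a set set \<Rightarrow> ('a \<Rightarrow> 'a) set" where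
  "leaf_group M F = {P r |P r. leaf_path M F P \<and> r \<in> time_interval}"

lemma zero_in_time_interval: "(\<lambda>_. 0) \<in> time_interval"
  by (simp add: time_interval_def in_cart_iff)

context
  fixes M :: "'a mfd" and F :: "'a set set"
  assumes M: "manifold M" and F: "partition_on (points M) F"
begin

lemma leaf_path_ident: "leaf_path M F (\<lambda>r. \<lambda>x\<in>points M. x)"
proof -
  have sub: "L \<subseteq> points M" if "L \<in> F" for L using F that by (auto simp: partition_on_def)
  have "inv_into (points M) (\<lambda>x\<in>points M. x) x = x" if "x \<in> points M" for x
    by (rule inv_into_f_eq) (use that in \<open>auto simp: inj_on_def\<close>)
  then have "smooth_family 1 time_interval M (\<lambda>r. inv_into (points M) (\<lambda>x\<in>points M. x))"
    by (intro smooth_family_cong[OF openin_time_interval M smooth_family_ident[OF openin_time_interval M]]) simp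
  moreover have "smooth_family 1 time_interval M (\<lambda>r. \<lambda>x\<in>points M. x)"
    by (rule smooth_family_cong[OF openin_time_interval M smooth_family_ident[OF openin_time_interval M]]) simp
  moreover have "(\<lambda>x\<in>points M. x) ` L = L" if "L \<in> F" for L using sub[OF that] by auto
  ultimately show ?thesis
    unfolding leaf_path_def using id_Bij by blast
qed

text \<open>A factor of modulus at most 1 maps the time interval into itself. Both orders of
  composition occur, since the path to be rescaled may be either factor of a product.\<close>

lemma leaf_path_compose:
  assumes P: "leaf_path M F P" and Q: "leaf_path M F Q" and s: "\<bar>s\<bar> \<le> 1"
  shows "leaf_path M F (\<lambda>r. compose (points M) (P (\<lambda>i. s * r i)) (Q r))"
    "leaf_path M F (\<lambda>r. compose (points M) (Q r) (P (\<lambda>i. s * r i)))"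
proof -
  let ?J = time_interval and ?X = "points M" and ?s = "\<lambda>r i. s * r i :: real"
  note J = openin_time_interval
  have sJ: "?s r \<in> ?J" if "r \<in> ?J" for r
  proof -
    have "\<bar>s * r 0\<bar> \<le> 1 * \<bar>r 0\<bar>" unfolding abs_mult using s by (intro mult_right_mono) auto
    then show ?thesis using that by (auto simp: time_interval_def in_cart_iff)
  qed
  have sms: "smooth_cart 1 ?J 1 ?s"
    unfolding smooth_cart_def
  proof (intro conjI allI impI smooth_fun_mult smooth_fun_const smooth_fun_coord J)
    show "?s ` ?J \<subseteq> cart 1" by (auto simp: in_cart_iff time_interval_def)
  qed
  have B: "P (?s r) \<in> Bij ?X" "Q r \<in> Bij ?X" if "r \<in> ?J" for r
    using P Q sJ[OF that] that by (auto simp: leaf_path_def)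
  have X: "f x \<in> ?X" "inv_into ?X f x \<in> ?X" "inv_into ?X f (f x) = x" "f (inv_into ?X f x) = x"
    if "f \<in> Bij ?X" "x \<in> ?X" for f x
    using that Bij_inv_into_mem[OF that] by (auto simp: Bij_def bij_betw_def f_inv_into_f)
  have inv: "inv_into ?X (compose ?X f g) x = inv_into ?X g (inv_into ?X f x)"
    if "f \<in> Bij ?X" "g \<in> Bij ?X" "x \<in> ?X" for f g x
  proof (rule inv_into_f_eq)
    show "inj_on (compose ?X f g) ?X" using compose_Bij[OF that(1,2)] by (simp add: Bij_def bij_betw_def)
  qed (use X(2)[OF that(1,3)] X(2)[OF that(2) X(2)[OF that(1,3)]] X(4)[OF that(1,3)]
      X(4)[OF that(2) X(2)[OF that(1,3)]] in \<open>simp_all add: compose_def\<close>)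
  have L: "compose ?X f g ` L = L" if "f ` L = L" "g ` L = L" "L \<in> F" for f g L
  proof -
    have "L \<subseteq> ?X" using F that(3) by (auto simp: partition_on_def)
    then have "compose ?X f g ` L = f ` (g ` L)" by (auto simp: compose_def image_iff subset_iff)
    then show ?thesis using that by simp
  qed
  have pl: "P (?s r) ` L = L" "Q r ` L = L" if "r \<in> ?J" "L \<in> F" for r L
    using P Q sJ[OF that(1)] that by (auto simp: leaf_path_def)
  have z: "P (\<lambda>_. 0) = (\<lambda>x\<in>?X. x)" "Q (\<lambda>_. 0) = (\<lambda>x\<in>?X. x)" using P Q by (auto simp: leaf_path_def)
  have sP: "smooth_family 1 ?J M P" "smooth_family 1 ?J M (\<lambda>r. inv_into ?X (P r))"
    and sQ: "smooth_family 1 ?J M Q" "smooth_family 1 ?J M (\<lambda>r. inv_into ?X (Q r))"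
    using P Q by (auto simp: leaf_path_def)
  have ss: "?s ` ?J \<subseteq> ?J" using sJ by blast
  note comp = smooth_family_compose[OF J M _ _ sms ss] and id = smooth_family_ident[OF J M]
  note comp1 = smooth_family_compose[OF J M _ _ smooth_cart_ident[OF J]]
  \<comment> \<open>Composition with the constant family of identities leaves just the change of
    parameter.\<close>
  have sPs: "smooth_family 1 ?J M (\<lambda>r. P (?s r))" "smooth_family 1 ?J M (\<lambda>r. inv_into ?X (P (?s r)))"
    using comp[OF sP(1) id] comp[OF sP(2) id] by simp_all
  have a: "smooth_family 1 ?J M (\<lambda>r. compose ?X (P (?s r)) (Q r))"
    by (rule smooth_family_cong[OF J M comp1[OF sPs(1) sQ(1)]]) (simp_all add: compose_def)
  have b: "smooth_family 1 ?J M (\<lambda>r. compose ?X (Q r) (P (?s r)))"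
    by (rule smooth_family_cong[OF J M comp1[OF sQ(1) sPs(1)]]) (simp_all add: compose_def)
  have a': "smooth_family 1 ?J M (\<lambda>r. inv_into ?X (compose ?X (P (?s r)) (Q r)))"
    by (rule smooth_family_cong[OF J M comp1[OF sQ(2) sPs(2)]]) (simp_all add: inv B)
  have b': "smooth_family 1 ?J M (\<lambda>r. inv_into ?X (compose ?X (Q r) (P (?s r))))"
    by (rule smooth_family_cong[OF J M comp1[OF sPs(2) sQ(2)]]) (simp_all add: inv B)
  have z': "compose ?X (P (?s (\<lambda>_. 0))) (Q (\<lambda>_. 0)) = (\<lambda>x\<in>?X. x)"
    "compose ?X (Q (\<lambda>_. 0)) (P (?s (\<lambda>_. 0))) = (\<lambda>x\<in>?X. x)"
    by (simp_all add: z compose_def cong: restrict_cong)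
  show "leaf_path M F (\<lambda>r. compose ?X (P (?s r)) (Q r))"
    unfolding leaf_path_def by (intro ballI conjI compose_Bij B L pl a a' z')
  show "leaf_path M F (\<lambda>r. compose ?X (Q r) (P (?s r)))"
    unfolding leaf_path_def by (intro ballI conjI compose_Bij B L pl b b' z')
qed

text \<open>The definition of a path is symmetric in the family and its inverses; the restriction
  only makes the latter extensional.\<close>

lemma leaf_path_inverse:
  assumes P: "leaf_path M F P"
  shows "leaf_path M F (\<lambda>r. \<lambda>x\<in>points M. inv_into (points M) (P r) x)"
proof -
  let ?J = time_interval and ?X = "points M"
  note J = openin_time_interval
  have B: "P r \<in> Bij ?X" if "r \<in> ?J" for r using P that by (auto simp: leaf_path_def)
  have ii: "inv_into ?X (\<lambda>x\<in>?X. inv_into ?X f x) x = f x" if "f \<in> Bij ?X" "x \<in> ?X" for f x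
  proof (rule inv_into_f_eq)
    show "inj_on (\<lambda>x\<in>?X. inv_into ?X f x) ?X"
      using restrict_inv_into_Bij[OF that(1)] by (simp add: Bij_def bij_betw_def)
  qed (use that in \<open>auto simp: Bij_def bij_betw_def\<close>)
  have L: "(\<lambda>x\<in>?X. inv_into ?X (P r) x) ` L = L" if "r \<in> ?J" "L \<in> F" for r L
  proof -
    have LX: "L \<subseteq> ?X" using F that(2) by (auto simp: partition_on_def)
    have "P r ` L = L" using P that by (auto simp: leaf_path_def)
    moreover have "inj_on (P r) ?X" using B[OF that(1)] by (simp add: Bij_def bij_betw_def)
    ultimately have "inv_into ?X (P r) ` L = L" using LX by (metis inv_into_image_cancel)
    moreover have "(\<lambda>x\<in>?X. inv_into ?X (P r) x) ` L = inv_into ?X (P r) ` L" using LX by auto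
    ultimately show ?thesis by simp
  qed
  have "inv_into ?X (\<lambda>x\<in>?X. x) x = x" if "x \<in> ?X" for x
    by (rule inv_into_f_eq) (use that in \<open>auto simp: inj_on_def\<close>)
  then have z: "(\<lambda>x\<in>?X. inv_into ?X (P (\<lambda>_. 0)) x) = (\<lambda>x\<in>?X. x)"
    using P by (auto simp: leaf_path_def)
  have "smooth_family 1 ?J M P" "smooth_family 1 ?J M (\<lambda>r. inv_into ?X (P r))"
    using P by (auto simp: leaf_path_def)
  note sm = this
  have "smooth_family 1 ?J M (\<lambda>r. \<lambda>x\<in>?X. inv_into ?X (P r) x)"
    by (rule smooth_family_cong[OF J M sm(2)]) simp
  moreover have "smooth_family 1 ?J M (\<lambda>r. inv_into ?X (\<lambda>x\<in>?X. inv_into ?X (P r) x))"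
    by (rule smooth_family_cong[OF J M sm(1)]) (simp add: ii B)
  moreover have "(\<lambda>x\<in>?X. inv_into ?X (P r) x) \<in> Bij ?X" if "r \<in> ?J" for r
    by (rule restrict_inv_into_Bij[OF B[OF that]])
  ultimately show ?thesis
    unfolding leaf_path_def using L z by (intro conjI ballI)
qed

lemma leaf_path_plot:
  assumes P: "leaf_path M F P"
  shows "(1, time_interval, P) \<in> subspace_diffeology (functional_diffeology M) (leaf_group M F)"
proof -
  have "smooth_family 1 time_interval M P" "smooth_family 1 time_interval M (\<lambda>r. inv_into (points M) (P r))"
    using P unfolding leaf_path_def by blast+
  note sm = this
  have "P r \<in> diffeos M" if "r \<in> time_interval" for r
    unfolding diffeos_def
    using P that smooth_family_slice[OF openin_time_interval M sm(1) that]
      smooth_family_slice[OF openin_time_interval M sm(2) that]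
    by (auto simp: leaf_path_def)
  then have "(1, time_interval, P) \<in> functional_diffeology M"
    unfolding functional_diffeology_def Diff_def
    using sm openin_time_interval by (simp add: smooth_family_def)
  moreover have "P ` time_interval \<subseteq> leaf_group M F"
    using P unfolding leaf_group_def by blast
  ultimately show ?thesis
    by (simp add: subspace_diffeology_def)
qed

section \<open>The members of the paths and their group operations\<close>

lemma leaf_group_diffeos: "leaf_group M F \<subseteq> diffeos M"
proof
  fix g assume "g \<in> leaf_group M F"
  then obtain P r where g: "g = P r" "leaf_path M F P" "r \<in> time_interval"
    by (auto simp: leaf_group_def)
  have "(1, time_interval, P) \<in> functional_diffeology M"
    using leaf_path_plot[OF g(2)] by (simp add: subspace_diffeology_def)
  then show "g \<in> diffeos M" using g by (simp add: functional_diffeology_def Diff_def)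
qed

lemma leaf_groupI: "leaf_path M F P \<Longrightarrow> r \<in> time_interval \<Longrightarrow> P r \<in> leaf_group M F"
  unfolding leaf_group_def by blast

lemma leaf_group_leaves: "g \<in> leaf_group M F \<Longrightarrow> L \<in> F \<Longrightarrow> g ` L = L"
  by (auto simp: leaf_group_def leaf_path_def)

lemma leaf_group_ident: "(\<lambda>x\<in>points M. x) \<in> leaf_group M F"
  using leaf_groupI[OF leaf_path_ident zero_in_time_interval] .

lemma leaf_group_inverse:
  assumes "g \<in> leaf_group M F"
  shows "(\<lambda>x\<in>points M. inv_into (points M) g x) \<in> leaf_group M F"
proof -
  obtain P r where g: "g = P r" "leaf_path M F P" "r \<in> time_interval"
    using assms by (auto simp: leaf_group_def)
  show ?thesis unfolding g(1) using leaf_groupI[OF leaf_path_inverse[OF g(2)] g(3)] .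
qed

text \<open>Of the two parameters, one is a multiple of the other by a factor of modulus at most 1, so one path
  can be rescaled to end at the same time as the other.\<close>

lemma leaf_group_compose:
  assumes "g \<in> leaf_group M F" "h \<in> leaf_group M F"
  shows "compose (points M) g h \<in> leaf_group M F"
proof -
  obtain P r Q q where g: "g = P r" "leaf_path M F P" "r \<in> time_interval"
    and h: "h = Q q" "leaf_path M F Q" "q \<in> time_interval"
    using assms by (auto simp: leaf_group_def)
  \<comment> \<open>If \<open>b 0 = 0\<close> then also \<open>a 0 = 0\<close>, and the quotient is
    0 because division by zero yields 0, so no separate case is required later.\<close>
  have scale: "\<bar>a 0 / b 0\<bar> \<le> 1" "a = (\<lambda>i. a 0 / b 0 * b i)"
    if "a \<in> time_interval" "b \<in> time_interval" "\<bar>a 0\<bar> \<le> \<bar>b 0\<bar>" for a b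
  proof -
    show "\<bar>a 0 / b 0\<bar> \<le> 1" using that(3) by (cases "b 0 = 0") (auto simp: abs_divide divide_le_eq)
    have "a i = a 0 / b 0 * b i" for i
      using that by (cases "i = 0"; cases "b 0 = 0") (auto simp: time_interval_def in_cart_iff)
    then show "a = (\<lambda>i. a 0 / b 0 * b i)" by blast
  qed
  show ?thesis
  proof (cases "\<bar>r 0\<bar> \<le> \<bar>q 0\<bar>")
    case True
    note s = scale[OF g(3) h(3) True]
    have "P r = P (\<lambda>i. r 0 / q 0 * q i)" using s(2) by (rule arg_cong)
    then have "compose (points M) g h = compose (points M) (P (\<lambda>i. r 0 / q 0 * q i)) (Q q)"
      by (simp only: g(1) h(1))
    then show ?thesis using leaf_groupI[OF leaf_path_compose(1)[OF g(2) h(2) s(1)] h(3)] by simp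
  next
    case False
    then have le: "\<bar>q 0\<bar> \<le> \<bar>r 0\<bar>" by simp
    note s = scale[OF h(3) g(3) le]
    have "Q q = Q (\<lambda>i. q 0 / r 0 * r i)" using s(2) by (rule arg_cong)
    then have "compose (points M) g h = compose (points M) (P r) (Q (\<lambda>i. q 0 / r 0 * r i))"
      by (simp only: g(1) h(1))
    then show ?thesis using leaf_groupI[OF leaf_path_compose(2)[OF h(2) g(2) s(1)] g(3)] by simp
  qed
qed

end


section \<open>D-connectedness and the subgroup property\<close>

lemma connectedin_time_interval: "connectedin (Euclidean_space 1) time_interval"
proof -
  let ?e = "\<lambda>t i. if i < 1 then t else 0 :: real"
  have "continuous_map euclideanreal (Euclidean_space 1) ?e"
    by (subst continuous_map_componentwise_Euclidean_space) auto
  then have "connectedin (Euclidean_space 1) (?e ` {-2<..<2})"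
    by (rule connectedin_continuous_map_image) simp
  moreover have "?e ` {-2<..<2} = time_interval"
  proof (intro Set.set_eqI iffI)
    fix r assume r: "r \<in> time_interval"
    then have "r = ?e (r 0)" by (auto simp: time_interval_def in_cart_iff fun_eq_iff)
    moreover have "r 0 \<in> {-2<..<2}" using r by (auto simp: time_interval_def abs_less_iff)
    ultimately show "r \<in> ?e ` {-2<..<2}" by blast
  qed (auto simp: time_interval_def in_cart_iff)
  ultimately show ?thesis by simp
qed

lemma continuous_map_plot:
  assumes "(m, S, p) \<in> \<D>" "p ` S \<subseteq> topspace (D_topology X \<D>)" "S \<subseteq> cart m" "openin (Euclidean_space m) S"
  shows "continuous_map (subtopology (Euclidean_space m) S) (D_topology X \<D>) p"
  unfolding continuous_map_def
proof (intro conjI allI impI)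
  show "p \<in> topspace (subtopology (Euclidean_space m) S) \<rightarrow> topspace (D_topology X \<D>)"
    using assms(2,3) by auto
  fix U assume "openin (D_topology X \<D>) U"
  then have "openin (Euclidean_space m) {r \<in> S. p r \<in> U}"
    using assms(1) by (auto simp: openin_D_topology)
  then show "openin (subtopology (Euclidean_space m) S) {x \<in> topspace (subtopology (Euclidean_space m) S). p x \<in> U}"
    using assms(3,4) by (simp add: openin_open_subtopology Int_absorb1)
qed

context
  fixes M :: "'a mfd" and F :: "'a set set"
  assumes M: "manifold M" and F: "partition_on (points M) F"
begin

text \<open>The whole group pulls back to the full domain of every plot, which is open.\<close>

lemma topspace_leaf_group:
  "topspace (D_topology (leaf_group M F) (subspace_diffeology (functional_diffeology M) (leaf_group M F))) =
   leaf_group M F"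
proof -
  let ?T = "D_topology (leaf_group M F) (subspace_diffeology (functional_diffeology M) (leaf_group M F))"
  have "{r \<in> S. p r \<in> leaf_group M F} = S"
    if "(m, S, p) \<in> subspace_diffeology (functional_diffeology M) (leaf_group M F)" for m S p
    using that by (auto simp: subspace_diffeology_def)
  then have "openin ?T (leaf_group M F)"
    by (auto simp: openin_D_topology subspace_diffeology_def functional_diffeology_def)
  then show ?thesis
    using openin_subset[of ?T] openin_topspace[of ?T] unfolding openin_D_topology by blast
qed

lemma D_connected_leaf_group:
  "D_connected (leaf_group M F) (subspace_diffeology (functional_diffeology M) (leaf_group M F))"
proof -
  let ?D = "subspace_diffeology (functional_diffeology M) (leaf_group M F)"
  let ?T = "D_topology (leaf_group M F) ?D"
  define \<U> where "\<U> = {P ` time_interval |P. leaf_path M F P}"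
  have "connectedin ?T (P ` time_interval)" if P: "leaf_path M F P" for P
  proof -
    have "P ` time_interval \<subseteq> topspace ?T" unfolding topspace_leaf_group using leaf_groupI[OF M F P] by blast
    then have "continuous_map (subtopology (Euclidean_space 1) time_interval) ?T P"
      by (rule continuous_map_plot[OF leaf_path_plot[OF M F P] _ openin_subset[OF openin_time_interval]
            openin_time_interval])
    moreover have "connectedin (subtopology (Euclidean_space 1) time_interval) time_interval"
      using connectedin_time_interval by (simp add: connectedin_subtopology)
    ultimately show ?thesis by (rule connectedin_continuous_map_image)
  qed
  then have "connectedin ?T (\<Union>\<U>)"
  proof (intro connectedin_Union)
    \<comment> \<open>The path images are connected and share the identity, so their union is
      connected.\<close>
    have "(\<lambda>x\<in>points M. x) \<in> P ` time_interval" if "leaf_path M F P" for P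
      using that zero_in_time_interval unfolding leaf_path_def by (metis image_eqI)
    then show "\<Inter>\<U> \<noteq> {}" unfolding \<U>_def by blast
  qed (auto simp: \<U>_def)
  moreover have "\<Union>\<U> = leaf_group M F" by (auto simp: \<U>_def leaf_group_def)
  ultimately show ?thesis
    unfolding D_connected_def using connectedin_topspace[of ?T] by (simp add: topspace_leaf_group)
qed

lemma subgroup_leaf_group: "subgroup (leaf_group M F) (Diff M)"
proof -
  have B: "g \<in> Bij (points M)" if "g \<in> diffeos M" for g using that by (simp add: diffeos_def)
  note d = subsetD[OF leaf_group_diffeos[OF M F]]
  have inv: "inv\<^bsub>Diff M\<^esub> g = (\<lambda>x\<in>points M. inv_into (points M) g x)" if g: "g \<in> leaf_group M F" for g
  proof -
    let ?h = "\<lambda>x\<in>points M. inv_into (points M) g x"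
    have gB: "g \<in> Bij (points M)" using B d g by blast
    have hB: "?h \<in> Bij (points M)" by (rule restrict_inv_into_Bij[OF gB])
    have hd: "?h \<in> diffeos M" using d[OF leaf_group_inverse[OF M F g]] .
    have 1: "compose (points M) ?h g = (\<lambda>x\<in>points M. x)"
      by (rule Bij_compose_restrict_eq[OF gB])
    have 2: "compose (points M) g ?h = (\<lambda>x\<in>points M. x)"
      using gB by (auto simp: compose_def Bij_def bij_betw_def f_inv_into_f)
    \<comment> \<open>The inverse in \<open>Diff M\<close> is a definite description over its
      carrier; existence and uniqueness are verified directly from the composition of maps.\<close>
    have "(THE y. y \<in> diffeos M \<and> compose (points M) g y = (\<lambda>x\<in>points M. x) \<and>
        compose (points M) y g = (\<lambda>x\<in>points M. x)) = ?h"
    proof (rule the_equality)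
      show "?h \<in> diffeos M \<and> compose (points M) g ?h = (\<lambda>x\<in>points M. x) \<and>
        compose (points M) ?h g = (\<lambda>x\<in>points M. x)" using hd 1 2 by blast
      fix y assume y: "y \<in> diffeos M \<and> compose (points M) g y = (\<lambda>x\<in>points M. x) \<and>
        compose (points M) y g = (\<lambda>x\<in>points M. x)"
      have "compose (points M) y (compose (points M) g ?h) = compose (points M) (compose (points M) y g) ?h"
        by (rule compose_assoc) (use Bij_imp_funcset[OF hB] in blast)
      then show "y = ?h"
        using y 2 Bij_imp_extensional[OF hB] Bij_imp_extensional[OF B[of y]]
          Bij_imp_funcset[OF hB] Bij_imp_funcset[OF B[of y]]
        by (simp add: Id_compose compose_Id)
    qed
    then show ?thesis
      unfolding m_inv_def Diff_def using gB B
      by (simp add: BijGroup_def cong: conj_cong)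
  qed
  show ?thesis
  proof (rule subgroup.intro)
    show "leaf_group M F \<subseteq> carrier (Diff M)" using leaf_group_diffeos[OF M F] by (simp add: Diff_def)
    show "\<one>\<^bsub>Diff M\<^esub> \<in> leaf_group M F"
      using leaf_group_ident[OF M F] by (simp add: Diff_def BijGroup_def)
    fix g h assume gh: "g \<in> leaf_group M F"
    show "inv\<^bsub>Diff M\<^esub> g \<in> leaf_group M F" using leaf_group_inverse[OF M F gh] inv[OF gh] by simp
    assume h: "h \<in> leaf_group M F"
    show "g \<otimes>\<^bsub>Diff M\<^esub> h \<in> leaf_group M F"
      using leaf_group_compose[OF M F gh h] B[OF d[OF gh]] B[OF d[OF h]]
      by (simp add: Diff_def BijGroup_def)
  qed
qed

end


section \<open>Orbits\<close>

lemma extend_by_id_chart: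
  assumes "inj_on \<psi> V" "x \<in> V" "f (\<psi> x) \<in> \<psi> ` V"
  shows "extend_by_id V \<psi> f x \<in> V" "\<psi> (extend_by_id V \<psi> f x) = f (\<psi> x)"
  using assms by (auto simp: extend_by_id_def f_inv_into_f inv_into_into)

text \<open>Within the chart any leaf is \<open>U\<close> times some set of transverse coordinates,
  so membership depends on the transverse block alone, and a displacement along \<open>u\<close> in
  \<open>cart k\<close> does not affect that block.\<close>

lemma extend_by_id_leaf:
  assumes inj: "inj_on \<psi> V" and V: "\<psi> ` V = {cat k a b |a b. a \<in> U \<and> b \<in> W}"
    and L: "\<psi> ` (L \<inter> V) = {cat k a b |a b. a \<in> U \<and> b \<in> l}"
    and u: "u \<in> cart k" and f: "f (\<psi> x) = (\<lambda>i. \<psi> x i + s * u i)" "f (\<psi> x) \<in> \<psi> ` V" and x: "x \<in> L" "x \<in> V"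
  shows "extend_by_id V \<psi> f x \<in> L"
proof -
  obtain a b where ab: "\<psi> x = cat k a b" "a \<in> U" "b \<in> l" using L x by blast
  obtain a' b' where ab': "f (\<psi> x) = cat k a' b'" "a' \<in> U" using f(2) unfolding V by blast
  \<comment> \<open>\<open>u\<close> vanishes from index \<open>k\<close> on, so the transverse
    block is unchanged.\<close>
  have "b' = block2 k (f (\<psi> x))" by (simp add: ab'(1) block2_cat)
  also have "\<dots> = block2 k (\<psi> x)" using u by (simp add: f(1) block2_def in_cart_iff)
  also have "\<dots> = b" by (simp add: ab(1) block2_cat)
  finally have "f (\<psi> x) \<in> \<psi> ` (L \<inter> V)" unfolding L using ab(3) ab' by blast
  then obtain y where y: "y \<in> L" "y \<in> V" "f (\<psi> x) = \<psi> y" by blast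
  then show ?thesis using inj x(2) by (simp add: extend_by_id_def)
qed

text \<open>Here \<open>k\<close> is one number for all leaves. Both \<open>f\<close> and its
  inverse \<open>g\<close> send each leaf into itself, which gives equality of the image with the
  leaf.\<close>

lemma leaf_path_local_flow:
  assumes M: "manifold M" and F: "partition_on (points M) F" and A: "(V, \<psi>) \<in> atlas M"
    and V: "\<psi> ` V = {cat k a b |a b. a \<in> U \<and> b \<in> W}"
    and L: "\<And>L. L \<in> F \<Longrightarrow> \<exists>l. \<psi> ` (L \<inter> V) = {cat k a b |a b. a \<in> U \<and> b \<in> l}"
    and K: "compactin (Euclidean_space (mdim M)) K" "K \<subseteq> \<psi> ` V"
    and u: "u \<in> cart k" and fl: "local_flow (mdim M) (\<psi> ` V) K u f g"
  shows "leaf_path M F (\<lambda>r. \<lambda>x\<in>points M. extend_by_id V \<psi> (f (r 0)) x)"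
proof -
  let ?X = "points M" and ?J = time_interval
  let ?f = "\<lambda>r. extend_by_id V \<psi> (f (r 0))" and ?g = "\<lambda>r. extend_by_id V \<psi> (g (r 0))"
  note c = is_chartD[OF maximal_mfd_is_chart[OF manifold_maximal[OF M] A]]
  have J: "\<bar>r 0\<bar> < 2" if "r \<in> ?J" for r using that by (simp add: time_interval_def)
  have fO: "f t x \<in> \<psi> ` V" "g t x \<in> \<psi> ` V" "g t (f t x) = x" "f t (g t x) = x"
    "\<exists>a. f t x = (\<lambda>i. x i + a * u i)" "\<exists>a. g t x = (\<lambda>i. x i + a * u i)"
    "x \<notin> K \<Longrightarrow> f t x = x" "x \<notin> K \<Longrightarrow> g t x = x" if "\<bar>t\<bar> < 2" "x \<in> \<psi> ` V" for t x
    using fl that unfolding local_flow_def by blast+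
  have smf: "smooth_family 1 ?J M ?f"
    by (rule smooth_family_extend_by_id[OF M A K _ fO(1,7)]) (use fl in \<open>simp add: local_flow_def\<close>)
  have smg: "smooth_family 1 ?J M ?g"
    by (rule smooth_family_extend_by_id[OF M A K _ fO(2,8)]) (use fl in \<open>simp add: local_flow_def\<close>)
  have pf: "?f r x \<in> ?X" and pg: "?g r x \<in> ?X" if "r \<in> ?J" "x \<in> ?X" for r x
    using smooth_family_points[OF openin_time_interval M smf that]
      smooth_family_points[OF openin_time_interval M smg that] .
  have gf: "?g r (?f r x) = x" and fg: "?f r (?g r x) = x" if r: "r \<in> ?J" for r x
  proof -
    show "?g r (?f r x) = x"
    proof (cases "x \<in> V")
      case True
      then have x: "\<psi> x \<in> \<psi> ` V" by blast
      note e = extend_by_id_chart[where f = "f (r 0)", OF c(3) True fO(1)[OF J[OF r] x]]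
      show ?thesis
        using e fO(3)[OF J[OF r] x] True c(3) by (simp add: extend_by_id_def[of V \<psi> "g (r 0)"])
    qed (simp add: extend_by_id_def)
    show "?f r (?g r x) = x"
    proof (cases "x \<in> V")
      case True
      then have x: "\<psi> x \<in> \<psi> ` V" by blast
      note e = extend_by_id_chart[where f = "g (r 0)", OF c(3) True fO(2)[OF J[OF r] x]]
      show ?thesis
        using e fO(4)[OF J[OF r] x] True c(3) by (simp add: extend_by_id_def[of V \<psi> "f (r 0)"])
    qed (simp add: extend_by_id_def)
  qed
  have Lf: "?f r x \<in> L" and Lg: "?g r x \<in> L" if r: "r \<in> ?J" and LF: "L \<in> F" and x: "x \<in> L" for r L x
  proof -
    obtain l where l: "\<psi> ` (L \<inter> V) = {cat k a b |a b. a \<in> U \<and> b \<in> l}" using L[OF LF] by blast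
    have "?f r x \<in> L \<and> ?g r x \<in> L"
    proof (cases "x \<in> V")
      case True
      then have px: "\<psi> x \<in> \<psi> ` V" by blast
      note fx = fO[OF J[OF r] px]
      obtain a b where "f (r 0) (\<psi> x) = (\<lambda>i. \<psi> x i + a * u i)" "g (r 0) (\<psi> x) = (\<lambda>i. \<psi> x i + b * u i)"
        using fx(5,6) by blast
      then show ?thesis
        using extend_by_id_leaf[where f = "f (r 0)", OF c(3) V l u _ fx(1) x True]
          extend_by_id_leaf[where f = "g (r 0)", OF c(3) V l u _ fx(2) x True]
        by blast
    qed (simp add: extend_by_id_def x)
    then show "?f r x \<in> L" "?g r x \<in> L" by blast+
  qed
  have LX: "L \<subseteq> ?X" if "L \<in> F" for L using F that by (auto simp: partition_on_def)
  have inj: "inj_on (\<lambda>x\<in>?X. ?f r x) ?X" if "r \<in> ?J" for r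
    by (rule inj_on_inverseI[of _ "?g r"]) (simp add: gf[OF that])
  have im: "(\<lambda>x\<in>?X. ?f r x) ` L = L" if "r \<in> ?J" "L \<in> F" for r L
  proof
    show "(\<lambda>x\<in>?X. ?f r x) ` L \<subseteq> L" using Lf[OF that] LX[OF that(2)] by auto
    show "L \<subseteq> (\<lambda>x\<in>?X. ?f r x) ` L"
    proof
      fix x assume x: "x \<in> L"
      have "x = (\<lambda>x\<in>?X. ?f r x) (?g r x)"
        using Lg[OF that x] LX[OF that(2)] fg[OF that(1), of x] by auto
      then show "x \<in> (\<lambda>x\<in>?X. ?f r x) ` L" using Lg[OF that x] by blast
    qed
  qed
  have imX: "(\<lambda>x\<in>?X. ?f r x) ` ?X = ?X" if "r \<in> ?J" for r
  proof
    show "(\<lambda>x\<in>?X. ?f r x) ` ?X \<subseteq> ?X" using pf[OF that] by auto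
    show "?X \<subseteq> (\<lambda>x\<in>?X. ?f r x) ` ?X"
    proof
      fix x assume x: "x \<in> ?X"
      have "x = (\<lambda>x\<in>?X. ?f r x) (?g r x)" using pg[OF that x] fg[OF that, of x] by simp
      then show "x \<in> (\<lambda>x\<in>?X. ?f r x) ` ?X" using pg[OF that x] by blast
    qed
  qed
  have B: "(\<lambda>x\<in>?X. ?f r x) \<in> Bij ?X" if "r \<in> ?J" for r
    using inj[OF that] imX[OF that] by (simp add: Bij_def bij_betw_def)
  have inv: "inv_into ?X (\<lambda>x\<in>?X. ?f r x) x = ?g r x" if "r \<in> ?J" "x \<in> ?X" for r x
    by (rule inv_into_f_eq[OF inj[OF that(1)] pg[OF that]]) (simp add: pg[OF that] fg[OF that(1)])
  have "smooth_family 1 ?J M (\<lambda>r. \<lambda>x\<in>?X. ?f r x)"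
    by (rule smooth_family_cong[OF openin_time_interval M smf]) simp
  moreover have "smooth_family 1 ?J M (\<lambda>r. inv_into ?X (\<lambda>x\<in>?X. ?f r x))"
    by (rule smooth_family_cong[OF openin_time_interval M smg]) (simp add: inv)
  moreover have "?f (\<lambda>_. 0) x = x" for x
  proof (cases "x \<in> V")
    case True
    then have "f 0 (\<psi> x) = \<psi> x" using fl by (auto simp: local_flow_def)
    then show ?thesis using True c(3) by (simp add: extend_by_id_def)
  qed (simp add: extend_by_id_def)
  then have "(\<lambda>x\<in>?X. ?f (\<lambda>_. 0) x) = (\<lambda>x\<in>?X. x)" by simp
  ultimately show ?thesis
    unfolding leaf_path_def using B im by blast
qed

section \<open>Openness of plaques in the leaf\<close>

lemma submfd_structure:
  assumes "weakly_embedded M L"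
  shows "submanifold_structure M L (submfd M L)"
  using assms unfolding weakly_embedded_def diffeological_submanifold_def submfd_def
  by (blast intro: someI_ex)

text \<open>A plaque is a plot of the leaf, and its dimension is that of the leaf, so invariance of domain
  makes it open.\<close>

lemma openin_plaque:
  assumes M: "manifold M" and A: "(V, \<psi>) \<in> atlas M" and N: "submanifold_structure M L N"
    and k: "mdim N \<le> mdim M" and B: "openin (Euclidean_space (mdim N)) B" "B \<subseteq> \<psi> ` V"
    and BL: "inv_into V \<psi> ` B \<subseteq> L"
  shows "openin (mfd_topology N) (inv_into V \<psi> ` B)"
proof -
  let ?p = "inv_into V \<psi>" and ?k = "mdim N"
  note c = is_chartD[OF maximal_mfd_is_chart[OF manifold_maximal[OF M] A]]
  have mN: "manifold N" and pN: "points N = L"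
    and dN: "manifold_diffeology N = subspace_diffeology (manifold_diffeology M) L"
    using N by (auto simp: submanifold_structure_def)
  have Bk: "B \<subseteq> cart ?k" using openin_subset[OF B(1)] .
  note refB = cart_mfd_ref_chart[OF B(1)] and maxB = maximal_cart_mfd[OF B(1)]
  have "smooth_map (cart_mfd ?k B) M ?p"
  proof (rule smooth_mapI[OF maxB])
    show "?p ` points (cart_mfd ?k B) \<subseteq> points M"
      using B(2) c(1) by (auto intro: inv_into_into)
    fix z assume z: "z \<in> points (cart_mfd ?k B)"
    have "smooth_in_charts ?k B (\<lambda>x\<in>B. x) (mdim M) V \<psi> ?p z"
    proof (rule smooth_in_chartsI[where N = B and h = "\<lambda>z. z", OF B(1)])
      \<comment> \<open>Vectors are sequences ending in zeros, so the inclusion of the smaller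
        Cartesian space as the first coordinates is the identity function.\<close>
      have "B \<subseteq> cart (mdim M)" using Bk k by (auto simp: in_cart_iff)
      then show "smooth_cart ?k B (mdim M) (\<lambda>z. z)"
        by (simp add: smooth_cart_def smooth_fun_coord[OF B(1)])
      show "?p (inv_into B (\<lambda>x\<in>B. x) z) \<in> V" "z = \<psi> (?p (inv_into B (\<lambda>x\<in>B. x) z))" if "z \<in> B" for z
        using that B(2) by (auto simp: inv_into_restrict_id f_inv_into_f intro: inv_into_into)
    qed (use z in auto)
    then show "\<exists>D \<phi> E \<xi>. (D, \<phi>) \<in> atlas (cart_mfd ?k B) \<and> (E, \<xi>) \<in> atlas M \<and>
        smooth_in_charts (mdim (cart_mfd ?k B)) D \<phi> (mdim M) E \<xi> ?p z"
      using refB A unfolding ref_chart_def by (intro exI[of _ B] exI[of _ "\<lambda>x\<in>B. x"] exI[of _ V] exI[of _ \<psi>]) simp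
  qed
  then have "(?k, B, ?p) \<in> manifold_diffeology M"
    using B(1) by (simp add: manifold_diffeology_def)
  \<comment> \<open>The plots of \<open>N\<close> are exactly the plots of \<open>M\<close> with
    values in \<open>L\<close>; this turns smoothness into \<open>M\<close> into smoothness into the
    leaf.\<close>
  then have "(?k, B, ?p) \<in> manifold_diffeology N"
    unfolding dN using BL by (simp add: subspace_diffeology_def)
  then have p: "smooth_map (cart_mfd ?k B) N ?p" by (simp add: manifold_diffeology_def)
  have "openin (Euclidean_space ?k) (\<xi> ` (?p ` B \<inter> E))" if E: "(E, \<xi>) \<in> atlas N" for E \<xi>
  proof (subst openin_subopen, intro ballI)
    fix y assume "y \<in> \<xi> ` (?p ` B \<inter> E)"
    then obtain z where z: "z \<in> B" "?p z \<in> E" "y = \<xi> (?p z)" by blast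
    have rE: "ref_chart N E \<xi>" using E by (simp add: manifold_ref_chart[OF mN])
    have "smooth_in_charts ?k B (\<lambda>x\<in>B. x) ?k E \<xi> ?p z"
      using smooth_map_in_charts[where f = ?p and x = z, OF maxB manifold_maximal[OF mN] p z(1) refB rE z(2)]
      by simp
    then obtain Q where Q: "openin (Euclidean_space ?k) Q" "(\<lambda>x\<in>B. x) z \<in> Q" "Q \<subseteq> (\<lambda>x\<in>B. x) ` B"
     "\<forall>z\<in>Q. ?p (inv_into B (\<lambda>x\<in>B. x) z) \<in> E" "smooth_cart ?k Q ?k (\<lambda>z. \<xi> (?p (inv_into B (\<lambda>x\<in>B. x) z)))"
      unfolding smooth_in_charts_def by (elim conjE exE)
    have QB: "Q \<subseteq> B" using Q(3) by auto
    have zQ: "z \<in> Q" using Q(2) z(1) by simp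
    have QE: "?p z \<in> E" if "z \<in> Q" for z
      using bspec[OF Q(4) that] QB that by (simp add: inv_into_restrict_id subset_iff)
    have sm: "smooth_cart ?k Q ?k (\<lambda>z. \<xi> (?p z))"
      by (rule smooth_cart_cong[OF Q(1) _ Q(5)]) (use QB in \<open>simp add: inv_into_restrict_id subset_iff\<close>)
    \<comment> \<open>Source and target both have dimension \<open>mdim N\<close>, so injectivity is
      what remains for invariance of domain.\<close>
    have "inj_on (\<lambda>z. \<xi> (?p z)) Q"
    proof (rule inj_onI)
      fix z z' assume *: "z \<in> Q" "z' \<in> Q" "\<xi> (?p z) = \<xi> (?p z')"
      then have "?p z = ?p z'"
        using QE ref_chart_inj[OF manifold_maximal[OF mN] rE] by (auto dest: inj_onD)
      moreover have "z \<in> \<psi> ` V" "z' \<in> \<psi> ` V" using * QB B(2) by auto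
      ultimately show "z = z'" by (metis f_inv_into_f)
    qed
    then have "openin (Euclidean_space ?k) ((\<lambda>z. \<xi> (?p z)) ` Q)"
      by (rule invariance_of_domain_Euclidean_space[OF Q(1) smooth_cart_continuous_map[OF Q(1) sm]])
    moreover have "(\<lambda>z. \<xi> (?p z)) ` Q \<subseteq> \<xi> ` (?p ` B \<inter> E)" using QB QE by blast
    ultimately show "\<exists>T. openin (Euclidean_space ?k) T \<and> y \<in> T \<and> T \<subseteq> \<xi> ` (?p ` B \<inter> E)"
      using zQ z(3) by blast
  qed
  then show ?thesis
    unfolding openin_mfd_topology[OF manifold_smooth_atlas[OF mN]] using BL pN by auto
qed

text \<open>A point \<open>b\<close> of a cube in \<open>cart k\<close> ends in zeros and hence
  equals \<open>cat k b 0\<close>. So the cube of reachable coordinates lies in the plaque through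
  the centre, and \<open>openin_plaque\<close> applies to it.\<close>

lemma leaf_group_neighbourhood:
  assumes M: "manifold M" and F: "singular_foliation M F" and L: "L \<in> F" and z: "z \<in> L"
  shows "\<exists>Y. openin (mfd_topology (submfd M L)) Y \<and> z \<in> Y \<and> (\<forall>y\<in>Y. \<exists>g\<in>leaf_group M F. g z = y)"
proof -
  let ?N = "submfd M L"
  let ?k = "mdim ?N" and ?n = "mdim M"
  have part: "partition_on (points M) F" and we: "weakly_embedded M L"
    using F L by (auto simp: singular_foliation_def)
  have zM: "z \<in> points M" using part L z by (auto simp: partition_on_def)
  have N: "submanifold_structure M L ?N" by (rule submfd_structure[OF we])
  have "\<forall>L\<in>F. \<forall>x\<in>L. \<exists>(V, \<psi>)\<in>atlas M. \<exists>U W. let k = mdim (submfd M L) in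
        x \<in> V \<and>
        openin (Euclidean_space k) U \<and> (\<lambda>_. 0) \<in> U \<and>
        openin (Euclidean_space (mdim M - k)) W \<and> (\<lambda>_. 0) \<in> W \<and>
        \<psi> ` V = {cat k u w |u w. u \<in> U \<and> w \<in> W} \<and>
        \<psi> x = (\<lambda>_. 0) \<and>
        (\<forall>L\<in>F. \<exists>l\<subseteq>W. \<psi> ` (L \<inter> V) = {cat k u w |u w. u \<in> U \<and> w \<in> l})"
    using F unfolding singular_foliation_def by (elim conjE)
  note chart = bspec[OF bspec[OF this L] z, unfolded Let_def case_prod_unfold]
  obtain q U W where q: "q \<in> atlas M" and *: "z \<in> fst q \<and>
        openin (Euclidean_space ?k) U \<and> (\<lambda>_. 0) \<in> U \<and>
        openin (Euclidean_space (?n - ?k)) W \<and> (\<lambda>_. 0) \<in> W \<and>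
        snd q ` fst q = {cat ?k u w |u w. u \<in> U \<and> w \<in> W} \<and>
        snd q z = (\<lambda>_. 0) \<and>
        (\<forall>L\<in>F. \<exists>l\<subseteq>W. snd q ` (L \<inter> fst q) = {cat ?k u w |u w. u \<in> U \<and> w \<in> l})"
    using chart by (elim bexE exE) (rule that)
  define V \<psi> where "V = fst q" and "\<psi> = snd q"
  note defs = V_def[symmetric] \<psi>_def[symmetric]
  have A: "(V, \<psi>) \<in> atlas M" using q by (simp add: V_def \<psi>_def)
  have zV: "z \<in> V" and U: "openin (Euclidean_space ?k) U" "(\<lambda>_. 0) \<in> U" and W: "(\<lambda>_. 0) \<in> W"
    and V: "\<psi> ` V = {cat ?k a b |a b. a \<in> U \<and> b \<in> W}" and z0: "\<psi> z = (\<lambda>_. 0)"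
    and Ls: "\<forall>L\<in>F. \<exists>l\<subseteq>W. \<psi> ` (L \<inter> V) = {cat ?k a b |a b. a \<in> U \<and> b \<in> l}"
    using *[unfolded defs] by - (elim conjE, assumption)+
  note c = is_chartD[OF maximal_mfd_is_chart[OF manifold_maximal[OF M] A]]
  \<comment> \<open>The chart condition contains the truncated difference \<open>mdim M - k\<close>
    and does not state this inequality. If it failed, \<open>U\<close> would contain a vector with
    nonzero coordinate at index \<open>mdim M\<close>, which no chart value has.\<close>
  have k: "?k \<le> ?n"
  proof (rule ccontr)
    assume nk: "\<not> ?k \<le> ?n"
    obtain e where e: "e > 0" "cube ?k (\<lambda>_. 0) e \<subseteq> U"
      using U openin_Euclidean_space_iff_cube by metis
    define a where "a = (\<lambda>i. if i = ?n then e / 2 else 0)"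
    have "a \<in> U" using e nk by (auto simp: a_def cube_def in_cart_iff intro!: subsetD[OF e(2)])
    then have "cat ?k a (\<lambda>_. 0) \<in> \<psi> ` V" unfolding V using W by blast
    then have "cat ?k a (\<lambda>_. 0) \<in> cart ?n" using openin_subset[OF c(4)] by blast
    then have "cat ?k a (\<lambda>_. 0) ?n = 0" by (simp add: in_cart_iff)
    then show False using nk e(1) by (simp add: cat_def a_def)
  qed
  have zero: "(\<lambda>_. 0) \<in> \<psi> ` V" using z0 zV by (metis image_eqI)
  obtain K d where K: "compactin (Euclidean_space ?n) K" "K \<subseteq> \<psi> ` V" and d: "d > 0"
    and fl: "\<And>u. u \<in> cart ?n \<Longrightarrow> (\<And>i. i < ?n \<Longrightarrow> \<bar>u i\<bar> < 1) \<Longrightarrow>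
       \<exists>f g. local_flow ?n (\<psi> ` V) K u f g \<and> f 1 (\<lambda>_. 0) = (\<lambda>i. d * u i)"
    by (rule exists_local_flow[OF c(4) zero]) blast
  let ?B = "cube ?k (\<lambda>_. 0) d"
  have oB: "openin (Euclidean_space ?k) ?B" by (rule openin_cube)
  have reach: "b \<in> \<psi> ` V \<and> (\<exists>g\<in>leaf_group M F. g z = inv_into V \<psi> b)" if b: "b \<in> ?B" for b
  proof -
    \<comment> \<open>The time-one map sends the centre to \<open>d u\<close>, so
      \<open>u = b/d\<close> hits \<open>b\<close>, and \<open>u\<close> has entries below 1 in
      modulus because \<open>b\<close> lies in the cube of radius \<open>d\<close>.\<close>
    define u where "u = (\<lambda>i. b i / d)"
    have uk: "u \<in> cart ?k" using b by (simp add: u_def cube_def in_cart_iff)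
    have un: "u \<in> cart ?n" using uk k by (simp add: in_cart_iff)
    have ub: "\<bar>u i\<bar> < 1" for i
    proof (cases "i < ?k")
      case True
      then show ?thesis using b d by (simp add: u_def cube_def abs_divide)
    next
      case False
      then show ?thesis using uk by (simp add: in_cart_iff)
    qed
    obtain f g where f: "local_flow ?n (\<psi> ` V) K u f g" "f 1 (\<lambda>_. 0) = (\<lambda>i. d * u i)"
      using fl[OF un ub] by blast
    have fb: "f 1 (\<lambda>_. 0) = b" using f(2) d by (simp add: u_def)
    \<comment> \<open>The local flow maps the chart image into itself, and time 1 is admissible;
      hence the whole cube lies in the chart image.\<close>
    have bV: "b \<in> \<psi> ` V" using f(1) zero fb unfolding local_flow_def
      by (metis abs_one one_less_numeral_iff semiring_norm(76))
    let ?P = "\<lambda>r. \<lambda>x\<in>points M. extend_by_id V \<psi> (f (r 0)) x"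
    have P: "leaf_path M F ?P"
      by (rule leaf_path_local_flow[OF M part A V _ K uk f(1)]) (use Ls in blast)
    let ?e = "\<lambda>i. if i = 0 then 1 else 0 :: real"
    have e: "?e \<in> time_interval" by (auto simp: time_interval_def in_cart_iff)
    have "?P ?e \<in> leaf_group M F" using leaf_groupI[OF M part P e] by simp
    moreover have "?P ?e z = inv_into V \<psi> b" using zM zV by (simp add: extend_by_id_def z0 fb)
    ultimately show ?thesis using bV by blast
  qed
  let ?Y = "inv_into V \<psi> ` ?B"
  have BV: "?B \<subseteq> \<psi> ` V" using reach by blast
  have "?Y \<subseteq> L"
  proof
    fix y assume "y \<in> ?Y"
    then obtain g where g: "g \<in> leaf_group M F" "g z = y" using reach by blast
    then show "y \<in> L" using leaf_group_leaves[OF M part g(1) L] z by blast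
  qed
  then have "openin (mfd_topology ?N) ?Y" by (rule openin_plaque[OF M A N k oB BV])
  moreover have "z \<in> ?Y"
  proof (rule image_eqI)
    show "z = inv_into V \<psi> (\<lambda>_. 0)" using z0 zV c(3) by (metis inv_into_f_f)
    show "(\<lambda>_. 0) \<in> ?B" using d by (simp add: cube_def in_cart_iff)
  qed
  ultimately show ?thesis using reach by blast
qed

text \<open>A foliation chart can be centred at any point of the leaf, so an orbit contains a
  neighbourhood of each of its points and not just of \<open>x\<close>.\<close>

lemma orbit_leaf_group:
  assumes M: "manifold M" and F: "singular_foliation M F" and L: "L \<in> F" and x: "x \<in> L"
  shows "{g x |g. g \<in> leaf_group M F} = L"
proof -
  let ?T = "mfd_topology (submfd M L)"
  define O' where "O' = (\<lambda>x. {g x |g. g \<in> leaf_group M F})"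
  have part: "partition_on (points M) F" and we: "weakly_embedded M L" and conn: "connected_space ?T"
    using F L by (auto simp: singular_foliation_def)
  have LX: "L \<subseteq> points M" using part L by (auto simp: partition_on_def)
  have top: "topspace ?T = L"
    using submfd_structure[OF we] topspace_mfd_topology[OF manifold_smooth_atlas]
    by (auto simp: submanifold_structure_def)
  have OI: "g y \<in> O' y" if "g \<in> leaf_group M F" for g y using that by (auto simp: O'_def)
  have OL: "O' y \<subseteq> L" if "y \<in> L" for y
    using leaf_group_leaves[OF M part _ L] that by (auto simp: O'_def)
  have self: "y \<in> O' y" if "y \<in> L" for y
  proof -
    have "y = (\<lambda>x\<in>points M. x) y" using that LX by auto
    then show ?thesis using leaf_group_ident[OF M part] unfolding O'_def by blast
  qed
  have trans: "w \<in> O' y" if y: "y \<in> L" and v: "v \<in> O' y" and w: "w \<in> O' v" for y v w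
  proof -
    obtain g h where g: "g \<in> leaf_group M F" "v = g y" "h \<in> leaf_group M F" "w = h v"
      using v w unfolding O'_def by blast
    have "w = compose (points M) h g y" using g(2,4) y LX by (auto simp: compose_def)
    then show ?thesis using leaf_group_compose[OF M part g(3,1)] unfolding O'_def by blast
  qed
  have sym: "y \<in> O' v" if y: "y \<in> L" and v: "v \<in> O' y" for y v
  proof -
    obtain g where g: "g \<in> leaf_group M F" "v = g y" using v unfolding O'_def by blast
    have gB: "g \<in> Bij (points M)"
      using leaf_group_diffeos[OF M part] g(1) by (auto simp: diffeos_def)
    have "v \<in> points M" using OL[OF y] v LX by blast
    then have "y = (\<lambda>x\<in>points M. inv_into (points M) g x) v"
      using gB g(2) y LX by (auto simp: Bij_def bij_betw_def)
    then show ?thesis using leaf_group_inverse[OF M part g(1)] unfolding O'_def by blast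
  qed
  have op: "openin ?T (O' y)" if y: "y \<in> L" for y
  proof (subst openin_subopen, intro ballI)
    fix v assume v: "v \<in> O' y"
    then have vL: "v \<in> L" using OL[OF y] by blast
    obtain Y where Y: "openin ?T Y" "v \<in> Y" "\<forall>w\<in>Y. \<exists>g\<in>leaf_group M F. g v = w"
      using leaf_group_neighbourhood[OF M F L vL] by blast
    have "Y \<subseteq> O' v" using Y(3) OI by fastforce
    then have "Y \<subseteq> O' y" using trans[OF y v] by blast
    then show "\<exists>T. openin ?T T \<and> v \<in> T \<and> T \<subseteq> O' y" using Y by blast
  qed
  \<comment> \<open>The union of the other orbits in \<open>L\<close>. It is open as well, so
    connectedness of the leaf forces it to be empty.\<close>
  let ?R = "\<Union>y\<in>L - O' x. O' y"
  have oR: "openin ?T ?R" by (rule openin_Union) (use op in auto)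
  have cov: "topspace ?T \<subseteq> O' x \<union> ?R" unfolding top using self by blast
  have disj: "O' x \<inter> ?R = {}"
  proof (rule ccontr)
    assume "O' x \<inter> ?R \<noteq> {}"
    then obtain v y where v: "v \<in> O' x" "y \<in> L" "y \<notin> O' x" "v \<in> O' y" by blast
    have "y \<in> O' v" by (rule sym[OF v(2,4)])
    then show False using trans[OF x v(1)] v(3) by blast
  qed
  have "?R = {}"
    using conn op[OF x] oR cov disj self[OF x] unfolding connected_space_def by blast
  then have "L \<subseteq> O' x" using cov unfolding top by blast
  then show ?thesis using OL[OF x] unfolding O'_def by blast
qed

theorem proposition2p26:
  fixes M :: "'a mfd" and F :: "'a set set"
  assumes "manifold M" and "singular_foliation M F"
  shows "\<exists>G. subgroup G (Diff M) \<and>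
             D_connected G (subspace_diffeology (functional_diffeology M) G) \<and>
             F = orbits (Diff M\<lparr>carrier := G\<rparr>) (points M) (\<lambda>g. g)"
proof (intro exI[of _ "leaf_group M F"] conjI)
  have part: "partition_on (points M) F" using assms(2) by (simp add: singular_foliation_def)
  show "subgroup (leaf_group M F) (Diff M)" by (rule subgroup_leaf_group[OF assms(1) part])
  show "D_connected (leaf_group M F) (subspace_diffeology (functional_diffeology M) (leaf_group M F))"
    by (rule D_connected_leaf_group[OF assms(1) part])
  let ?G = "Diff M\<lparr>carrier := leaf_group M F\<rparr>"
  have orb: "orbit ?G (\<lambda>g. g) x = L" if "L \<in> F" "x \<in> L" for L x
    unfolding orbit_def using orbit_leaf_group[OF assms that] by simp
  show "F = orbits ?G (points M) (\<lambda>g. g)"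
  proof (intro Set.set_eqI iffI)
    fix L assume L: "L \<in> F"
    then have "L \<noteq> {}" "L \<subseteq> points M" using part by (auto simp: partition_on_def)
    then obtain x where x: "x \<in> L" "x \<in> points M" by blast
    show "L \<in> orbits ?G (points M) (\<lambda>g. g)"
      unfolding orbits_def using orb[OF L x(1)] x(2) by blast
  next
    fix L assume "L \<in> orbits ?G (points M) (\<lambda>g. g)"
    then obtain x where x: "x \<in> points M" "L = orbit ?G (\<lambda>g. g) x" unfolding orbits_def by blast
    then obtain L' where L': "L' \<in> F" "x \<in> L'" using part by (auto simp: partition_on_def)
    show "L \<in> F" using orb[OF L'] L'(1) x(2) by simp
  qed
qed

end
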